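(* Let $k$ be a field and let $(\mathcal C,\otimes,I,C)$ be a braided tensor category with a forgetful functor $F$ from $\mathcal C$ to the category of $k$-vector spaces such that $F(U\otimes V)=F(U)\otimes F(V)$ and $F(I)=k$. Let $H$ be a finite-dimensional braided Hopf algebra in $\mathcal C$. Then $H$ is semisimple as an ordinary algebra over $k$ if and only if $\epsilon(\int^l_H)\neq0$.
   Context: A braided Hopf algebra in $\mathcal C$ is a Hopf algebra object $(H,m,\eta,\Delta,\epsilon,S)$ in $\mathcal C$ (with $\Delta$ multiplicative for the braided tensor product algebra structure on $H\otimes H$); no condition $C_{H,H}=C_{H,H}^{-1}$ is assumed. Objects are identified with their underlying $k$-vector spaces. $\int^l_H=\{x\in H\mid hx=\epsilon(h)x\text{ for all }h\in H\}$. An ordinary $k$-algebra $H$ is semisimple if every $H$-submodule of every $H$-module is a direct summand as an $H$-module. *)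

theory Defs
  imports "Jordan_Normal_Form.Missing_VectorSpace"
begin

section \<open>Braided tensor categories\<close>

record ('o, 'a) braided_cat =
  Ob :: "'o set"
  Hom :: "'o \<Rightarrow> 'o \<Rightarrow> 'a set"
  Idn :: "'o \<Rightarrow> 'a"
  Comp :: "'a \<Rightarrow> 'a \<Rightarrow> 'a"  (infixl "\<cdot>\<index>" 60)
  TOb :: "'o \<Rightarrow> 'o \<Rightarrow> 'o"  (infixr "\<boxtimes>\<index>" 70)
  TAr :: "'a \<Rightarrow> 'a \<Rightarrow> 'a"  (infixr "\<star>\<index>" 70)
  Unit :: "'o"  ("\<I>\<index>")
  Assoc :: "'o \<Rightarrow> 'o \<Rightarrow> 'o \<Rightarrow> 'a"  ("\<alpha>\<index>")
  LUnit :: "'o \<Rightarrow> 'a"  ("\<lambda>\<^sub>I\<index>")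
  RUnit :: "'o \<Rightarrow> 'a"  ("\<rho>\<^sub>I\<index>")
  Braid :: "'o \<Rightarrow> 'o \<Rightarrow> 'a"  ("\<beta>\<index>")

definition inverse_arrows :: "('o, 'a, 'z) braided_cat_scheme \<Rightarrow> 'o \<Rightarrow> 'o \<Rightarrow> 'a \<Rightarrow> 'a \<Rightarrow> bool"
  where "inverse_arrows C U V f g \<longleftrightarrow>
    f \<in> Hom C U V \<and> g \<in> Hom C V U \<and> g \<cdot>\<^bsub>C\<^esub> f = Idn C U \<and> f \<cdot>\<^bsub>C\<^esub> g = Idn C V"

definition is_iso :: "('o, 'a, 'z) braided_cat_scheme \<Rightarrow> 'o \<Rightarrow> 'o \<Rightarrow> 'a \<Rightarrow> bool"
  where "is_iso C U V f \<longleftrightarrow> (\<exists>g. inverse_arrows C U V f g)"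

definition inv_arrow :: "('o, 'a, 'z) braided_cat_scheme \<Rightarrow> 'o \<Rightarrow> 'o \<Rightarrow> 'a \<Rightarrow> 'a"
  where "inv_arrow C U V f = (THE g. inverse_arrows C U V f g)"

definition Assoc_inv :: "('o, 'a, 'z) braided_cat_scheme \<Rightarrow> 'o \<Rightarrow> 'o \<Rightarrow> 'o \<Rightarrow> 'a"  ("\<alpha>\<^sub>i\<index>")
  where "\<alpha>\<^sub>i\<^bsub>C\<^esub> U V W =
    inv_arrow C ((U \<boxtimes>\<^bsub>C\<^esub> V) \<boxtimes>\<^bsub>C\<^esub> W) (U \<boxtimes>\<^bsub>C\<^esub> (V \<boxtimes>\<^bsub>C\<^esub> W)) (\<alpha>\<^bsub>C\<^esub> U V W)"

locale small_category =
  fixes C :: "('o, 'a, 'z) braided_cat_scheme" (structure)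
  assumes Hom_Ob: "f \<in> Hom C U V \<Longrightarrow> U \<in> Ob C \<and> V \<in> Ob C"
    and Hom_disjoint: "f \<in> Hom C U V \<Longrightarrow> f \<in> Hom C U' V' \<Longrightarrow> U = U' \<and> V = V'"
    and Idn_Hom: "U \<in> Ob C \<Longrightarrow> Idn C U \<in> Hom C U U"
    and Comp_Hom: "f \<in> Hom C U V \<Longrightarrow> g \<in> Hom C V W \<Longrightarrow> g \<cdot> f \<in> Hom C U W"
    and Comp_Idn: "f \<in> Hom C U V \<Longrightarrow> f \<cdot> Idn C U = f"
    and Idn_Comp: "f \<in> Hom C U V \<Longrightarrow> Idn C V \<cdot> f = f"
    and Comp_assoc: "f \<in> Hom C U V \<Longrightarrow> g \<in> Hom C V W \<Longrightarrow> h \<in> Hom C W X \<Longrightarrow>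
      (h \<cdot> g) \<cdot> f = h \<cdot> (g \<cdot> f)"

locale tensor_category = small_category C
  for C :: "('o, 'a, 'z) braided_cat_scheme" (structure) +
  assumes Unit_Ob: "\<I> \<in> Ob C"
    and TOb_Ob: "U \<in> Ob C \<Longrightarrow> V \<in> Ob C \<Longrightarrow> U \<boxtimes> V \<in> Ob C"
    and TAr_Hom: "f \<in> Hom C U U' \<Longrightarrow> g \<in> Hom C V V' \<Longrightarrow> f \<star> g \<in> Hom C (U \<boxtimes> V) (U' \<boxtimes> V')"
    and TAr_Idn: "U \<in> Ob C \<Longrightarrow> V \<in> Ob C \<Longrightarrow> Idn C U \<star> Idn C V = Idn C (U \<boxtimes> V)"
    and TAr_Comp: "f \<in> Hom C U U' \<Longrightarrow> f' \<in> Hom C U' U'' \<Longrightarrow>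
      g \<in> Hom C V V' \<Longrightarrow> g' \<in> Hom C V' V'' \<Longrightarrow> (f' \<cdot> f) \<star> (g' \<cdot> g) = (f' \<star> g') \<cdot> (f \<star> g)"
    and Assoc_iso: "U \<in> Ob C \<Longrightarrow> V \<in> Ob C \<Longrightarrow> W \<in> Ob C \<Longrightarrow>
      is_iso C ((U \<boxtimes> V) \<boxtimes> W) (U \<boxtimes> (V \<boxtimes> W)) (\<alpha> U V W)"
    and LUnit_iso: "U \<in> Ob C \<Longrightarrow> is_iso C (\<I> \<boxtimes> U) U (\<lambda>\<^sub>I U)"
    and RUnit_iso: "U \<in> Ob C \<Longrightarrow> is_iso C (U \<boxtimes> \<I>) U (\<rho>\<^sub>I U)"
    and Assoc_natural: "f \<in> Hom C U U' \<Longrightarrow> g \<in> Hom C V V' \<Longrightarrow> h \<in> Hom C W W' \<Longrightarrow>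
      \<alpha> U' V' W' \<cdot> ((f \<star> g) \<star> h) = (f \<star> (g \<star> h)) \<cdot> \<alpha> U V W"
    and LUnit_natural: "f \<in> Hom C U U' \<Longrightarrow> \<lambda>\<^sub>I U' \<cdot> (Idn C \<I> \<star> f) = f \<cdot> \<lambda>\<^sub>I U"
    and RUnit_natural: "f \<in> Hom C U U' \<Longrightarrow> \<rho>\<^sub>I U' \<cdot> (f \<star> Idn C \<I>) = f \<cdot> \<rho>\<^sub>I U"
    and pentagon: "U \<in> Ob C \<Longrightarrow> V \<in> Ob C \<Longrightarrow> W \<in> Ob C \<Longrightarrow> X \<in> Ob C \<Longrightarrow>
      (Idn C U \<star> \<alpha> V W X) \<cdot> \<alpha> U (V \<boxtimes> W) X \<cdot> (\<alpha> U V W \<star> Idn C X)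
      = \<alpha> U V (W \<boxtimes> X) \<cdot> \<alpha> (U \<boxtimes> V) W X"
    and triangle: "U \<in> Ob C \<Longrightarrow> V \<in> Ob C \<Longrightarrow>
      (Idn C U \<star> \<lambda>\<^sub>I V) \<cdot> \<alpha> U \<I> V = \<rho>\<^sub>I U \<star> Idn C V"

text \<open>No symmetry: \<open>\<beta> V U \<cdot> \<beta> U V\<close> need not be the identity.\<close>

locale braided_tensor_category = tensor_category C
  for C :: "('o, 'a, 'z) braided_cat_scheme" (structure) +
  assumes Braid_iso: "U \<in> Ob C \<Longrightarrow> V \<in> Ob C \<Longrightarrow> is_iso C (U \<boxtimes> V) (V \<boxtimes> U) (\<beta> U V)"
    and Braid_natural: "f \<in> Hom C U U' \<Longrightarrow> g \<in> Hom C V V' \<Longrightarrow>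
      \<beta> U' V' \<cdot> (f \<star> g) = (g \<star> f) \<cdot> \<beta> U V"
    and hexagon1: "U \<in> Ob C \<Longrightarrow> V \<in> Ob C \<Longrightarrow> W \<in> Ob C \<Longrightarrow>
      \<alpha> V W U \<cdot> \<beta> U (V \<boxtimes> W) \<cdot> \<alpha> U V W
      = (Idn C V \<star> \<beta> U W) \<cdot> \<alpha> V U W \<cdot> (\<beta> U V \<star> Idn C W)"
    and hexagon2: "U \<in> Ob C \<Longrightarrow> V \<in> Ob C \<Longrightarrow> W \<in> Ob C \<Longrightarrow>
      \<alpha>\<^sub>i W U V \<cdot> \<beta> (U \<boxtimes> V) W \<cdot> \<alpha>\<^sub>i U V W
      = (\<beta> U W \<star> Idn C V) \<cdot> \<alpha>\<^sub>i U W V \<cdot> (Idn C U \<star> \<beta> V W)"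

section \<open>Braided Hopf algebras\<close>

text \<open>The arrow \<open>(U \<boxtimes> V) \<boxtimes> (W \<boxtimes> X) \<rightarrow> (U \<boxtimes> W) \<boxtimes> (V \<boxtimes> X)\<close> that braids the inner factors; followed by
  \<open>m \<star> m\<close> it is the multiplication of the braided tensor product of two algebras.\<close>

definition braid_middle :: "('o, 'a, 'z) braided_cat_scheme \<Rightarrow> 'o \<Rightarrow> 'o \<Rightarrow> 'o \<Rightarrow> 'o \<Rightarrow> 'a"
  where "braid_middle C U V W X =
    \<alpha>\<^sub>i\<^bsub>C\<^esub> U W (V \<boxtimes>\<^bsub>C\<^esub> X)
    \<cdot>\<^bsub>C\<^esub> (Idn C U \<star>\<^bsub>C\<^esub> (\<alpha>\<^bsub>C\<^esub> W V X \<cdot>\<^bsub>C\<^esub> (\<beta>\<^bsub>C\<^esub> V W \<star>\<^bsub>C\<^esub> Idn C X) \<cdot>\<^bsub>C\<^esub> \<alpha>\<^sub>i\<^bsub>C\<^esub> V W X))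
    \<cdot>\<^bsub>C\<^esub> \<alpha>\<^bsub>C\<^esub> U V (W \<boxtimes>\<^bsub>C\<^esub> X)"

locale braided_hopf_algebra = braided_tensor_category C
  for C :: "('o, 'a, 'z) braided_cat_scheme" (structure) +
  fixes H :: 'o and m \<eta> \<Delta> \<epsilon> S :: 'a
  assumes H_Ob: "H \<in> Ob C"
    and m_Hom: "m \<in> Hom C (H \<boxtimes> H) H"
    and \<eta>_Hom: "\<eta> \<in> Hom C \<I> H"
    and \<Delta>_Hom: "\<Delta> \<in> Hom C H (H \<boxtimes> H)"
    and \<epsilon>_Hom: "\<epsilon> \<in> Hom C H \<I>"
    and S_Hom: "S \<in> Hom C H H"
    and mul_assoc: "m \<cdot> (m \<star> Idn C H) = m \<cdot> (Idn C H \<star> m) \<cdot> \<alpha> H H H"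
    and m_lunit: "m \<cdot> (\<eta> \<star> Idn C H) = \<lambda>\<^sub>I H"
    and m_runit: "m \<cdot> (Idn C H \<star> \<eta>) = \<rho>\<^sub>I H"
    and \<Delta>_coassoc: "\<alpha> H H H \<cdot> (\<Delta> \<star> Idn C H) \<cdot> \<Delta> = (Idn C H \<star> \<Delta>) \<cdot> \<Delta>"
    and \<Delta>_lcounit: "\<lambda>\<^sub>I H \<cdot> (\<epsilon> \<star> Idn C H) \<cdot> \<Delta> = Idn C H"
    and \<Delta>_rcounit: "\<rho>\<^sub>I H \<cdot> (Idn C H \<star> \<epsilon>) \<cdot> \<Delta> = Idn C H"
    and \<Delta>_m: "\<Delta> \<cdot> m = (m \<star> m) \<cdot> braid_middle C H H H H \<cdot> (\<Delta> \<star> \<Delta>)"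
    and \<Delta>_\<eta>: "\<Delta> \<cdot> \<eta> = (\<eta> \<star> \<eta>) \<cdot> inv_arrow C (\<I> \<boxtimes> \<I>) \<I> (\<lambda>\<^sub>I \<I>)"
    and \<epsilon>_m: "\<epsilon> \<cdot> m = \<lambda>\<^sub>I \<I> \<cdot> (\<epsilon> \<star> \<epsilon>)"
    and \<epsilon>_\<eta>: "\<epsilon> \<cdot> \<eta> = Idn C \<I>"
    and S_left: "m \<cdot> (S \<star> Idn C H) \<cdot> \<Delta> = \<eta> \<cdot> \<epsilon>"
    and S_right: "m \<cdot> (Idn C H \<star> S) \<cdot> \<Delta> = \<eta> \<cdot> \<epsilon>"

section \<open>Forgetful functors to vector spaces\<close>

definition bilinear_map ::
  "('k, 'y) ring_scheme \<Rightarrow> ('k, 'u) module \<Rightarrow> ('k, 'v) module \<Rightarrow> ('k, 'w) module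
    \<Rightarrow> ('u \<Rightarrow> 'v \<Rightarrow> 'w) \<Rightarrow> bool"
  where "bilinear_map K U V W b \<longleftrightarrow>
    (\<forall>u \<in> carrier U. linear_map K V W (\<lambda>v. b u v)) \<and>
    (\<forall>v \<in> carrier V. linear_map K U W (\<lambda>u. b u v))"

text \<open>The universal property is tested against spaces \<open>W\<close> on the type carrying \<open>U\<close>, \<open>V\<close> and \<open>T\<close>.
  Below the field lives on that type too, so \<open>W\<close> may be the field or \<open>T\<close>; taking these as test
  spaces already forces \<open>T\<close> to be the usual tensor product.\<close>

definition is_tensor_product ::
  "('k, 'y) ring_scheme \<Rightarrow> ('k, 'v) module \<Rightarrow> ('k, 'v) module \<Rightarrow> ('k, 'v) module
    \<Rightarrow> ('v \<Rightarrow> 'v \<Rightarrow> 'v) \<Rightarrow> bool"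
  where "is_tensor_product K U V T \<tau> \<longleftrightarrow>
    vectorspace K U \<and> vectorspace K V \<and> vectorspace K T \<and> bilinear_map K U V T \<tau> \<and>
    (\<forall>(W :: ('k, 'v) module) b. vectorspace K W \<longrightarrow> bilinear_map K U V W b \<longrightarrow>
      (\<exists>f. linear_map K T W f \<and> (\<forall>u \<in> carrier U. \<forall>v \<in> carrier V. f (\<tau> u v) = b u v)) \<and>
      (\<forall>f g. linear_map K T W f \<longrightarrow> linear_map K T W g \<longrightarrow>
        (\<forall>u \<in> carrier U. \<forall>v \<in> carrier V. f (\<tau> u v) = b u v \<and> g (\<tau> u v) = b u v) \<longrightarrow>
        (\<forall>t \<in> carrier T. f t = g t)))"

definition scalar_space :: "'v ring \<Rightarrow> ('v, 'v) module"
  where "scalar_space K = \<lparr>carrier = carrier K, mult = mult K, one = one K,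
    zero = zero K, add = add K, smult = mult K\<rparr>"

text \<open>\<open>Ften F U V u v\<close> is the pure tensor \<open>u \<otimes> v\<close> in \<open>F(U \<boxtimes> V) = F(U) \<otimes> F(V)\<close>.\<close>

record ('o, 'a, 'v) vect_functor =
  Fob :: "'o \<Rightarrow> ('v, 'v) module"
  Far :: "'a \<Rightarrow> 'v \<Rightarrow> 'v"
  Ften :: "'o \<Rightarrow> 'o \<Rightarrow> 'v \<Rightarrow> 'v \<Rightarrow> 'v"

text \<open>The type \<open>'v\<close> is a universe containing the field and the underlying spaces of all objects.
  The functor is faithful and carries the tensor structure of the category, constraints
  included, to the usual one of vector spaces. Nothing is required of the image of the
  braiding.\<close>

locale forgetful_functor = tensor_category C + field K
  for K :: "'v ring" and C :: "('o, 'a, 'z) braided_cat_scheme" (structure) +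
  fixes F :: "('o, 'a, 'v) vect_functor"
  assumes Fob_space: "U \<in> Ob C \<Longrightarrow> vectorspace K (Fob F U)"
    and Far_linear: "f \<in> Hom C U V \<Longrightarrow> linear_map K (Fob F U) (Fob F V) (Far F f)"
    and Far_Idn: "U \<in> Ob C \<Longrightarrow> x \<in> carrier (Fob F U) \<Longrightarrow> Far F (Idn C U) x = x"
    and Far_Comp: "f \<in> Hom C U V \<Longrightarrow> g \<in> Hom C V W \<Longrightarrow> x \<in> carrier (Fob F U) \<Longrightarrow>
      Far F (g \<cdot> f) x = Far F g (Far F f x)"
    and faithful: "f \<in> Hom C U V \<Longrightarrow> g \<in> Hom C U V \<Longrightarrow>
      (\<And>x. x \<in> carrier (Fob F U) \<Longrightarrow> Far F f x = Far F g x) \<Longrightarrow> f = g"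
    and Fob_Unit: "Fob F \<I> = scalar_space K"
    and Fob_TOb: "U \<in> Ob C \<Longrightarrow> V \<in> Ob C \<Longrightarrow>
      is_tensor_product K (Fob F U) (Fob F V) (Fob F (U \<boxtimes> V)) (Ften F U V)"
    and Far_TAr: "f \<in> Hom C U U' \<Longrightarrow> g \<in> Hom C V V' \<Longrightarrow>
      u \<in> carrier (Fob F U) \<Longrightarrow> v \<in> carrier (Fob F V) \<Longrightarrow>
      Far F (f \<star> g) (Ften F U V u v) = Ften F U' V' (Far F f u) (Far F g v)"
    and Far_Assoc: "U \<in> Ob C \<Longrightarrow> V \<in> Ob C \<Longrightarrow> W \<in> Ob C \<Longrightarrow>
      u \<in> carrier (Fob F U) \<Longrightarrow> v \<in> carrier (Fob F V) \<Longrightarrow> w \<in> carrier (Fob F W) \<Longrightarrow>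
      Far F (\<alpha> U V W) (Ften F (U \<boxtimes> V) W (Ften F U V u v) w)
      = Ften F U (V \<boxtimes> W) u (Ften F V W v w)"
    and Far_LUnit: "U \<in> Ob C \<Longrightarrow> a \<in> carrier K \<Longrightarrow> u \<in> carrier (Fob F U) \<Longrightarrow>
      Far F (\<lambda>\<^sub>I U) (Ften F \<I> U a u) = a \<odot>\<^bsub>Fob F U\<^esub> u"
    and Far_RUnit: "U \<in> Ob C \<Longrightarrow> a \<in> carrier K \<Longrightarrow> u \<in> carrier (Fob F U) \<Longrightarrow>
      Far F (\<rho>\<^sub>I U) (Ften F U \<I> u a) = a \<odot>\<^bsub>Fob F U\<^esub> u"

section \<open>The underlying algebra, integrals and semisimplicity\<close>

definition underlying_algebra ::
  "'v ring \<Rightarrow> ('o, 'a, 'v) vect_functor \<Rightarrow> 'o \<Rightarrow> 'a \<Rightarrow> 'a \<Rightarrow> ('v, 'v) module"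
  where "underlying_algebra K F H m \<eta> = (Fob F H)
    \<lparr>mult := (\<lambda>x y. Far F m (Ften F H H x y)), one := Far F \<eta> \<one>\<^bsub>K\<^esub>\<rparr>"

definition left_integrals :: "('k, 'v) module \<Rightarrow> ('v \<Rightarrow> 'k) \<Rightarrow> 'v set"
  where "left_integrals A e =
    {x \<in> carrier A. \<forall>h \<in> carrier A. h \<otimes>\<^bsub>A\<^esub> x = e h \<odot>\<^bsub>A\<^esub> x}"

text \<open>Left modules over a \<open>K\<close>-algebra \<open>A\<close>; \<open>act\<close> is the action, while \<open>\<odot>\<^bsub>M\<^esub>\<close> is the action of \<open>K\<close>.\<close>

definition algebra_module ::
  "('k, 'y) ring_scheme \<Rightarrow> ('k, 'v) module \<Rightarrow> ('k, 'm) module \<Rightarrow> ('v \<Rightarrow> 'm \<Rightarrow> 'm) \<Rightarrow> bool"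
  where "algebra_module K A M act \<longleftrightarrow>
    vectorspace K M \<and> bilinear_map K A M M act \<and>
    (\<forall>g \<in> carrier A. \<forall>h \<in> carrier A. \<forall>x \<in> carrier M. act (g \<otimes>\<^bsub>A\<^esub> h) x = act g (act h x)) \<and>
    (\<forall>x \<in> carrier M. act \<one>\<^bsub>A\<^esub> x = x)"

definition algebra_submodule ::
  "('k, 'y) ring_scheme \<Rightarrow> ('k, 'v) module \<Rightarrow> ('k, 'm) module \<Rightarrow> ('v \<Rightarrow> 'm \<Rightarrow> 'm) \<Rightarrow> 'm set \<Rightarrow> bool"
  where "algebra_submodule K A M act N \<longleftrightarrow>
    subspace K N M \<and> (\<forall>h \<in> carrier A. \<forall>x \<in> N. act h x \<in> N)"

text \<open>A predicate cannot quantify over types, so the type carrying the modules is a parameter. It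
  has to be large enough to hold the modules of interest, in particular \<open>A\<close> itself.\<close>

definition semisimple_algebra ::
  "'m itself \<Rightarrow> ('k, 'y) ring_scheme \<Rightarrow> ('k, 'v) module \<Rightarrow> bool"
  where "semisimple_algebra _ K A \<longleftrightarrow>
    (\<forall>(M :: ('k, 'm) module) act N. algebra_module K A M act \<longrightarrow> algebra_submodule K A M act N \<longrightarrow>
      (\<exists>N'. algebra_submodule K A M act N' \<and>
        N \<inter> N' = {\<zero>\<^bsub>M\<^esub>} \<and> module.subspace_sum M N N' = carrier M))"

end

(*
The braiding enters only through the elements beta(h (x) L) with L a left integral.  By naturality
beta maps H (x) Int into Int (x) H, where Int is the space of left integrals, and, H being
finite-dimensional, it does so bijectively.  Comparing Delta(h L) with its braided expansion along the
Galois map a (x) b |-> a_1 (x) a_2 b gives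

  h L_1 (x) S(L_2) = sum L'_1 (x) S(L'_2) h',   where beta(h (x) L) = sum L' (x) h'.

Applying epsilon to the first leg shows that S(L) is a right integral.  If epsilon(L) = 1, then
L = S(L) L = S(L) is two-sided, which forces beta(h (x) L) = L (x) h; thus L_1 (x) S(L_2) is an
ordinary separability idempotent, and averaging a linear projection over it proves Maschke's theorem.
Conversely, a complement of the left ideal ker(epsilon) in H consists of integrals.
*)

theory Submission
  imports Defs
begin

text \<open>The obstacle is that an H-module is a bare vector space outside the category: nothing
  braids past it, while the identity for h L_1 (x) S(L_2) contains a braiding of h with L. The image
  of the braiding is in no way related to the flip of vector spaces, so this braiding must be shown
  to be trivial before averaging over L_1 (x) S(L_2) can commute with the action of h. Applying
  epsilon yields only sum S(L') h' = epsilon(h) S(L), an equation for the whole tensor beta(h (x) L)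
  = sum L' (x) h'. Isolating S(L) h requires L (x) h itself to be beta of something in H (x) Int.
  This is where surjectivity onto Int (x) H, and with it finite dimension, is needed. Naturality of
  beta against epsilon ends at the unit object, so the braiding with the unit has to be computed
  first; the hexagons determine it. Identities in H are proved under an arbitrary linear form,
  because Sweedler sums are available only through their values under scalar-valued bilinear
  forms.\<close>

section \<open>Linear and bilinear maps\<close>

lemma linear_mapI:
  assumes "vectorspace K U" "vectorspace K W"
    and "\<And>x. x \<in> carrier U \<Longrightarrow> f x \<in> carrier W"
    and "\<And>x y. x \<in> carrier U \<Longrightarrow> y \<in> carrier U \<Longrightarrow> f (x \<oplus>\<^bsub>U\<^esub> y) = f x \<oplus>\<^bsub>W\<^esub> f y"
    and "\<And>a x. a \<in> carrier K \<Longrightarrow> x \<in> carrier U \<Longrightarrow> f (a \<odot>\<^bsub>U\<^esub> x) = a \<odot>\<^bsub>W\<^esub> f x"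
  shows "linear_map K U W f"
  using assms
  by (auto simp: linear_map_def mod_hom_def mod_hom_axioms_def module_hom_def vectorspace_def)

lemma linear_mapD:
  assumes "linear_map K U W f"
  shows linear_map_dom: "vectorspace K U"
    and linear_map_cod: "vectorspace K W"
    and linear_map_closed: "x \<in> carrier U \<Longrightarrow> f x \<in> carrier W"
    and linear_map_add: "x \<in> carrier U \<Longrightarrow> y \<in> carrier U \<Longrightarrow> f (x \<oplus>\<^bsub>U\<^esub> y) = f x \<oplus>\<^bsub>W\<^esub> f y"
    and linear_map_smult: "a \<in> carrier K \<Longrightarrow> x \<in> carrier U \<Longrightarrow> f (a \<odot>\<^bsub>U\<^esub> x) = a \<odot>\<^bsub>W\<^esub> f x"
proof -
  interpret linear_map K U W f by fact
  show "vectorspace K U" "vectorspace K W" by unfold_locales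
  show "x \<in> carrier U \<Longrightarrow> f x \<in> carrier W" by (rule f_im)
  show "x \<in> carrier U \<Longrightarrow> y \<in> carrier U \<Longrightarrow> f (x \<oplus>\<^bsub>U\<^esub> y) = f x \<oplus>\<^bsub>W\<^esub> f y" by (rule f_add)
  show "a \<in> carrier K \<Longrightarrow> x \<in> carrier U \<Longrightarrow> f (a \<odot>\<^bsub>U\<^esub> x) = a \<odot>\<^bsub>W\<^esub> f x" by (rule f_smult)
qed

lemma linear_map_cong:
  assumes "linear_map K U W f" "\<And>x. x \<in> carrier U \<Longrightarrow> f x = g x"
  shows "linear_map K U W g"
proof -
  interpret linear_map K U W f by fact
  show ?thesis
    using assms(2) by (intro linear_mapI) (auto simp flip: assms(2) simp: V.vectorspace_axioms W.vectorspace_axioms)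
qed

lemma linear_map_id: "vectorspace K U \<Longrightarrow> linear_map K U U (\<lambda>x. x)"
  by (intro linear_mapI) auto

lemma linear_map_comp:
  assumes "linear_map K U V f" "linear_map K V W g"
  shows "linear_map K U W (\<lambda>x. g (f x))"
  using linear_mapD[OF assms(1)] linear_mapD[OF assms(2)]
  by (intro linear_mapI) auto

lemma linear_map_zero:
  assumes "linear_map K U W f" shows "f \<zero>\<^bsub>U\<^esub> = \<zero>\<^bsub>W\<^esub>"
  using assms by (rule linear_map.T0_is_0)

lemma linear_map_pointwise_add:
  assumes "linear_map K U W f" "linear_map K U W g"
  shows "linear_map K U W (\<lambda>x. f x \<oplus>\<^bsub>W\<^esub> g x)"
proof -
  interpret W: vectorspace K W using assms(1) by (rule linear_map_cod)
  show ?thesis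
    using linear_mapD[OF assms(1)] linear_mapD[OF assms(2)]
    by (intro linear_mapI) (auto simp: W.smult_r_distr W.M.a_ac W.module.smult_r_distr)
qed

lemma linear_map_pointwise_smult:
  assumes "linear_map K U W f" "c \<in> carrier K"
  shows "linear_map K U W (\<lambda>x. c \<odot>\<^bsub>W\<^esub> f x)"
proof -
  interpret W: vectorspace K W using assms(1) by (rule linear_map_cod)
  show ?thesis
    using linear_mapD[OF assms(1)] assms(2)
    by (intro linear_mapI) (auto simp: W.smult_r_distr W.R.m_comm simp flip: W.smult_assoc1)
qed

lemma linear_map_finsum:
  assumes "linear_map K U W f" "finite I" "\<And>i. i \<in> I \<Longrightarrow> g i \<in> carrier U"
  shows "f (finsum U g I) = finsum W (\<lambda>i. f (g i)) I"
proof -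
  interpret U: vectorspace K U using assms(1) by (rule linear_map_dom)
  interpret W: vectorspace K W using assms(1) by (rule linear_map_cod)
  show ?thesis using assms(2,3)
  proof (induction I)
    case (insert i I)
    then have "g \<in> I \<rightarrow> carrier U" "g i \<in> carrier U" "finsum U g I \<in> carrier U"
      "(\<lambda>i. f (g i)) \<in> I \<rightarrow> carrier W"
      using linear_map_closed[OF assms(1)] by (auto intro!: U.M.finsum_closed)
    with insert show ?case
      by (simp add: linear_map_add[OF assms(1)] linear_map_closed[OF assms(1)])
  qed (simp add: linear_map_zero[OF assms(1)])
qed

lemma linear_map_pointwise_finsum:
  assumes "vectorspace K U" "vectorspace K W" "finite I" "\<And>i. i \<in> I \<Longrightarrow> linear_map K U W (f i)"
  shows "linear_map K U W (\<lambda>x. finsum W (\<lambda>i. f i x) I)"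
proof -
  interpret U: vectorspace K U by fact
  interpret W: vectorspace K W by fact
  show ?thesis using assms(3,4)
  proof (induction I)
    case empty
    then show ?case by (intro linear_mapI) (auto simp: assms)
  next
    case (insert i I)
    have "linear_map K U W (\<lambda>x. f i x \<oplus>\<^bsub>W\<^esub> finsum W (\<lambda>i. f i x) I)"
      using insert by (intro linear_map_pointwise_add) auto
    then show ?case
    proof (rule linear_map_cong)
      fix x assume x: "x \<in> carrier U"
      have "f j x \<in> carrier W" if "j \<in> insert i I" for j
        using linear_map_closed[OF insert.prems[OF that] x] .
      with insert.hyps show "f i x \<oplus>\<^bsub>W\<^esub> finsum W (\<lambda>i. f i x) I = finsum W (\<lambda>i. f i x) (insert i I)"
        by (intro W.M.finsum_insert[symmetric]) auto
    qed
  qed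
qed

lemma submodule_finsum_closed:
  assumes "LinearCombinations.submodule R N M" "finite I" "\<And>i. i \<in> I \<Longrightarrow> g i \<in> N"
  shows "finsum M g I \<in> N"
proof -
  interpret module R M using assms(1) by (rule submodule.module)
  have N: "N \<subseteq> carrier M" using assms(1) by (rule submodule.subset)
  show ?thesis using assms(2,3)
  proof (induction I)
    case empty
    then show ?case using submodule.zero_closed[OF assms(1)] by simp
  next
    case (insert i I)
    then have "finsum M g (insert i I) = g i \<oplus>\<^bsub>M\<^esub> finsum M g I"
      using N by (intro M.finsum_insert) auto
    with insert show ?case using submodule.m_closed[OF assms(1)] by simp
  qed
qed

lemma bilinear_mapI:
  assumes "\<And>u. u \<in> carrier U \<Longrightarrow> linear_map K V W (\<lambda>v. f u v)"
    and "\<And>v. v \<in> carrier V \<Longrightarrow> linear_map K U W (\<lambda>u. f u v)"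
  shows "bilinear_map K U V W f"
  using assms by (simp add: bilinear_map_def)

lemma bilinear_mapD:
  assumes "bilinear_map K U V W f"
  shows bilinear_map_right: "u \<in> carrier U \<Longrightarrow> linear_map K V W (f u)"
    and bilinear_map_left: "v \<in> carrier V \<Longrightarrow> linear_map K U W (\<lambda>u. f u v)"
    and bilinear_map_closed: "u \<in> carrier U \<Longrightarrow> v \<in> carrier V \<Longrightarrow> f u v \<in> carrier W"
  using assms linear_map_closed[of K V W "f u" v] by (auto simp: bilinear_map_def)

lemma bilinear_left_comp:
  "bilinear_map K U V W f \<Longrightarrow> v \<in> carrier V \<Longrightarrow> linear_map K X U g \<Longrightarrow> linear_map K X W (\<lambda>x. f (g x) v)"
  by (rule linear_map_comp[OF _ bilinear_map_left])

lemma bilinear_right_comp: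
  "bilinear_map K U V W f \<Longrightarrow> u \<in> carrier U \<Longrightarrow> linear_map K X V g \<Longrightarrow> linear_map K X W (\<lambda>x. f u (g x))"
  by (rule linear_map_comp[OF _ bilinear_map_right])

lemma scalar_space_simps [simp]:
  "carrier (scalar_space K) = carrier K"
  "add (scalar_space K) = add K"
  "zero (scalar_space K) = zero K"
  "smult (scalar_space K) = mult K"
  by (auto simp: scalar_space_def)

lemma vectorspace_scalar_space:
  assumes "field K" shows "vectorspace K (scalar_space K)"
proof -
  interpret field K by fact
  have "abelian_group (scalar_space K)"
    by (rule abelian_groupI) (auto simp: a_ac intro: l_neg)
  then have "module K (scalar_space K)"
    by (intro moduleI) (auto simp: m_assoc l_distr r_distr is_cring)
  then show ?thesis by (simp add: vectorspace_def assms)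
qed

section \<open>Finite-dimensional spaces\<close>

text \<open>The maps \<open>d b\<close> are the coordinate functionals of a basis. Only the
  reproducing formula is recorded, since every later use expands a vector in this way.\<close>

lemma dual_basis_exists:
  assumes "vectorspace K V" "vectorspace.fin_dim K V"
  shows "\<exists>B d. finite B \<and> B \<subseteq> carrier V \<and>
    (\<forall>b\<in>B. linear_map K V (scalar_space K) (d b)) \<and>
    (\<forall>x\<in>carrier V. finsum V (\<lambda>b. d b x \<odot>\<^bsub>V\<^esub> b) B = x)"
proof -
  interpret vectorspace K V by fact
  obtain B where B: "finite B" "basis B" using finite_basis_exists[OF assms(2)] by blast
  then have BV: "B \<subseteq> carrier V" by (simp add: basis_def)
  \<comment> \<open>Coefficient functions are unique only as extensional functions on
    \<open>B\<close>, which is why \<open>co_eq\<close> below restricts a given \<open>a\<close>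
    first.\<close>
  have ex1: "\<exists>!a. a \<in> B \<rightarrow>\<^sub>E carrier K \<and> lincomb a B = x" if "x \<in> carrier V" for x
    using basis_criterion[OF B(1) BV] B(2) that by blast
  define co where "co x = (THE a. a \<in> B \<rightarrow>\<^sub>E carrier K \<and> lincomb a B = x)" for x
  have co: "co x \<in> B \<rightarrow>\<^sub>E carrier K" "lincomb (co x) B = x" if "x \<in> carrier V" for x
    using theI'[OF ex1[OF that]] by (auto simp: co_def)
  have co_eq: "co x b = a b" if "x \<in> carrier V" "a \<in> B \<rightarrow> carrier K" "lincomb a B = x" "b \<in> B" for x a b
  proof -
    have "lincomb (restrict a B) B = x"
      using that by (subst lincomb_restrict[OF BV, of _ a]) auto
    then have "co x = restrict a B"
      unfolding co_def using that(2) by (intro the1_equality[OF ex1[OF that(1)]]) auto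
    then show ?thesis using that by simp
  qed
  show ?thesis
  proof (intro exI conjI ballI)
    show "finite B" "B \<subseteq> carrier V" by fact+
    fix b assume b: "b \<in> B"
    show "linear_map K V (scalar_space K) (\<lambda>x. co x b)"
    proof (rule linear_mapI)
      show "vectorspace K (scalar_space K)" by (simp add: vectorspace_scalar_space field.field_axioms)
      show "vectorspace K V" by fact
    next
      fix x assume "x \<in> carrier V" then show "co x b \<in> carrier (scalar_space K)" using co b by auto
    next
      fix x y assume x: "x \<in> carrier V" and y: "y \<in> carrier V"
      have "lincomb (\<lambda>b. co x b \<oplus>\<^bsub>K\<^esub> co y b) B = x \<oplus>\<^bsub>V\<^esub> y"
        using lincomb_sum[OF B(1) BV, of "co x" "co y"] co x y by (auto simp: PiE_def)
      then show "co (x \<oplus>\<^bsub>V\<^esub> y) b = co x b \<oplus>\<^bsub>scalar_space K\<^esub> co y b"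
        using co x y b by (subst co_eq[of _ "\<lambda>b. co x b \<oplus>\<^bsub>K\<^esub> co y b"]) auto
    next
      fix a x assume a: "a \<in> carrier K" and x: "x \<in> carrier V"
      have "lincomb (\<lambda>b. a \<otimes>\<^bsub>K\<^esub> co x b) B = a \<odot>\<^bsub>V\<^esub> x"
        using lincomb_smult[OF BV _ a, of "co x"] co x by (auto simp: PiE_def)
      then show "co (a \<odot>\<^bsub>V\<^esub> x) b = a \<odot>\<^bsub>scalar_space K\<^esub> co x b"
        using co x a b by (subst co_eq[of _ "\<lambda>b. a \<otimes>\<^bsub>K\<^esub> co x b"]) auto
    qed
  next
    fix x assume "x \<in> carrier V"
    then show "finsum V (\<lambda>b. co x b \<odot>\<^bsub>V\<^esub> b) B = x"
      using co(2) by (simp add: lincomb_def)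
  qed
qed

text \<open>Equal coordinates in a basis force equality. This lets vector identities be derived from
  Sweedler expressions whose values are scalars.\<close>

lemma eq_if_linear_forms_eq:
  assumes "vectorspace K V" "vectorspace.fin_dim K V" "x \<in> carrier V" "y \<in> carrier V"
    and "\<And>\<phi>. linear_map K V (scalar_space K) \<phi> \<Longrightarrow> \<phi> x = \<phi> y"
  shows "x = y"
proof -
  interpret vectorspace K V by fact
  obtain B d where B: "finite B" "B \<subseteq> carrier V"
    "\<And>b. b \<in> B \<Longrightarrow> linear_map K V (scalar_space K) (d b)"
    "\<And>x. x \<in> carrier V \<Longrightarrow> finsum V (\<lambda>b. d b x \<odot>\<^bsub>V\<^esub> b) B = x"
    using dual_basis_exists[OF assms(1,2)] by blast
  have "finsum V (\<lambda>b. d b x \<odot>\<^bsub>V\<^esub> b) B = finsum V (\<lambda>b. d b y \<odot>\<^bsub>V\<^esub> b) B"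
    using assms(5)[OF B(3)] B(2) linear_map_closed[OF B(3)] assms(3,4)
    by (intro M.finsum_cong') (auto intro!: smult_closed)
  then show ?thesis using B(4) assms(3,4) by simp
qed

text \<open>Independent subsets of \<open>W\<close> stay independent in \<open>V\<close>, so their
  size is at most \<open>dim\<close>; a maximal one exists and generates \<open>W\<close>.\<close>

lemma fin_dim_subspace:
  assumes "vectorspace K V" "vectorspace.fin_dim K V" "subspace K W V"
  shows "vectorspace.fin_dim K (V\<lparr>carrier := W\<rparr>)"
proof -
  interpret vectorspace K V by fact
  interpret W: vectorspace K "vs W" using subspace_is_vs[OF assms(3)] .
  have WV: "W \<subseteq> carrier V" using assms(3) by (simp add: subspace_def submodule_def)
  have li: "W.lin_indpt S \<longleftrightarrow> lin_indpt S" if "S \<subseteq> W" for S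
    using span_li_not_depend(2)[OF that] assms(3) by (simp add: subspace_def)
  have "\<exists>S. finite S \<and> maximal S (\<lambda>S. S \<subseteq> W \<and> lin_indpt S)"
  proof (rule maximal_exists)
    show "finite S \<and> card S \<le> dim" if "S \<subseteq> W \<and> lin_indpt S" for S
      using that li_le_dim[OF assms(2)] WV by auto
    show "{} \<subseteq> W \<and> lin_indpt {}" by (simp add: lin_dep_def)
  qed
  then obtain S where S: "finite S" "maximal S (\<lambda>S. S \<subseteq> W \<and> lin_indpt S)" by blast
  have "(\<lambda>S. S \<subseteq> carrier (vs W) \<and> W.lin_indpt S) = (\<lambda>S. S \<subseteq> W \<and> lin_indpt S)"
    using li by (intro ext conj_cong) simp_all
  with S(2) have "maximal S (\<lambda>S. S \<subseteq> carrier (vs W) \<and> W.lin_indpt S)" by (simp only:)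
  then have "W.gen_set S" by (rule W.max_li_is_gen)
  moreover have "S \<subseteq> carrier (vs W)" using S(2) by (simp add: maximal_def)
  ultimately show ?thesis using S(1) unfolding W.fin_dim_def by blast
qed

text \<open>Injectivity carries a basis to an independent set of the same size \<open>dim\<close>,
  which is again a basis and lies in the image.\<close>

lemma injective_endomorphism_surj:
  assumes f: "linear_map K V V f" and fd: "vectorspace.fin_dim K V" and inj: "inj_on f (carrier V)"
  shows "f ` carrier V = carrier V"
proof -
  interpret V: vectorspace K V using f by (rule linear_map_dom)
  obtain B where B: "finite B" "V.basis B" using V.finite_basis_exists[OF fd] by blast
  then have BV: "B \<subseteq> carrier V" "V.lin_indpt B" by (auto simp: V.basis_def)
  have fB: "f ` B \<subseteq> carrier V" "finite (f ` B)"
    using BV B linear_map_closed[OF f] by auto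
  have card: "card (f ` B) = V.dim"
    using V.dim_basis[OF B] card_image[OF inj_on_subset[OF inj BV(1)]] by simp
  have li: "V.lin_indpt (f ` B)"
  proof (rule V.finite_lin_indpt2[OF fB(2,1)])
    fix a assume a: "a \<in> f ` B \<rightarrow> carrier K" "V.lincomb a (f ` B) = \<zero>\<^bsub>V\<^esub>"
    have "V.lincomb a (f ` B) = f (V.lincomb (a \<circ> f) B)"
      using linear_map.lincomb_linear_image[OF f inj BV(1) a(1) B(1)] .
    then have "f (V.lincomb (a \<circ> f) B) = f \<zero>\<^bsub>V\<^esub>" using a(2) linear_map_zero[OF f] by simp
    moreover have "V.lincomb (a \<circ> f) B \<in> carrier V"
      using a(1) by (intro V.lincomb_closed[OF BV(1)]) auto
    ultimately have "V.lincomb (a \<circ> f) B = \<zero>\<^bsub>V\<^esub>"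
      using inj by (auto dest: inj_onD)
    moreover have "a \<circ> f \<in> B \<rightarrow> carrier K" using a(1) by auto
    ultimately have "a \<circ> f \<in> B \<rightarrow> {\<zero>\<^bsub>K\<^esub>}"
      by (intro V.not_lindepD[OF BV(2) B(1) subset_refl])
    then show "\<forall>v\<in>f ` B. a v = \<zero>\<^bsub>K\<^esub>" by auto
  qed
  have "V.gen_set (f ` B)"
    using V.dim_li_is_basis[OF fd fB(2,1) li] card by (simp add: V.basis_def)
  moreover have "V.span (f ` B) \<subseteq> linear_map.imT V f"
    using linear_map.imT_is_subspace[OF f] BV(1)
    by (intro V.span_is_subset) (auto simp: subspace_def linear_map.axioms(3)[OF f, THEN mod_hom.im_def])
  ultimately have "carrier V \<subseteq> f ` carrier V"
    by (simp add: linear_map.axioms(3)[OF f, THEN mod_hom.im_def])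
  then show ?thesis using linear_map_closed[OF f] by auto
qed

section \<open>Tensor products\<close>

text \<open>The linear extension is unique only on \<open>carrier T\<close>, so one is selected by
  choice. The selection depends on \<open>b\<close> only through its values on the carriers, see
  \<open>tensor_lift_cong\<close>.\<close>

definition tensor_lift ::
  "('k, 'y) ring_scheme \<Rightarrow> ('k, 'v) module \<Rightarrow> ('k, 'v) module \<Rightarrow> ('k, 'v) module
    \<Rightarrow> ('v \<Rightarrow> 'v \<Rightarrow> 'v) \<Rightarrow> ('k, 'v) module \<Rightarrow> ('v \<Rightarrow> 'v \<Rightarrow> 'v) \<Rightarrow> 'v \<Rightarrow> 'v"
  where "tensor_lift K U V T \<tau> W b =
    (SOME f. linear_map K T W f \<and> (\<forall>u\<in>carrier U. \<forall>v\<in>carrier V. f (\<tau> u v) = b u v))"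

context
  fixes K :: "('k, 'y) ring_scheme" and U V T :: "('k, 'v) module" and \<tau> :: "'v \<Rightarrow> 'v \<Rightarrow> 'v"
  assumes tp: "is_tensor_product K U V T \<tau>"
begin

lemma tensor_bilinear: "bilinear_map K U V T \<tau>"
  using tp by (simp add: is_tensor_product_def)

lemma tensor_lift_spec:
  assumes "vectorspace K W" "bilinear_map K U V W b"
  shows tensor_lift_linear: "linear_map K T W (tensor_lift K U V T \<tau> W b)"
    and tensor_lift_pure: "u \<in> carrier U \<Longrightarrow> v \<in> carrier V \<Longrightarrow> tensor_lift K U V T \<tau> W b (\<tau> u v) = b u v"
proof -
  have "\<exists>f. linear_map K T W f \<and> (\<forall>u\<in>carrier U. \<forall>v\<in>carrier V. f (\<tau> u v) = b u v)"
    using tp assms by (auto simp: is_tensor_product_def)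
  from someI_ex[OF this]
  show "linear_map K T W (tensor_lift K U V T \<tau> W b)"
    "u \<in> carrier U \<Longrightarrow> v \<in> carrier V \<Longrightarrow> tensor_lift K U V T \<tau> W b (\<tau> u v) = b u v"
    by (auto simp: tensor_lift_def)
qed

text \<open>The uniqueness half of the universal property. It takes the place of writing a tensor as
  a sum of pure ones: an identity linear in \<open>t\<close> needs to be checked only for
  \<open>t = \<tau> u v\<close>.\<close>

lemma tensor_ext:
  fixes W :: "('k, 'v) module"
  assumes f: "linear_map K T W f" and g: "linear_map K T W g"
    and eq: "\<And>u v. u \<in> carrier U \<Longrightarrow> v \<in> carrier V \<Longrightarrow> f (\<tau> u v) = g (\<tau> u v)"
    and t: "t \<in> carrier T"
  shows "f t = g t"
proof -
  have "bilinear_map K U V W (\<lambda>u v. f (\<tau> u v))"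
    using tensor_bilinear f by (auto simp: bilinear_map_def intro: linear_map_comp)
  moreover have "vectorspace K W" using f by (rule linear_map_cod)
  ultimately have "\<forall>f' g'. linear_map K T W f' \<longrightarrow> linear_map K T W g' \<longrightarrow>
      (\<forall>u\<in>carrier U. \<forall>v\<in>carrier V. f' (\<tau> u v) = f (\<tau> u v) \<and> g' (\<tau> u v) = f (\<tau> u v)) \<longrightarrow>
      (\<forall>t\<in>carrier T. f' t = g' t)"
    using tp unfolding is_tensor_product_def by blast
  then show ?thesis using f g eq t by auto
qed

text \<open>A chosen extension carries no linearity in parameters by itself; uniqueness supplies it,
  because both sides extend the same bilinear map. Nested Sweedler sums depend on this.\<close>

lemma tensor_lift_parameter_linear:
  assumes "vectorspace K W" "vectorspace K P"
    and b: "\<And>p. p \<in> carrier P \<Longrightarrow> bilinear_map K U V W (b p)"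
    and p: "\<And>u v. u \<in> carrier U \<Longrightarrow> v \<in> carrier V \<Longrightarrow> linear_map K P W (\<lambda>p. b p u v)"
    and t: "t \<in> carrier T"
  shows "linear_map K P W (\<lambda>p. tensor_lift K U V T \<tau> W (b p) t)"
proof -
  interpret P: vectorspace K P by fact
  note l = tensor_lift_linear[OF assms(1) b]
  note [simp] = tensor_lift_pure[OF assms(1) b]
  show ?thesis
  proof (rule linear_mapI)
    fix x y assume xy: "x \<in> carrier P" "y \<in> carrier P"
    show "tensor_lift K U V T \<tau> W (b (x \<oplus>\<^bsub>P\<^esub> y)) t
      = tensor_lift K U V T \<tau> W (b x) t \<oplus>\<^bsub>W\<^esub> tensor_lift K U V T \<tau> W (b y) t"
      by (rule tensor_ext[OF l linear_map_pointwise_add[OF l l] _ t])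
        (use xy linear_map_add[OF p] in auto)
  next
    fix a x assume ax: "a \<in> carrier K" "x \<in> carrier P"
    show "tensor_lift K U V T \<tau> W (b (a \<odot>\<^bsub>P\<^esub> x)) t = a \<odot>\<^bsub>W\<^esub> tensor_lift K U V T \<tau> W (b x) t"
      by (rule tensor_ext[OF l linear_map_pointwise_smult[OF l] _ t])
        (use ax linear_map_smult[OF p] in auto)
  qed (use assms linear_map_closed[OF l t] in auto)
qed

lemma tensor_lift_linear_comp:
  assumes "bilinear_map K U V W b" "linear_map K W X g" "t \<in> carrier T"
  shows "tensor_lift K U V T \<tau> X (\<lambda>u v. g (b u v)) t = g (tensor_lift K U V T \<tau> W b t)"
proof -
  have W: "vectorspace K W" "vectorspace K X" using assms(2) by (auto dest: linear_mapD)
  have gb: "bilinear_map K U V X (\<lambda>u v. g (b u v))"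
    using assms(1,2) by (auto simp: bilinear_map_def intro: linear_map_comp)
  show ?thesis
    by (rule tensor_ext[OF tensor_lift_linear[OF W(2) gb]
          linear_map_comp[OF tensor_lift_linear[OF W(1) assms(1)] assms(2)] _ assms(3)])
      (simp add: tensor_lift_pure[OF W(2) gb] tensor_lift_pure[OF W(1) assms(1)])
qed

end

lemma tensor_lift_cong:
  assumes "\<And>u v. u \<in> carrier U \<Longrightarrow> v \<in> carrier V \<Longrightarrow> b u v = c u v"
  shows "tensor_lift K U V T \<tau> W b = tensor_lift K U V T \<tau> W c"
  using assms by (auto simp: tensor_lift_def cong: ball_cong)

section \<open>Arrows on elements\<close>

context forgetful_functor
begin

lemmas Ften_bilinear = tensor_bilinear[OF Fob_TOb]

lemma Ften_closed [simp]:
  assumes "U \<in> Ob C" "V \<in> Ob C" "u \<in> carrier (Fob F U)" "v \<in> carrier (Fob F V)"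
  shows "Ften F U V u v \<in> carrier (Fob F (U \<boxtimes> V))"
  using bilinear_map_closed[OF Ften_bilinear] assms by auto

lemma Far_closed: "f \<in> Hom C U V \<Longrightarrow> x \<in> carrier (Fob F U) \<Longrightarrow> Far F f x \<in> carrier (Fob F V)"
  by (rule linear_map_closed[OF Far_linear])

lemma inverse_arrowsD:
  assumes "is_iso C U V f"
  shows is_iso_Hom: "f \<in> Hom C U V"
    and inv_arrow_Hom: "inv_arrow C U V f \<in> Hom C V U"
    and Far_inv_arrow: "x \<in> carrier (Fob F U) \<Longrightarrow> Far F (inv_arrow C U V f) (Far F f x) = x"
    and Far_inv_arrow2: "y \<in> carrier (Fob F V) \<Longrightarrow> Far F f (Far F (inv_arrow C U V f) y) = y"
proof -
  obtain g where g: "inverse_arrows C U V f g" using assms by (auto simp: is_iso_def)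
  have uniq: "g' = g" if "inverse_arrows C U V f g'" for g'
  proof -
    have "g' = (g \<cdot> f) \<cdot> g'" using g that Idn_Comp by (auto simp: inverse_arrows_def)
    also have "\<dots> = g \<cdot> (f \<cdot> g')" using g that by (intro Comp_assoc) (auto simp: inverse_arrows_def)
    also have "\<dots> = g" using g that Comp_Idn by (auto simp: inverse_arrows_def)
    finally show ?thesis .
  qed
  have "inv_arrow C U V f = g"
    unfolding inv_arrow_def by (rule the_equality) (rule g, rule uniq)
  then have i: "f \<in> Hom C U V" "inv_arrow C U V f \<in> Hom C V U"
    "inv_arrow C U V f \<cdot> f = Idn C U" "f \<cdot> inv_arrow C U V f = Idn C V"
    using g by (auto simp: inverse_arrows_def)
  then show "f \<in> Hom C U V" "inv_arrow C U V f \<in> Hom C V U" by auto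
  have Ob: "U \<in> Ob C" "V \<in> Ob C" using Hom_Ob[OF i(1)] by auto
  show "x \<in> carrier (Fob F U) \<Longrightarrow> Far F (inv_arrow C U V f) (Far F f x) = x"
    using Far_Comp[OF i(1,2)] i(3) Far_Idn[OF Ob(1)] by simp
  show "y \<in> carrier (Fob F V) \<Longrightarrow> Far F f (Far F (inv_arrow C U V f) y) = y"
    using Far_Comp[OF i(2,1)] i(4) Far_Idn[OF Ob(2)] by simp
qed

lemma Far_iso_inj:
  assumes "is_iso C U V f" "x \<in> carrier (Fob F U)" "y \<in> carrier (Fob F U)" "Far F f x = Far F f y"
  shows "x = y"
  using trans[OF arg_cong[OF assms(4), of "Far F (inv_arrow C U V f)"] Far_inv_arrow[OF assms(1,3)]]
  unfolding Far_inv_arrow[OF assms(1,2)] .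

lemmas Assoc_Hom = is_iso_Hom[OF Assoc_iso]
lemmas LUnit_Hom = is_iso_Hom[OF LUnit_iso]
lemmas RUnit_Hom = is_iso_Hom[OF RUnit_iso]
lemmas Assoc_inv_Hom = inv_arrow_Hom[OF Assoc_iso, folded Assoc_inv_def]

lemma Far_Assoc_inv:
  assumes "U \<in> Ob C" "V \<in> Ob C" "W \<in> Ob C"
    and "u \<in> carrier (Fob F U)" "v \<in> carrier (Fob F V)" "w \<in> carrier (Fob F W)"
  shows "Far F (\<alpha>\<^sub>i U V W) (Ften F U (V \<boxtimes> W) u (Ften F V W v w))
    = Ften F (U \<boxtimes> V) W (Ften F U V u v) w"
  unfolding Far_Assoc[OF assms, symmetric] Assoc_inv_def
  by (rule Far_inv_arrow[OF Assoc_iso]) (use assms TOb_Ob in auto)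

lemma Fob_Unit_one: "\<one>\<^bsub>K\<^esub> \<in> carrier (Fob F \<I>)"
  by (simp add: Fob_Unit)

lemma smult_one_Fob: "U \<in> Ob C \<Longrightarrow> u \<in> carrier (Fob F U) \<Longrightarrow> \<one>\<^bsub>K\<^esub> \<odot>\<^bsub>Fob F U\<^esub> u = u"
  using Fob_space[of U] by (simp add: vectorspace_def module.smult_one)

end

text \<open>On the unit object the braiding is forced by the hexagons: \<open>u \<mapsto> \<beta>(u \<otimes> 1)\<close> is an injective
  idempotent under \<open>F U \<otimes> K = F U = K \<otimes> F U\<close>.\<close>

locale braided_forgetful_functor = forgetful_functor K C F + braided_tensor_category C
  for K :: "'v ring" and C :: "('o, 'a, 'z) braided_cat_scheme" (structure) and F
begin

lemmas Braid_Hom = is_iso_Hom[OF Braid_iso]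

lemma Braid_Unit_right:
  assumes U: "U \<in> Ob C" and u: "u \<in> carrier (Fob F U)"
  shows "Far F (\<beta> U \<I>) (Ften F U \<I> u \<one>\<^bsub>K\<^esub>) = Ften F \<I> U \<one>\<^bsub>K\<^esub> u"
proof -
  let ?I = "Unit C" and ?e = "\<one>\<^bsub>K\<^esub>"
  note O [simp] = U Unit_Ob TOb_Ob Fob_Unit_one
  \<comment> \<open>\<open>\<phi>\<close> is the braiding with the unit, read as an endomorphism of
    F(U) through both unit constraints. The goal amounts to \<open>\<phi> u = u\<close>.\<close>
  define \<phi> where "\<phi> x = Far F (\<lambda>\<^sub>I U) (Far F (\<beta> U ?I) (Ften F U ?I x ?e))" for x
  have \<beta>I: "Far F (\<beta> U ?I) (Ften F U ?I x ?e) \<in> carrier (Fob F (?I \<boxtimes> U))"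
    if "x \<in> carrier (Fob F U)" for x
    by (rule Far_closed[OF Braid_Hom]) (use that in auto)
  have \<phi> [simp]: "\<phi> x \<in> carrier (Fob F U)" if "x \<in> carrier (Fob F U)" for x
    unfolding \<phi>_def by (rule Far_closed[OF LUnit_Hom]) (use that \<beta>I in auto)
  \<comment> \<open>Since the left unit constraint is bijective, every element of F(I (x) U) has the
    form 1 (x) x.\<close>
  have \<beta>\<phi>: "Far F (\<beta> U ?I) (Ften F U ?I x ?e) = Ften F ?I U ?e (\<phi> x)" if x: "x \<in> carrier (Fob F U)" for x
  proof (rule Far_iso_inj[OF LUnit_iso])
    show "Far F (\<lambda>\<^sub>I U) (Far F (\<beta> U ?I) (Ften F U ?I x ?e)) = Far F (\<lambda>\<^sub>I U) (Ften F ?I U ?e (\<phi> x))"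
      using x by (simp add: Far_LUnit smult_one_Fob \<phi>_def[symmetric])
  qed (use x \<beta>I in auto)
  have \<phi>_inj: "x = y" if "x \<in> carrier (Fob F U)" "y \<in> carrier (Fob F U)" "\<phi> x = \<phi> y" for x y
  proof -
    have "Far F (\<beta> U ?I) (Ften F U ?I x ?e) = Far F (\<beta> U ?I) (Ften F U ?I y ?e)"
      using that by (simp add: \<beta>\<phi>)
    then have "Ften F U ?I x ?e = Ften F U ?I y ?e"
      by (rule Far_iso_inj[OF Braid_iso, rotated -1]) (use that in auto)
    then have "Far F (\<rho>\<^sub>I U) (Ften F U ?I x ?e) = Far F (\<rho>\<^sub>I U) (Ften F U ?I y ?e)" by simp
    then show ?thesis using that by (simp add: Far_RUnit smult_one_Fob)
  qed
  let ?t = "Ften F (U \<boxtimes> ?I) ?I (Ften F U ?I u ?e) ?e"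
  let ?s = "Ften F U (?I \<boxtimes> ?I) u (Ften F ?I ?I ?e ?e)"
  have t: "?t \<in> carrier (Fob F ((U \<boxtimes> ?I) \<boxtimes> ?I))" using u by auto
  have s: "?s \<in> carrier (Fob F (U \<boxtimes> (?I \<boxtimes> ?I)))" using u by auto
  note II = TOb_Ob[OF Unit_Ob Unit_Ob]
  note a1 = Assoc_Hom[OF U Unit_Ob Unit_Ob]
  note b1 = Braid_Hom[OF U II]
  note a2 = Assoc_Hom[OF Unit_Ob Unit_Ob U]
  note c1 = TAr_Hom[OF Braid_Hom[OF U Unit_Ob] Idn_Hom[OF Unit_Ob]]
  note c2 = Assoc_Hom[OF Unit_Ob U Unit_Ob]
  note c3 = TAr_Hom[OF Idn_Hom[OF Unit_Ob] Braid_Hom[OF U Unit_Ob]]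
  \<comment> \<open>The hexagon for U, I, I at u (x) 1 (x) 1: braiding u past I (x) I applies
    \<open>\<phi>\<close> twice.\<close>
  have "Far F (\<alpha> ?I ?I U) (Far F (\<beta> U (?I \<boxtimes> ?I)) (Far F (\<alpha> U ?I ?I) ?t))
    = Far F (Idn C ?I \<star> \<beta> U ?I) (Far F (\<alpha> ?I U ?I) (Far F (\<beta> U ?I \<star> Idn C ?I) ?t))"
    using arg_cong[OF hexagon1[OF U Unit_Ob Unit_Ob], of "\<lambda>f. Far F f ?t"]
    by (simp add: Far_Comp[OF a1 Comp_Hom[OF b1 a2] t] Far_Comp[OF b1 a2 Far_closed[OF a1 t]]
        Far_Comp[OF c1 Comp_Hom[OF c2 c3] t] Far_Comp[OF c2 c3 Far_closed[OF c1 t]])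
  also have "\<dots> = Ften F ?I (?I \<boxtimes> U) ?e (Ften F ?I U ?e (\<phi> (\<phi> u)))"
    using u by (simp add: Far_TAr[OF Braid_Hom[OF U Unit_Ob] Idn_Hom[OF Unit_Ob]]
        Far_TAr[OF Idn_Hom[OF Unit_Ob] Braid_Hom[OF U Unit_Ob]] Far_Idn \<beta>\<phi> Far_Assoc)
  also have "\<dots> = Far F (\<alpha> ?I ?I U) (Ften F (?I \<boxtimes> ?I) U (Ften F ?I ?I ?e ?e) (\<phi> (\<phi> u)))"
    using u by (simp add: Far_Assoc)
  finally have "Far F (\<beta> U (?I \<boxtimes> ?I)) (Far F (\<alpha> U ?I ?I) ?t)
    = Ften F (?I \<boxtimes> ?I) U (Ften F ?I ?I ?e ?e) (\<phi> (\<phi> u))"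
    by (rule Far_iso_inj[OF Assoc_iso, rotated -1])
      (use u Far_closed[OF b1 Far_closed[OF a1 t]] in auto)
  then have *: "Far F (\<beta> U (?I \<boxtimes> ?I)) ?s = Ften F (?I \<boxtimes> ?I) U (Ften F ?I ?I ?e ?e) (\<phi> (\<phi> u))"
    using u by (simp add: Far_Assoc)
  note l = LUnit_Hom[OF Unit_Ob]
  note n1 = TAr_Hom[OF Idn_Hom[OF U] l]
  note n2 = TAr_Hom[OF l Idn_Hom[OF U]]
  \<comment> \<open>Naturality along the unit constraint I (x) I -> I: the same braiding applies
    \<open>\<phi>\<close> only once. Thus \<open>\<phi>\<close> is idempotent on u, and injectivity
    gives \<open>\<phi> u = u\<close>.\<close>
  have "Far F (\<beta> U ?I) (Far F (Idn C U \<star> \<lambda>\<^sub>I ?I) ?s) = Far F (\<lambda>\<^sub>I ?I \<star> Idn C U) (Far F (\<beta> U (?I \<boxtimes> ?I)) ?s)"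
    using arg_cong[OF Braid_natural[OF Idn_Hom[OF U] l], of "\<lambda>f. Far F f ?s"]
    by (simp add: Far_Comp[OF n1 Braid_Hom[OF U Unit_Ob] s] Far_Comp[OF b1 n2 s])
  then have "Ften F ?I U ?e (\<phi> u) = Ften F ?I U ?e (\<phi> (\<phi> u))"
    using u by (simp add: Far_TAr[OF Idn_Hom[OF U] l] Far_TAr[OF l Idn_Hom[OF U]] *
        Far_Idn Far_LUnit smult_one_Fob \<beta>\<phi>)
  then have "Far F (\<lambda>\<^sub>I U) (Ften F ?I U ?e (\<phi> u)) = Far F (\<lambda>\<^sub>I U) (Ften F ?I U ?e (\<phi> (\<phi> u)))" by simp
  then have "\<phi> u = \<phi> (\<phi> u)" using u by (simp add: Far_LUnit smult_one_Fob)
  then have "\<phi> u = u" using \<phi>_inj[of "\<phi> u" u] u by simp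
  then show ?thesis using \<beta>\<phi>[OF u] by simp
qed

text \<open>The mirror argument with \<open>hexagon2\<close> and inverse associators. It is carried
  out separately because the braiding is not assumed symmetric, so this arrow is not given as the
  inverse of the one treated before.\<close>

lemma Braid_Unit_left:
  assumes U: "U \<in> Ob C" and u: "u \<in> carrier (Fob F U)"
  shows "Far F (\<beta> \<I> U) (Ften F \<I> U \<one>\<^bsub>K\<^esub> u) = Ften F U \<I> u \<one>\<^bsub>K\<^esub>"
proof -
  let ?I = "Unit C" and ?e = "\<one>\<^bsub>K\<^esub>"
  note O [simp] = U Unit_Ob TOb_Ob Fob_Unit_one
  define \<phi> where "\<phi> x = Far F (\<rho>\<^sub>I U) (Far F (\<beta> ?I U) (Ften F ?I U ?e x))" for x
  have \<beta>I: "Far F (\<beta> ?I U) (Ften F ?I U ?e x) \<in> carrier (Fob F (U \<boxtimes> ?I))"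
    if "x \<in> carrier (Fob F U)" for x
    by (rule Far_closed[OF Braid_Hom]) (use that in auto)
  have \<phi> [simp]: "\<phi> x \<in> carrier (Fob F U)" if "x \<in> carrier (Fob F U)" for x
    unfolding \<phi>_def by (rule Far_closed[OF RUnit_Hom]) (use that \<beta>I in auto)
  have \<beta>\<phi>: "Far F (\<beta> ?I U) (Ften F ?I U ?e x) = Ften F U ?I (\<phi> x) ?e" if x: "x \<in> carrier (Fob F U)" for x
  proof (rule Far_iso_inj[OF RUnit_iso])
    show "Far F (\<rho>\<^sub>I U) (Far F (\<beta> ?I U) (Ften F ?I U ?e x)) = Far F (\<rho>\<^sub>I U) (Ften F U ?I (\<phi> x) ?e)"
      using x by (simp add: Far_RUnit smult_one_Fob \<phi>_def[symmetric])
  qed (use x \<beta>I in auto)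
  have \<phi>_inj: "x = y" if "x \<in> carrier (Fob F U)" "y \<in> carrier (Fob F U)" "\<phi> x = \<phi> y" for x y
  proof -
    have "Far F (\<beta> ?I U) (Ften F ?I U ?e x) = Far F (\<beta> ?I U) (Ften F ?I U ?e y)"
      using that by (simp add: \<beta>\<phi>)
    then have "Ften F ?I U ?e x = Ften F ?I U ?e y"
      by (rule Far_iso_inj[OF Braid_iso, rotated -1]) (use that in auto)
    then have "Far F (\<lambda>\<^sub>I U) (Ften F ?I U ?e x) = Far F (\<lambda>\<^sub>I U) (Ften F ?I U ?e y)" by simp
    then show ?thesis using that by (simp add: Far_LUnit smult_one_Fob)
  qed
  let ?t = "Ften F ?I (?I \<boxtimes> U) ?e (Ften F ?I U ?e u)"
  let ?s = "Ften F (?I \<boxtimes> ?I) U (Ften F ?I ?I ?e ?e) u"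
  have t: "?t \<in> carrier (Fob F (?I \<boxtimes> (?I \<boxtimes> U)))" using u by auto
  have s: "?s \<in> carrier (Fob F ((?I \<boxtimes> ?I) \<boxtimes> U))" using u by auto
  note II = TOb_Ob[OF Unit_Ob Unit_Ob]
  note a1 = Assoc_inv_Hom[OF Unit_Ob Unit_Ob U]
  note b1 = Braid_Hom[OF II U]
  note a2 = Assoc_inv_Hom[OF U Unit_Ob Unit_Ob]
  note c1 = TAr_Hom[OF Idn_Hom[OF Unit_Ob] Braid_Hom[OF Unit_Ob U]]
  note c2 = Assoc_inv_Hom[OF Unit_Ob U Unit_Ob]
  note c3 = TAr_Hom[OF Braid_Hom[OF Unit_Ob U] Idn_Hom[OF Unit_Ob]]
  have "Far F (\<alpha>\<^sub>i U ?I ?I) (Far F (\<beta> (?I \<boxtimes> ?I) U) (Far F (\<alpha>\<^sub>i ?I ?I U) ?t))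
    = Far F (\<beta> ?I U \<star> Idn C ?I) (Far F (\<alpha>\<^sub>i ?I U ?I) (Far F (Idn C ?I \<star> \<beta> ?I U) ?t))"
    using arg_cong[OF hexagon2[OF Unit_Ob Unit_Ob U], of "\<lambda>f. Far F f ?t"]
    by (simp add: Far_Comp[OF a1 Comp_Hom[OF b1 a2] t] Far_Comp[OF b1 a2 Far_closed[OF a1 t]]
        Far_Comp[OF c1 Comp_Hom[OF c2 c3] t] Far_Comp[OF c2 c3 Far_closed[OF c1 t]])
  also have "\<dots> = Ften F (U \<boxtimes> ?I) ?I (Ften F U ?I (\<phi> (\<phi> u)) ?e) ?e"
    using u by (simp add: Far_TAr[OF Braid_Hom[OF Unit_Ob U] Idn_Hom[OF Unit_Ob]]
        Far_TAr[OF Idn_Hom[OF Unit_Ob] Braid_Hom[OF Unit_Ob U]] Far_Idn \<beta>\<phi> Far_Assoc_inv)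
  finally have "Far F (\<alpha> U ?I ?I) (Far F (\<alpha>\<^sub>i U ?I ?I) (Far F (\<beta> (?I \<boxtimes> ?I) U) (Far F (\<alpha>\<^sub>i ?I ?I U) ?t)))
    = Far F (\<alpha> U ?I ?I) (Ften F (U \<boxtimes> ?I) ?I (Ften F U ?I (\<phi> (\<phi> u)) ?e) ?e)" by simp
  then have "Far F (\<beta> (?I \<boxtimes> ?I) U) (Far F (\<alpha>\<^sub>i ?I ?I U) ?t)
    = Ften F U (?I \<boxtimes> ?I) (\<phi> (\<phi> u)) (Ften F ?I ?I ?e ?e)"
    using u Far_inv_arrow2[OF Assoc_iso[OF U Unit_Ob Unit_Ob] Far_closed[OF b1 Far_closed[OF a1 t]]]
    by (simp add: Far_Assoc Assoc_inv_def)
  then have *: "Far F (\<beta> (?I \<boxtimes> ?I) U) ?s = Ften F U (?I \<boxtimes> ?I) (\<phi> (\<phi> u)) (Ften F ?I ?I ?e ?e)"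
    using u by (simp add: Far_Assoc_inv)
  note l = LUnit_Hom[OF Unit_Ob]
  note n1 = TAr_Hom[OF l Idn_Hom[OF U]]
  note n2 = TAr_Hom[OF Idn_Hom[OF U] l]
  have "Far F (\<beta> ?I U) (Far F (\<lambda>\<^sub>I ?I \<star> Idn C U) ?s) = Far F (Idn C U \<star> \<lambda>\<^sub>I ?I) (Far F (\<beta> (?I \<boxtimes> ?I) U) ?s)"
    using arg_cong[OF Braid_natural[OF l Idn_Hom[OF U]], of "\<lambda>f. Far F f ?s"]
    by (simp add: Far_Comp[OF n1 Braid_Hom[OF Unit_Ob U] s] Far_Comp[OF b1 n2 s])
  then have "Ften F U ?I (\<phi> u) ?e = Ften F U ?I (\<phi> (\<phi> u)) ?e"
    using u by (simp add: Far_TAr[OF Idn_Hom[OF U] l] Far_TAr[OF l Idn_Hom[OF U]] *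
        Far_Idn Far_LUnit smult_one_Fob \<beta>\<phi>)
  then have "Far F (\<rho>\<^sub>I U) (Ften F U ?I (\<phi> u) ?e) = Far F (\<rho>\<^sub>I U) (Ften F U ?I (\<phi> (\<phi> u)) ?e)" by simp
  then have "\<phi> u = \<phi> (\<phi> u)" using u by (simp add: Far_RUnit smult_one_Fob)
  then have "\<phi> u = u" using \<phi>_inj[of "\<phi> u" u] u by simp
  then show ?thesis using \<beta>\<phi>[OF u] by simp
qed

end

section \<open>Sweedler calculus\<close>

locale fibred_hopf_algebra = braided_forgetful_functor K C F + braided_hopf_algebra C H m \<eta> \<Delta> \<epsilon> S
  for K :: "'v ring" and C :: "('o, 'a, 'z) braided_cat_scheme" (structure) and F
    and H m \<eta> \<Delta> \<epsilon> S +
  assumes fin_dim: "vectorspace.fin_dim K (Fob F H)"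
begin

abbreviation k where "k \<equiv> scalar_space K"
abbreviation A where "A \<equiv> Fob F H"
abbreviation HH where "HH \<equiv> H \<boxtimes> H"
abbreviation ten where "ten \<equiv> Ften F H H"
abbreviation lift where
  "lift X Y \<equiv> tensor_lift K (Fob F X) (Fob F Y) (Fob F (X \<boxtimes> Y)) (Ften F X Y) k"

definition mul (infixl "\<bullet>" 75) where "x \<bullet> y = Far F m (ten x y)"
definition e where "e = Far F \<epsilon>"
definition s where "s = Far F S"
definition u where "u = Far F \<eta> \<one>\<^bsub>K\<^esub>"

text \<open>With \<open>\<Delta> a = \<Sum> a\<^sub>1 \<otimes> a\<^sub>2\<close> and \<open>\<beta> (a \<otimes> b) = \<Sum> b' \<otimes> a'\<close>, these are \<open>\<Sum> f a\<^sub>1 a\<^sub>2\<close> and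
  \<open>\<Sum> f b' a'\<close>: tensors are used only through the values of bilinear forms on them.\<close>

definition D where "D f a = lift H H f (Far F \<Delta> a)"
definition B where "B f a b = lift H H f (Far F (\<beta> H H) (ten a b))"

section \<open>Linearity of Sweedler expressions in each variable\<close>

lemma vs_k: "vectorspace K k"
  by (rule vectorspace_scalar_space) (rule field_axioms)

lemma vs_A: "vectorspace K A" by (rule Fob_space[OF H_Ob])

lemma lin_Far:
  assumes "f \<in> Hom C X Y" "linear_map K U (Fob F X) g"
  shows "linear_map K U (Fob F Y) (\<lambda>x. Far F f (g x))"
  by (rule linear_map_comp[OF assms(2) Far_linear[OF assms(1)]])

lemma lin_ten_left:
  assumes "X \<in> Ob C" "Y \<in> Ob C" "y \<in> carrier (Fob F Y)" "linear_map K U (Fob F X) g"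
  shows "linear_map K U (Fob F (X \<boxtimes> Y)) (\<lambda>x. Ften F X Y (g x) y)"
  by (rule bilinear_left_comp[OF Ften_bilinear[OF assms(1,2)] assms(3,4)])

lemma lin_ten_right:
  assumes "X \<in> Ob C" "Y \<in> Ob C" "x \<in> carrier (Fob F X)" "linear_map K U (Fob F Y) g"
  shows "linear_map K U (Fob F (X \<boxtimes> Y)) (\<lambda>y. Ften F X Y x (g y))"
  by (rule bilinear_right_comp[OF Ften_bilinear[OF assms(1,2)] assms(3,4)])

lemma lin_lift:
  assumes "X \<in> Ob C" "Y \<in> Ob C" "bilinear_map K (Fob F X) (Fob F Y) k b"
    and "linear_map K U (Fob F (X \<boxtimes> Y)) g"
  shows "linear_map K U k (\<lambda>x. lift X Y b (g x))"
  by (rule linear_map_comp[OF assms(4) tensor_lift_linear[OF Fob_TOb[OF assms(1,2)] vs_k assms(3)]])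

lemma lin_lift_param:
  assumes "X \<in> Ob C" "Y \<in> Ob C" "vectorspace K P" "t \<in> carrier (Fob F (X \<boxtimes> Y))"
    and "\<And>p. p \<in> carrier P \<Longrightarrow> bilinear_map K (Fob F X) (Fob F Y) k (b p)"
    and "\<And>x y. x \<in> carrier (Fob F X) \<Longrightarrow> y \<in> carrier (Fob F Y) \<Longrightarrow> linear_map K P k (\<lambda>p. b p x y)"
  shows "linear_map K P k (\<lambda>p. lift X Y (b p) t)"
  by (rule tensor_lift_parameter_linear[OF Fob_TOb[OF assms(1,2)] vs_k assms(3)]) (use assms in auto)

lemma lift_pure:
  assumes "X \<in> Ob C" "Y \<in> Ob C" "bilinear_map K (Fob F X) (Fob F Y) k b"
    and "x \<in> carrier (Fob F X)" "y \<in> carrier (Fob F Y)"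
  shows "lift X Y b (Ften F X Y x y) = b x y"
  by (rule tensor_lift_pure[OF Fob_TOb[OF assms(1,2)] vs_k assms(3-5)])

lemmas ten_ext = tensor_ext[OF Fob_TOb]

lemma mul_closed [simp]: "x \<in> carrier A \<Longrightarrow> y \<in> carrier A \<Longrightarrow> x \<bullet> y \<in> carrier A"
  unfolding mul_def by (intro Far_closed[OF m_Hom] Ften_closed H_Ob)

lemma e_closed [simp]: "x \<in> carrier A \<Longrightarrow> e x \<in> carrier K"
  using Far_closed[OF \<epsilon>_Hom, of x] by (simp add: e_def Fob_Unit)

lemma s_closed [simp]: "x \<in> carrier A \<Longrightarrow> s x \<in> carrier A"
  unfolding s_def by (rule Far_closed[OF S_Hom])

lemma u_closed [simp]: "u \<in> carrier A"
  unfolding u_def by (rule Far_closed[OF \<eta>_Hom Fob_Unit_one])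

lemma \<Delta>_closed [simp]: "x \<in> carrier A \<Longrightarrow> Far F \<Delta> x \<in> carrier (Fob F HH)"
  by (rule Far_closed[OF \<Delta>_Hom])

lemma \<beta>_closed [simp]: "t \<in> carrier (Fob F HH) \<Longrightarrow> Far F (\<beta> H H) t \<in> carrier (Fob F HH)"
  by (rule Far_closed[OF Braid_Hom]) (auto simp: H_Ob)

lemma lin_e: "linear_map K X A g \<Longrightarrow> linear_map K X k (\<lambda>x. e (g x))"
  unfolding e_def using lin_Far[OF \<epsilon>_Hom, of X g] by (simp add: Fob_Unit)

lemma lin_s: "linear_map K X A g \<Longrightarrow> linear_map K X A (\<lambda>x. s (g x))"
  unfolding s_def by (rule lin_Far[OF S_Hom])

lemma lin_mul_left: "y \<in> carrier A \<Longrightarrow> linear_map K X A g \<Longrightarrow> linear_map K X A (\<lambda>x. g x \<bullet> y)"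
  unfolding mul_def by (rule lin_Far[OF m_Hom lin_ten_left[OF H_Ob H_Ob]])

lemma lin_mul_right: "y \<in> carrier A \<Longrightarrow> linear_map K X A g \<Longrightarrow> linear_map K X A (\<lambda>x. y \<bullet> g x)"
  unfolding mul_def by (rule lin_Far[OF m_Hom lin_ten_right[OF H_Ob H_Ob]])

lemma lin_scalar_left:
  assumes "c \<in> carrier K" "linear_map K X k g" shows "linear_map K X k (\<lambda>x. g x \<otimes>\<^bsub>K\<^esub> c)"
proof -
  have "linear_map K X k (\<lambda>x. c \<odot>\<^bsub>k\<^esub> g x)" by (rule linear_map_pointwise_smult[OF assms(2,1)])
  then show ?thesis
    by (rule linear_map_cong) (use assms linear_map_closed[OF assms(2)] in \<open>simp add: m_comm\<close>)
qed

lemma lin_scalar_right: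
  assumes "c \<in> carrier K" "linear_map K X k g" shows "linear_map K X k (\<lambda>x. c \<otimes>\<^bsub>K\<^esub> g x)"
  using linear_map_pointwise_smult[OF assms(2,1)] by simp

lemma lin_D: "bilinear_map K A A k f \<Longrightarrow> linear_map K X A g \<Longrightarrow> linear_map K X k (\<lambda>x. D f (g x))"
  unfolding D_def by (rule lin_lift[OF H_Ob H_Ob _ lin_Far[OF \<Delta>_Hom]])

lemma lin_D_param:
  assumes "vectorspace K P" "a \<in> carrier A"
    and "\<And>p. p \<in> carrier P \<Longrightarrow> bilinear_map K A A k (f p)"
    and "\<And>x y. x \<in> carrier A \<Longrightarrow> y \<in> carrier A \<Longrightarrow> linear_map K P k (\<lambda>p. f p x y)"
  shows "linear_map K P k (\<lambda>p. D (f p) a)"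
  unfolding D_def by (rule lin_lift_param[OF H_Ob H_Ob]) (use assms in auto)

lemma lin_B_left:
  "bilinear_map K A A k f \<Longrightarrow> b \<in> carrier A \<Longrightarrow> linear_map K X A g \<Longrightarrow> linear_map K X k (\<lambda>x. B f (g x) b)"
  unfolding B_def
  by (rule lin_lift[OF H_Ob H_Ob _ lin_Far[OF Braid_Hom[OF H_Ob H_Ob] lin_ten_left[OF H_Ob H_Ob]]])

lemma lin_B_right:
  "bilinear_map K A A k f \<Longrightarrow> a \<in> carrier A \<Longrightarrow> linear_map K X A g \<Longrightarrow> linear_map K X k (\<lambda>x. B f a (g x))"
  unfolding B_def
  by (rule lin_lift[OF H_Ob H_Ob _ lin_Far[OF Braid_Hom[OF H_Ob H_Ob] lin_ten_right[OF H_Ob H_Ob]]])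

lemma lin_B_param:
  assumes "vectorspace K P" "a \<in> carrier A" "b \<in> carrier A"
    and "\<And>p. p \<in> carrier P \<Longrightarrow> bilinear_map K A A k (f p)"
    and "\<And>x y. x \<in> carrier A \<Longrightarrow> y \<in> carrier A \<Longrightarrow> linear_map K P k (\<lambda>p. f p x y)"
  shows "linear_map K P k (\<lambda>p. B (f p) a b)"
  unfolding B_def by (rule lin_lift_param[OF H_Ob H_Ob]) (use assms H_Ob in auto)

lemmas lin_A = linear_map_id[OF vs_A]

text \<open>Each rule has an inner linear map \<open>g\<close> in the varying position, so backward
  chaining with \<open>lins\<close> peels off the outermost operation and reduces any nested
  expression to the identity map.\<close>

lemmas lins = bilinear_mapI lin_A vs_A vs_k lin_e lin_s lin_mul_left lin_mul_right lin_scalar_left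
  lin_scalar_right lin_D lin_D_param lin_B_left lin_B_right lin_B_param

lemma D_closed: "bilinear_map K A A k f \<Longrightarrow> a \<in> carrier A \<Longrightarrow> D f a \<in> carrier K"
  using linear_map_closed[OF lin_D[OF _ lin_A]] by simp

lemma B_closed: "bilinear_map K A A k f \<Longrightarrow> a \<in> carrier A \<Longrightarrow> b \<in> carrier A \<Longrightarrow> B f a b \<in> carrier K"
  using linear_map_closed[OF lin_B_left[OF _ _ lin_A]] by simp

lemma D_cong: "(\<And>x y. x \<in> carrier A \<Longrightarrow> y \<in> carrier A \<Longrightarrow> f x y = g x y) \<Longrightarrow> D f a = D g a"
  unfolding D_def by (rule arg_cong[of _ _ "\<lambda>f. f _"], rule tensor_lift_cong)

lemma B_cong: "(\<And>x y. x \<in> carrier A \<Longrightarrow> y \<in> carrier A \<Longrightarrow> f x y = g x y) \<Longrightarrow> B f a b = B g a b"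
  unfolding B_def by (rule arg_cong[of _ _ "\<lambda>f. f _"], rule tensor_lift_cong)

lemma D_scale:
  assumes "bilinear_map K A A k f" "c \<in> carrier K" "a \<in> carrier A"
  shows "D (\<lambda>x y. c \<otimes>\<^bsub>K\<^esub> f x y) a = c \<otimes>\<^bsub>K\<^esub> D f a"
proof -
  have "linear_map K k k (\<lambda>x. c \<otimes>\<^bsub>K\<^esub> x)"
    by (rule lin_scalar_right[OF assms(2) linear_map_id[OF vs_k]])
  from tensor_lift_linear_comp[OF Fob_TOb[OF H_Ob H_Ob] assms(1) this \<Delta>_closed[OF assms(3)]]
  show ?thesis by (simp add: D_def)
qed

lemma Far_Comp2:
  assumes "f \<in> Hom C U V" "g \<in> Hom C V W" "h \<in> Hom C W X" "x \<in> carrier (Fob F U)"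
  shows "Far F (h \<cdot> g \<cdot> f) x = Far F h (Far F g (Far F f x))"
  by (simp add: Far_Comp[OF assms(1) Comp_Hom[OF assms(2,3)] assms(4)]
      Far_Comp[OF assms(2,3) Far_closed[OF assms(1,4)]])

section \<open>The Hopf algebra axioms on elements and under forms\<close>

lemmas I_H = Idn_Hom[OF H_Ob]
lemmas HH_Ob = TOb_Ob[OF H_Ob H_Ob]
lemmas Far_Idn_H = Far_Idn[OF H_Ob]

lemma mul_ass: "a \<in> carrier A \<Longrightarrow> b \<in> carrier A \<Longrightarrow> c \<in> carrier A \<Longrightarrow> a \<bullet> b \<bullet> c = a \<bullet> (b \<bullet> c)"
  using arg_cong[OF mul_assoc, of "\<lambda>f. Far F f (Ften F HH H (ten a b) c)"]
  by (simp add: H_Ob HH_Ob Far_Comp[OF TAr_Hom[OF m_Hom I_H] m_Hom] Far_TAr[OF m_Hom I_H] Far_TAr[OF I_H m_Hom]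
      Far_Comp2[OF Assoc_Hom[OF H_Ob H_Ob H_Ob] TAr_Hom[OF I_H m_Hom] m_Hom] Far_Assoc Far_Idn_H mul_def)

lemma u_mul [simp]: "a \<in> carrier A \<Longrightarrow> u \<bullet> a = a"
  using arg_cong[OF m_lunit, of "\<lambda>f. Far F f (Ften F \<I> H \<one>\<^bsub>K\<^esub> a)"]
  by (simp add: H_Ob Unit_Ob Fob_Unit_one Far_Comp[OF TAr_Hom[OF \<eta>_Hom I_H] m_Hom] Far_TAr[OF \<eta>_Hom I_H]
      Far_LUnit Far_Idn_H mul_def u_def smult_one_Fob)

lemma mul_u [simp]: "a \<in> carrier A \<Longrightarrow> a \<bullet> u = a"
  using arg_cong[OF m_runit, of "\<lambda>f. Far F f (Ften F H \<I> a \<one>\<^bsub>K\<^esub>)"]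
  by (simp add: H_Ob Unit_Ob Fob_Unit_one Far_Comp[OF TAr_Hom[OF I_H \<eta>_Hom] m_Hom] Far_TAr[OF I_H \<eta>_Hom]
      Far_RUnit Far_Idn_H mul_def u_def smult_one_Fob)

lemma e_mul [simp]: "a \<in> carrier A \<Longrightarrow> b \<in> carrier A \<Longrightarrow> e (a \<bullet> b) = e a \<otimes>\<^bsub>K\<^esub> e b"
  using arg_cong[OF \<epsilon>_m, of "\<lambda>f. Far F f (ten a b)"] e_closed[of a] e_closed[of b]
  by (simp add: H_Ob Unit_Ob Far_Comp[OF m_Hom \<epsilon>_Hom] Far_Comp[OF TAr_Hom[OF \<epsilon>_Hom \<epsilon>_Hom] LUnit_Hom[OF Unit_Ob]]
      Far_TAr[OF \<epsilon>_Hom \<epsilon>_Hom] Far_LUnit mul_def e_def Fob_Unit)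

lemma e_u [simp]: "e u = \<one>\<^bsub>K\<^esub>"
  using arg_cong[OF \<epsilon>_\<eta>, of "\<lambda>f. Far F f \<one>\<^bsub>K\<^esub>"]
  by (simp add: Far_Comp[OF \<eta>_Hom \<epsilon>_Hom] Fob_Unit_one Far_Idn[OF Unit_Ob] u_def e_def)

text \<open>A trilinear \<open>f\<close> induces one linear form \<open>G\<close> on H (x) (H (x)
  H). The two iterated expressions are \<open>G\<close> evaluated on the two sides of
  \<open>\<Delta>_coassoc\<close>, the left one after reassociation.\<close>

lemma D_coassoc:
  assumes f1: "\<And>x y. x \<in> carrier A \<Longrightarrow> y \<in> carrier A \<Longrightarrow> linear_map K A k (\<lambda>z. f x y z)"
    and f2: "\<And>x z. x \<in> carrier A \<Longrightarrow> z \<in> carrier A \<Longrightarrow> linear_map K A k (\<lambda>y. f x y z)"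
    and f3: "\<And>y z. y \<in> carrier A \<Longrightarrow> z \<in> carrier A \<Longrightarrow> linear_map K A k (\<lambda>x. f x y z)"
    and a: "a \<in> carrier A"
  shows "D (\<lambda>x z. D (\<lambda>x y. f x y z) x) a = D (\<lambda>x y. D (\<lambda>y z. f x y z) y) a"
proof -
  note [simp] = H_Ob HH_Ob
  define G where "G = lift H HH (\<lambda>x. lift H H (f x))"
  have bf: "bilinear_map K A A k (f x)" if "x \<in> carrier A" for x
    using that f1 f2 by (intro bilinear_mapI)
  have bg: "bilinear_map K A (Fob F HH) k (\<lambda>x. lift H H (f x))"
    by (intro bilinear_mapI lin_lift lin_lift_param bf vs_A linear_map_id Fob_space f3) auto
  have G: "linear_map K (Fob F (H \<boxtimes> HH)) k G"
    unfolding G_def by (intro lin_lift linear_map_id Fob_space bg) (auto intro: TOb_Ob)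
  have Gp: "G (Ften F H HH x t) = lift H H (f x) t" if "x \<in> carrier A" "t \<in> carrier (Fob F HH)" for x t
    unfolding G_def by (rule lift_pure[OF _ _ bg]) (use that in auto)
  have Gpp: "G (Ften F H HH x (ten y z)) = f x y z" if "x \<in> carrier A" "y \<in> carrier A" "z \<in> carrier A" for x y z
    using that by (simp add: Gp lift_pure bf)
  have inner: "lift H H (\<lambda>x y. f x y z) t = G (Far F (\<alpha> H H H) (Ften F HH H t z))"
    if z: "z \<in> carrier A" and t: "t \<in> carrier (Fob F HH)" for z t
  proof (rule ten_ext[OF H_Ob H_Ob _ _ _ t])
    have b: "bilinear_map K A A k (\<lambda>x y. f x y z)" using z by (intro bilinear_mapI f2 f3)
    show "linear_map K (Fob F HH) k (lift H H (\<lambda>x y. f x y z))"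
      by (intro lin_lift linear_map_id Fob_space b) auto
    show "linear_map K (Fob F HH) k (\<lambda>t. G (Far F (\<alpha> H H H) (Ften F HH H t z)))"
      by (intro linear_map_comp[OF _ G] lin_Far[OF Assoc_Hom] lin_ten_left linear_map_id Fob_space) (use z in auto)
    show "lift H H (\<lambda>x y. f x y z) (ten x y) = G (Far F (\<alpha> H H H) (Ften F HH H (ten x y) z))"
      if "x \<in> carrier A" "y \<in> carrier A" for x y
      using that z by (simp add: Far_Assoc Gpp lift_pure[OF _ _ b])
  qed
  have left: "lift H H (\<lambda>x z. D (\<lambda>x y. f x y z) x) t = G (Far F (\<alpha> H H H) (Far F (\<Delta> \<star> Idn C H) t))"
    if t: "t \<in> carrier (Fob F HH)" for t
  proof (rule ten_ext[OF H_Ob H_Ob _ _ _ t])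
    have b: "bilinear_map K A A k (\<lambda>x z. D (\<lambda>x y. f x y z) x)"
      by (intro lins f1 f2 f3) auto
    show "linear_map K (Fob F HH) k (lift H H (\<lambda>x z. D (\<lambda>x y. f x y z) x))"
      by (intro lin_lift linear_map_id Fob_space b) auto
    show "linear_map K (Fob F HH) k (\<lambda>t. G (Far F (\<alpha> H H H) (Far F (\<Delta> \<star> Idn C H) t)))"
      by (intro linear_map_comp[OF _ G] lin_Far[OF Assoc_Hom] lin_Far[OF TAr_Hom[OF \<Delta>_Hom I_H]] linear_map_id Fob_space) auto
    show "lift H H (\<lambda>x z. D (\<lambda>x y. f x y z) x) (ten x y) = G (Far F (\<alpha> H H H) (Far F (\<Delta> \<star> Idn C H) (ten x y)))"
      if "x \<in> carrier A" "y \<in> carrier A" for x y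
      using that by (simp add: Far_TAr[OF \<Delta>_Hom I_H] lift_pure[OF _ _ b] Far_Idn_H inner[OF _ \<Delta>_closed, folded D_def])
  qed
  have right: "lift H H (\<lambda>x y. D (\<lambda>y z. f x y z) y) t = G (Far F (Idn C H \<star> \<Delta>) t)"
    if t: "t \<in> carrier (Fob F HH)" for t
  proof (rule ten_ext[OF H_Ob H_Ob _ _ _ t])
    have b: "bilinear_map K A A k (\<lambda>x y. D (\<lambda>y z. f x y z) y)"
      by (intro lins f1 f2 f3) auto
    show "linear_map K (Fob F HH) k (lift H H (\<lambda>x y. D (\<lambda>y z. f x y z) y))"
      by (intro lin_lift linear_map_id Fob_space b) auto
    show "linear_map K (Fob F HH) k (\<lambda>t. G (Far F (Idn C H \<star> \<Delta>) t))"
      by (intro linear_map_comp[OF _ G] lin_Far[OF TAr_Hom[OF I_H \<Delta>_Hom]] linear_map_id Fob_space) auto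
    show "lift H H (\<lambda>x y. D (\<lambda>y z. f x y z) y) (ten x y) = G (Far F (Idn C H \<star> \<Delta>) (ten x y))"
      if "x \<in> carrier A" "y \<in> carrier A" for x y
      using that by (simp add: Far_TAr[OF I_H \<Delta>_Hom] lift_pure[OF _ _ b] Far_Idn_H Gp[OF _ \<Delta>_closed, folded D_def])
  qed
  have "Far F (\<alpha> H H H) (Far F (\<Delta> \<star> Idn C H) (Far F \<Delta> a)) = Far F (Idn C H \<star> \<Delta>) (Far F \<Delta> a)"
    using arg_cong[OF \<Delta>_coassoc, of "\<lambda>f. Far F f a"] a
    by (simp add: Far_Comp2[OF \<Delta>_Hom TAr_Hom[OF \<Delta>_Hom I_H] Assoc_Hom] Far_Comp[OF \<Delta>_Hom TAr_Hom[OF I_H \<Delta>_Hom]])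
  then show ?thesis
    using left[OF \<Delta>_closed[OF a]] right[OF \<Delta>_closed[OF a]] by (simp add: D_def[of _ a])
qed

text \<open>Formulated for an arbitrary tensor, since it serves both comultiplied elements
  (\<open>D_counit_left\<close>) and braided ones (\<open>B_counit_left\<close>).\<close>

lemma lift_e_left:
  assumes \<phi>: "linear_map K A k \<phi>" and t: "t \<in> carrier (Fob F HH)"
  shows "lift H H (\<lambda>x y. e x \<otimes>\<^bsub>K\<^esub> \<phi> y) t = \<phi> (Far F (\<lambda>\<^sub>I H) (Far F (\<epsilon> \<star> Idn C H) t))"
proof (rule ten_ext[OF H_Ob H_Ob _ _ _ t])
  note [simp] = H_Ob HH_Ob Unit_Ob
  have b: "bilinear_map K A A k (\<lambda>x y. e x \<otimes>\<^bsub>K\<^esub> \<phi> y)"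
    by (intro lins \<phi>) (use linear_map_closed[OF \<phi>] in auto)
  show "linear_map K (Fob F HH) k (lift H H (\<lambda>x y. e x \<otimes>\<^bsub>K\<^esub> \<phi> y))"
    by (intro lin_lift linear_map_id Fob_space b) auto
  show "linear_map K (Fob F HH) k (\<lambda>t. \<phi> (Far F (\<lambda>\<^sub>I H) (Far F (\<epsilon> \<star> Idn C H) t)))"
    by (intro linear_map_comp[OF _ \<phi>] lin_Far[OF LUnit_Hom] lin_Far[OF TAr_Hom[OF \<epsilon>_Hom I_H]] linear_map_id Fob_space) auto
  show "lift H H (\<lambda>x y. e x \<otimes>\<^bsub>K\<^esub> \<phi> y) (ten x y) = \<phi> (Far F (\<lambda>\<^sub>I H) (Far F (\<epsilon> \<star> Idn C H) (ten x y)))"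
    if "x \<in> carrier A" "y \<in> carrier A" for x y
    using that e_closed linear_map_smult[OF \<phi>]
    by (simp add: Far_TAr[OF \<epsilon>_Hom I_H] lift_pure[OF _ _ b] Far_Idn_H Far_LUnit flip: e_def)
qed

lemma lift_e_right:
  assumes \<phi>: "linear_map K A k \<phi>" and t: "t \<in> carrier (Fob F HH)"
  shows "lift H H (\<lambda>x y. e y \<otimes>\<^bsub>K\<^esub> \<phi> x) t = \<phi> (Far F (\<rho>\<^sub>I H) (Far F (Idn C H \<star> \<epsilon>) t))"
proof (rule ten_ext[OF H_Ob H_Ob _ _ _ t])
  note [simp] = H_Ob HH_Ob Unit_Ob
  have b: "bilinear_map K A A k (\<lambda>x y. e y \<otimes>\<^bsub>K\<^esub> \<phi> x)"
    by (intro lins \<phi>) (use linear_map_closed[OF \<phi>] in auto)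
  show "linear_map K (Fob F HH) k (lift H H (\<lambda>x y. e y \<otimes>\<^bsub>K\<^esub> \<phi> x))"
    by (intro lin_lift linear_map_id Fob_space b) auto
  show "linear_map K (Fob F HH) k (\<lambda>t. \<phi> (Far F (\<rho>\<^sub>I H) (Far F (Idn C H \<star> \<epsilon>) t)))"
    by (intro linear_map_comp[OF _ \<phi>] lin_Far[OF RUnit_Hom] lin_Far[OF TAr_Hom[OF I_H \<epsilon>_Hom]] linear_map_id Fob_space) auto
  show "lift H H (\<lambda>x y. e y \<otimes>\<^bsub>K\<^esub> \<phi> x) (ten x y) = \<phi> (Far F (\<rho>\<^sub>I H) (Far F (Idn C H \<star> \<epsilon>) (ten x y)))"
    if "x \<in> carrier A" "y \<in> carrier A" for x y
    using that e_closed linear_map_smult[OF \<phi>]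
    by (simp add: Far_TAr[OF I_H \<epsilon>_Hom] lift_pure[OF _ _ b] Far_Idn_H Far_RUnit flip: e_def)
qed

lemma D_counit_left:
  assumes "linear_map K A k \<phi>" "a \<in> carrier A"
  shows "D (\<lambda>x y. e x \<otimes>\<^bsub>K\<^esub> \<phi> y) a = \<phi> a"
  using arg_cong[OF \<Delta>_lcounit, of "\<lambda>f. Far F f a"] assms
  by (simp add: D_def lift_e_left H_Ob Far_Idn_H Far_Comp2[OF \<Delta>_Hom TAr_Hom[OF \<epsilon>_Hom I_H] LUnit_Hom])

lemma D_counit_right:
  assumes "linear_map K A k \<phi>" "a \<in> carrier A"
  shows "D (\<lambda>x y. e y \<otimes>\<^bsub>K\<^esub> \<phi> x) a = \<phi> a"
  using arg_cong[OF \<Delta>_rcounit, of "\<lambda>f. Far F f a"] assms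
  by (simp add: D_def lift_e_right H_Ob Far_Idn_H Far_Comp2[OF \<Delta>_Hom TAr_Hom[OF I_H \<epsilon>_Hom] RUnit_Hom])

lemma ten_unit_right:
  assumes "a \<in> carrier A" "c \<in> carrier K"
  shows "Ften F H \<I> a c = Ften F H \<I> (c \<odot>\<^bsub>A\<^esub> a) \<one>\<^bsub>K\<^esub>"
  using linear_map_smult[OF bilinear_map_left[OF Ften_bilinear[OF H_Ob Unit_Ob] Fob_Unit_one] assms(2,1)]
    linear_map_smult[OF bilinear_map_right[OF Ften_bilinear[OF H_Ob Unit_Ob] assms(1)] assms(2) Fob_Unit_one] assms
  by (simp add: Fob_Unit)

lemma ten_unit_left:
  assumes "a \<in> carrier A" "c \<in> carrier K"
  shows "Ften F \<I> H c a = Ften F \<I> H \<one>\<^bsub>K\<^esub> (c \<odot>\<^bsub>A\<^esub> a)"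
  using linear_map_smult[OF bilinear_map_left[OF Ften_bilinear[OF Unit_Ob H_Ob] assms(1)] assms(2) Fob_Unit_one]
    linear_map_smult[OF bilinear_map_right[OF Ften_bilinear[OF Unit_Ob H_Ob] Fob_Unit_one] assms(2,1)] assms
  by (simp add: Fob_Unit)

lemma smult_A_closed [simp]: "c \<in> carrier K \<Longrightarrow> a \<in> carrier A \<Longrightarrow> c \<odot>\<^bsub>A\<^esub> a \<in> carrier A"
  by (rule module.smult_closed[OF vectorspace.axioms(1)[OF vs_A]])

text \<open>By naturality the counit slides through the braiding and lands on \<open>b\<close>; what
  remains is the braiding of \<open>a\<close> with the unit object, which is trivial by
  \<open>Braid_Unit_right\<close>.\<close>

lemma B_counit_left:
  assumes \<phi>: "linear_map K A k \<phi>" and a: "a \<in> carrier A" and b: "b \<in> carrier A"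
  shows "B (\<lambda>x y. e x \<otimes>\<^bsub>K\<^esub> \<phi> y) a b = e b \<otimes>\<^bsub>K\<^esub> \<phi> a"
proof -
  note [simp] = H_Ob HH_Ob Unit_Ob
  have t: "ten a b \<in> carrier (Fob F HH)" using a b by simp
  have "Far F (\<epsilon> \<star> Idn C H) (Far F (\<beta> H H) (ten a b)) = Far F (\<beta> H \<I>) (Far F (Idn C H \<star> \<epsilon>) (ten a b))"
    using arg_cong[OF Braid_natural[OF I_H \<epsilon>_Hom], of "\<lambda>f. Far F f (ten a b)"] t
    by (simp add: Far_Comp[OF TAr_Hom[OF I_H \<epsilon>_Hom] Braid_Hom] Far_Comp[OF Braid_Hom TAr_Hom[OF \<epsilon>_Hom I_H]])
  also have "\<dots> = Ften F \<I> H \<one>\<^bsub>K\<^esub> (e b \<odot>\<^bsub>A\<^esub> a)"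
    using a b by (simp add: Far_TAr[OF I_H \<epsilon>_Hom] Far_Idn_H ten_unit_right[OF a e_closed[OF b]] Braid_Unit_right flip: e_def)
  finally show ?thesis
    using a b t \<phi> by (simp add: B_def lift_e_left Far_LUnit smult_one_Fob linear_map_smult[OF \<phi>])
qed

lemma B_counit_right:
  assumes \<phi>: "linear_map K A k \<phi>" and a: "a \<in> carrier A" and b: "b \<in> carrier A"
  shows "B (\<lambda>x y. e y \<otimes>\<^bsub>K\<^esub> \<phi> x) a b = e a \<otimes>\<^bsub>K\<^esub> \<phi> b"
proof -
  note [simp] = H_Ob HH_Ob Unit_Ob
  have t: "ten a b \<in> carrier (Fob F HH)" using a b by simp
  have "Far F (Idn C H \<star> \<epsilon>) (Far F (\<beta> H H) (ten a b)) = Far F (\<beta> \<I> H) (Far F (\<epsilon> \<star> Idn C H) (ten a b))"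
    using arg_cong[OF Braid_natural[OF \<epsilon>_Hom I_H], of "\<lambda>f. Far F f (ten a b)"] t
    by (simp add: Far_Comp[OF TAr_Hom[OF \<epsilon>_Hom I_H] Braid_Hom] Far_Comp[OF Braid_Hom TAr_Hom[OF I_H \<epsilon>_Hom]])
  also have "\<dots> = Ften F H \<I> (e a \<odot>\<^bsub>A\<^esub> b) \<one>\<^bsub>K\<^esub>"
    using a b by (simp add: Far_TAr[OF \<epsilon>_Hom I_H] Far_Idn_H ten_unit_left[OF b e_closed[OF a]] Braid_Unit_left flip: e_def)
  finally show ?thesis
    using a b t \<phi> by (simp add: B_def lift_e_right Far_RUnit smult_one_Fob linear_map_smult[OF \<phi>])
qed

lemma D_antipode_left:
  assumes \<phi>: "linear_map K A k \<phi>" and a: "a \<in> carrier A"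
  shows "D (\<lambda>x y. \<phi> (s x \<bullet> y)) a = e a \<otimes>\<^bsub>K\<^esub> \<phi> u"
proof -
  note [simp] = H_Ob HH_Ob Unit_Ob
  have b: "bilinear_map K A A k (\<lambda>x y. \<phi> (s x \<bullet> y))"
    by (intro bilinear_mapI linear_map_comp[OF _ \<phi>] lins) auto
  have "D (\<lambda>x y. \<phi> (s x \<bullet> y)) a = \<phi> (Far F m (Far F (S \<star> Idn C H) (Far F \<Delta> a)))"
    unfolding D_def
  proof (rule ten_ext[OF H_Ob H_Ob _ _ _ \<Delta>_closed[OF a]])
    show "linear_map K (Fob F HH) k (lift H H (\<lambda>x y. \<phi> (s x \<bullet> y)))"
      by (intro lin_lift linear_map_id Fob_space b) auto
    show "linear_map K (Fob F HH) k (\<lambda>t. \<phi> (Far F m (Far F (S \<star> Idn C H) t)))"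
      by (intro linear_map_comp[OF _ \<phi>] lin_Far[OF m_Hom] lin_Far[OF TAr_Hom[OF S_Hom I_H]] linear_map_id Fob_space) auto
    show "lift H H (\<lambda>x y. \<phi> (s x \<bullet> y)) (ten x y) = \<phi> (Far F m (Far F (S \<star> Idn C H) (ten x y)))"
      if "x \<in> carrier A" "y \<in> carrier A" for x y
      using that by (simp add: lift_pure[OF _ _ b] Far_TAr[OF S_Hom I_H] Far_Idn_H flip: mul_def s_def)
  qed
  also have "Far F m (Far F (S \<star> Idn C H) (Far F \<Delta> a)) = Far F \<eta> (e a)"
    using arg_cong[OF S_left, of "\<lambda>f. Far F f a"] a
    by (simp add: Far_Comp2[OF \<Delta>_Hom TAr_Hom[OF S_Hom I_H] m_Hom] Far_Comp[OF \<epsilon>_Hom \<eta>_Hom] e_def)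
  also have "\<dots> = e a \<odot>\<^bsub>A\<^esub> u"
    using linear_map_smult[OF Far_linear[OF \<eta>_Hom] e_closed[OF a] Fob_Unit_one] a by (simp add: Fob_Unit u_def)
  finally show ?thesis using a by (simp add: linear_map_smult[OF \<phi>])
qed

lemma D_antipode_right:
  assumes \<phi>: "linear_map K A k \<phi>" and a: "a \<in> carrier A"
  shows "D (\<lambda>x y. \<phi> (x \<bullet> s y)) a = e a \<otimes>\<^bsub>K\<^esub> \<phi> u"
proof -
  note [simp] = H_Ob HH_Ob Unit_Ob
  have b: "bilinear_map K A A k (\<lambda>x y. \<phi> (x \<bullet> s y))"
    by (intro bilinear_mapI linear_map_comp[OF _ \<phi>] lins) auto
  have "D (\<lambda>x y. \<phi> (x \<bullet> s y)) a = \<phi> (Far F m (Far F (Idn C H \<star> S) (Far F \<Delta> a)))"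
    unfolding D_def
  proof (rule ten_ext[OF H_Ob H_Ob _ _ _ \<Delta>_closed[OF a]])
    show "linear_map K (Fob F HH) k (lift H H (\<lambda>x y. \<phi> (x \<bullet> s y)))"
      by (intro lin_lift linear_map_id Fob_space b) auto
    show "linear_map K (Fob F HH) k (\<lambda>t. \<phi> (Far F m (Far F (Idn C H \<star> S) t)))"
      by (intro linear_map_comp[OF _ \<phi>] lin_Far[OF m_Hom] lin_Far[OF TAr_Hom[OF I_H S_Hom]] linear_map_id Fob_space) auto
    show "lift H H (\<lambda>x y. \<phi> (x \<bullet> s y)) (ten x y) = \<phi> (Far F m (Far F (Idn C H \<star> S) (ten x y)))"
      if "x \<in> carrier A" "y \<in> carrier A" for x y
      using that by (simp add: lift_pure[OF _ _ b] Far_TAr[OF I_H S_Hom] Far_Idn_H flip: mul_def s_def)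
  qed
  also have "Far F m (Far F (Idn C H \<star> S) (Far F \<Delta> a)) = Far F \<eta> (e a)"
    using arg_cong[OF S_right, of "\<lambda>f. Far F f a"] a
    by (simp add: Far_Comp2[OF \<Delta>_Hom TAr_Hom[OF I_H S_Hom] m_Hom] Far_Comp[OF \<epsilon>_Hom \<eta>_Hom] e_def)
  also have "\<dots> = e a \<odot>\<^bsub>A\<^esub> u"
    using linear_map_smult[OF Far_linear[OF \<eta>_Hom] e_closed[OF a] Fob_Unit_one] a by (simp add: Fob_Unit u_def)
  finally show ?thesis using a by (simp add: linear_map_smult[OF \<phi>])
qed

text \<open>Naturality along the multiplication replaces braiding past \<open>b \<bullet> c\<close>
  by braiding past b (x) c, and \<open>hexagon1\<close> splits the latter: \<open>a\<close> first
  passes \<open>b\<close>, and the resulting \<open>a'\<close> then passes \<open>c\<close>.\<close>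

lemma B_mult:
  assumes f: "bilinear_map K A A k f" and a: "a \<in> carrier A" and b: "b \<in> carrier A" and c: "c \<in> carrier A"
  shows "B f a (b \<bullet> c) = B (\<lambda>b' a'. B (\<lambda>c' a''. f (b' \<bullet> c') a'') a' c) a b"
proof -
  note [simp] = H_Ob HH_Ob TOb_Ob
  note \<beta>H = Braid_Hom[OF H_Ob H_Ob] and \<alpha>H = Assoc_Hom[OF H_Ob H_Ob H_Ob]
  note fl = bilinear_left_comp[OF f] and fr = bilinear_right_comp[OF f]
  define g where "g x = (\<lambda>y w. f (x \<bullet> y) w)" for x
  have bg: "bilinear_map K A A k (g x)" if "x \<in> carrier A" for x
    unfolding g_def by (intro lins fl fr) (use that in auto)
  have bg': "bilinear_map K A (Fob F HH) k (\<lambda>x. lift H H (g x))"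
    by (intro bilinear_mapI lin_lift lin_lift_param bg vs_A linear_map_id Fob_space)
      (auto simp: g_def intro!: lins fl fr)
  \<comment> \<open>\<open>G\<close> is the form x (x) (y (x) w) |-> f(x y, w), on which both the
    naturality side and the hexagon side can be evaluated.\<close>
  define G where "G = lift H HH (\<lambda>x. lift H H (g x))"
  have G: "linear_map K (Fob F (H \<boxtimes> HH)) k G"
    unfolding G_def by (intro lin_lift linear_map_id Fob_space bg') auto
  have Gp: "G (Ften F H HH x t) = lift H H (g x) t" if "x \<in> carrier A" "t \<in> carrier (Fob F HH)" for x t
    unfolding G_def by (rule lift_pure[OF _ _ bg']) (use that in auto)
  let ?t = "Ften F H HH a (ten b c)" and ?t' = "Ften F HH H (ten a b) c"
  have t: "?t \<in> carrier (Fob F (H \<boxtimes> HH))" "?t' \<in> carrier (Fob F (HH \<boxtimes> H))" using a b c by auto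
  define z where "z = Far F (\<beta> H HH) ?t"
  have z: "z \<in> carrier (Fob F (HH \<boxtimes> H))"
    unfolding z_def by (rule Far_closed[OF Braid_Hom t(1)]) auto
  have "Far F (\<beta> H H) (ten a (b \<bullet> c)) = Far F (m \<star> Idn C H) z"
    using arg_cong[OF Braid_natural[OF I_H m_Hom], of "\<lambda>f. Far F f ?t"] a b c t
    by (simp add: z_def Far_Comp[OF TAr_Hom[OF I_H m_Hom] Braid_Hom] Far_TAr[OF I_H m_Hom] Far_Idn_H
        Far_Comp[OF Braid_Hom TAr_Hom[OF m_Hom I_H]] mul_def)
  then have "B f a (b \<bullet> c) = lift H H f (Far F (m \<star> Idn C H) z)" by (simp add: B_def)
  also have "\<dots> = G (Far F (\<alpha> H H H) z)"
  proof (rule ten_ext[OF HH_Ob H_Ob _ _ _ z])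
    show "linear_map K (Fob F (HH \<boxtimes> H)) k (\<lambda>z. lift H H f (Far F (m \<star> Idn C H) z))"
      by (intro lin_lift lin_Far[OF TAr_Hom[OF m_Hom I_H]] linear_map_id Fob_space f) auto
    show "linear_map K (Fob F (HH \<boxtimes> H)) k (\<lambda>z. G (Far F (\<alpha> H H H) z))"
      by (intro linear_map_comp[OF _ G] lin_Far[OF \<alpha>H] linear_map_id Fob_space) auto
    fix r w assume r: "r \<in> carrier (Fob F HH)" and w: "w \<in> carrier A"
    show "lift H H f (Far F (m \<star> Idn C H) (Ften F HH H r w)) = G (Far F (\<alpha> H H H) (Ften F HH H r w))"
    proof (rule ten_ext[OF H_Ob H_Ob _ _ _ r])
      show "linear_map K (Fob F HH) k (\<lambda>r. lift H H f (Far F (m \<star> Idn C H) (Ften F HH H r w)))"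
        by (intro lin_lift lin_Far[OF TAr_Hom[OF m_Hom I_H]] lin_ten_left linear_map_id Fob_space f) (use w in auto)
      show "linear_map K (Fob F HH) k (\<lambda>r. G (Far F (\<alpha> H H H) (Ften F HH H r w)))"
        by (intro linear_map_comp[OF _ G] lin_Far[OF \<alpha>H] lin_ten_left linear_map_id Fob_space) (use w in auto)
      fix x y assume "x \<in> carrier A" "y \<in> carrier A"
      then show "lift H H f (Far F (m \<star> Idn C H) (Ften F HH H (ten x y) w))
          = G (Far F (\<alpha> H H H) (Ften F HH H (ten x y) w))"
        using w by (simp add: Far_TAr[OF m_Hom I_H] Far_Idn_H Far_Assoc Gp lift_pure[OF _ _ bg] lift_pure[OF _ _ f]
            flip: mul_def) (simp add: g_def)
    qed
  qed
  also have "Far F (\<alpha> H H H) z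
    = Far F (Idn C H \<star> \<beta> H H) (Far F (\<alpha> H H H) (Ften F HH H (Far F (\<beta> H H) (ten a b)) c))"
    using arg_cong[OF hexagon1[OF H_Ob H_Ob H_Ob], of "\<lambda>f. Far F f ?t'"] a b c t
    by (simp add: Far_Comp2[OF \<alpha>H Braid_Hom[OF H_Ob HH_Ob] \<alpha>H] Far_Assoc z_def
        Far_Comp2[OF TAr_Hom[OF \<beta>H I_H] \<alpha>H TAr_Hom[OF I_H \<beta>H]] Far_TAr[OF \<beta>H I_H] Far_Idn_H)
  finally have "B f a (b \<bullet> c)
    = G (Far F (Idn C H \<star> \<beta> H H) (Far F (\<alpha> H H H) (Ften F HH H (Far F (\<beta> H H) (ten a b)) c)))" .
  moreover have "lift H H (\<lambda>b' a'. B (\<lambda>c' a''. f (b' \<bullet> c') a'') a' c) t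
    = G (Far F (Idn C H \<star> \<beta> H H) (Far F (\<alpha> H H H) (Ften F HH H t c)))"
    if t: "t \<in> carrier (Fob F HH)" for t
  proof (rule ten_ext[OF H_Ob H_Ob _ _ _ t])
    let ?h = "\<lambda>b' a'. B (\<lambda>c' a''. f (b' \<bullet> c') a'') a' c"
    have h: "bilinear_map K A A k ?h" by (intro lins fl fr) (use c in auto)
    show "linear_map K (Fob F HH) k (lift H H ?h)"
      by (intro lin_lift linear_map_id Fob_space h) auto
    show "linear_map K (Fob F HH) k (\<lambda>t. G (Far F (Idn C H \<star> \<beta> H H) (Far F (\<alpha> H H H) (Ften F HH H t c))))"
      by (intro linear_map_comp[OF _ G] lin_Far[OF TAr_Hom[OF I_H \<beta>H]] lin_Far[OF \<alpha>H] lin_ten_left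
          linear_map_id Fob_space) (use c in auto)
    show "lift H H ?h (ten x y) = G (Far F (Idn C H \<star> \<beta> H H) (Far F (\<alpha> H H H) (Ften F HH H (ten x y) c)))"
      if "x \<in> carrier A" "y \<in> carrier A" for x y
      using that c by (simp add: lift_pure[OF _ _ h] Far_Assoc Far_TAr[OF I_H \<beta>H] Far_Idn_H Gp)
        (simp add: B_def g_def)
  qed
  ultimately show ?thesis using a b by (simp add: B_def[of _ a b])
qed

lemma Far_braid_middle:
  assumes "a \<in> carrier A" "a' \<in> carrier A" "b \<in> carrier A" "b' \<in> carrier A"
  shows "Far F (braid_middle C H H H H) (Ften F HH HH (ten a a') (ten b b'))
    = Far F (\<alpha>\<^sub>i H H HH) (Ften F H (H \<boxtimes> HH) a (Far F (\<alpha> H H H) (Ften F HH H (Far F (\<beta> H H) (ten a' b)) b')))"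
proof -
  note [simp] = H_Ob HH_Ob TOb_Ob
  note \<beta>H = Braid_Hom[OF H_Ob H_Ob] and \<alpha>H = Assoc_Hom[OF H_Ob H_Ob H_Ob]
  note inner = Comp_Hom[OF Assoc_inv_Hom[OF H_Ob H_Ob H_Ob] Comp_Hom[OF TAr_Hom[OF \<beta>H I_H] \<alpha>H]]
  show ?thesis
    unfolding braid_middle_def using assms
    by (simp add: Far_Comp2[OF Assoc_Hom[OF H_Ob H_Ob HH_Ob] TAr_Hom[OF I_H inner] Assoc_inv_Hom[OF H_Ob H_Ob HH_Ob]]
        Far_Assoc Far_TAr[OF I_H inner] Far_Idn_H Far_Assoc_inv Far_TAr[OF \<beta>H I_H]
        Far_Comp2[OF Assoc_inv_Hom[OF H_Ob H_Ob H_Ob] TAr_Hom[OF \<beta>H I_H] \<alpha>H])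
qed

lemma braid_middle_Hom: "braid_middle C H H H H \<in> Hom C (HH \<boxtimes> HH) (HH \<boxtimes> HH)"
  unfolding braid_middle_def
  by (rule Comp_Hom[OF Assoc_Hom Comp_Hom[OF TAr_Hom[OF I_H Comp_Hom[OF Assoc_inv_Hom
            Comp_Hom[OF TAr_Hom[OF Braid_Hom I_H] Assoc_Hom]]] Assoc_inv_Hom]]) (simp_all add: H_Ob TOb_Ob)

text \<open>The axiom \<open>\<Delta>_m\<close> under the form \<open>f\<close>. None of the
  comultiplied elements nor the braided middle tensor is pure, so the reduction to pure tensors
  happens in three layers: the middle tensor (\<open>inner\<close>), the coproduct of
  \<open>b\<close> (\<open>right\<close>), the coproduct of \<open>a\<close>
  (\<open>left\<close>).\<close>

lemma D_mult:
  assumes f: "bilinear_map K A A k f" and a: "a \<in> carrier A" and b: "b \<in> carrier A"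
  shows "D f (a \<bullet> b) = D (\<lambda>a1 a2. D (\<lambda>b1 b2. B (\<lambda>x y. f (a1 \<bullet> x) (y \<bullet> b2)) a2 b1) b) a"
proof -
  note [simp] = H_Ob HH_Ob TOb_Ob
  note \<beta>H = Braid_Hom[OF H_Ob H_Ob] and \<alpha>H = Assoc_Hom[OF H_Ob H_Ob H_Ob]
  note fl = bilinear_left_comp[OF f] and fr = bilinear_right_comp[OF f]
  note bm = lin_Far[OF braid_middle_Hom] and mm = lin_Far[OF TAr_Hom[OF m_Hom m_Hom]]
  let ?L = "\<lambda>s t. lift H H f (Far F (m \<star> m) (Far F (braid_middle C H H H H) (Ften F HH HH s t)))"
  let ?h = "\<lambda>a1 a2 b1 b2. B (\<lambda>x y. f (a1 \<bullet> x) (y \<bullet> b2)) a2 b1"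
  have h: "bilinear_map K A A k (?h a1 a2)" if "a1 \<in> carrier A" "a2 \<in> carrier A" for a1 a2
    by (intro lins fl fr) (use that in auto)
  have inner: "lift H H f (Far F (m \<star> m)
      (Far F (\<alpha>\<^sub>i H H HH) (Ften F H (H \<boxtimes> HH) a1 (Far F (\<alpha> H H H) (Ften F HH H t b2)))))
    = lift H H (\<lambda>x y. f (a1 \<bullet> x) (y \<bullet> b2)) t"
    if a1: "a1 \<in> carrier A" and b2: "b2 \<in> carrier A" and t: "t \<in> carrier (Fob F HH)" for a1 b2 t
  proof (rule ten_ext[OF H_Ob H_Ob _ _ _ t])
    have c: "bilinear_map K A A k (\<lambda>x y. f (a1 \<bullet> x) (y \<bullet> b2))"
      by (intro lins fl fr) (use that in auto)
    show "linear_map K (Fob F HH) k (lift H H (\<lambda>x y. f (a1 \<bullet> x) (y \<bullet> b2)))"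
      by (intro lin_lift linear_map_id Fob_space c) auto
    show "linear_map K (Fob F HH) k (\<lambda>t. lift H H f (Far F (m \<star> m)
        (Far F (\<alpha>\<^sub>i H H HH) (Ften F H (H \<boxtimes> HH) a1 (Far F (\<alpha> H H H) (Ften F HH H t b2))))))"
      by (intro lin_lift mm lin_Far[OF Assoc_inv_Hom[OF H_Ob H_Ob HH_Ob]] lin_ten_right lin_Far[OF \<alpha>H] lin_ten_left
          linear_map_id Fob_space f) (use that in auto)
    show "lift H H f (Far F (m \<star> m)
        (Far F (\<alpha>\<^sub>i H H HH) (Ften F H (H \<boxtimes> HH) a1 (Far F (\<alpha> H H H) (Ften F HH H (ten x y) b2)))))
      = lift H H (\<lambda>x y. f (a1 \<bullet> x) (y \<bullet> b2)) (ten x y)"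
      if "x \<in> carrier A" "y \<in> carrier A" for x y
      using that a1 b2 by (simp add: Far_Assoc Far_Assoc_inv Far_TAr[OF m_Hom m_Hom] lift_pure[OF _ _ f] lift_pure[OF _ _ c]
          flip: mul_def)
  qed
  have pure: "?L (ten a1 a2) (ten b1 b2) = ?h a1 a2 b1 b2"
    if "a1 \<in> carrier A" "a2 \<in> carrier A" "b1 \<in> carrier A" "b2 \<in> carrier A" for a1 a2 b1 b2
    unfolding Far_braid_middle[OF that] B_def using that by (intro inner) auto
  have right: "?L (ten a1 a2) t = lift H H (?h a1 a2) t"
    if a12: "a1 \<in> carrier A" "a2 \<in> carrier A" and t: "t \<in> carrier (Fob F HH)" for a1 a2 t
  proof (rule ten_ext[OF H_Ob H_Ob _ _ _ t])
    show "linear_map K (Fob F HH) k (?L (ten a1 a2))"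
      by (intro lin_lift mm bm lin_ten_right linear_map_id Fob_space f) (use that in auto)
    show "linear_map K (Fob F HH) k (lift H H (?h a1 a2))"
      by (intro lin_lift linear_map_id Fob_space h) (use that in auto)
    show "?L (ten a1 a2) (ten b1 b2) = lift H H (?h a1 a2) (ten b1 b2)"
      if "b1 \<in> carrier A" "b2 \<in> carrier A" for b1 b2
      using that a12 by (simp add: pure lift_pure[OF _ _ h])
  qed
  have left: "?L t (Far F \<Delta> b) = lift H H (\<lambda>a1 a2. D (?h a1 a2) b) t" if t: "t \<in> carrier (Fob F HH)" for t
  proof (rule ten_ext[OF H_Ob H_Ob _ _ _ t])
    have c: "bilinear_map K A A k (\<lambda>a1 a2. D (?h a1 a2) b)"
      by (intro lins fl fr) (use b in auto)
    show "linear_map K (Fob F HH) k (\<lambda>t. ?L t (Far F \<Delta> b))"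
      by (intro lin_lift mm bm lin_ten_left linear_map_id Fob_space f) (use b in auto)
    show "linear_map K (Fob F HH) k (lift H H (\<lambda>a1 a2. D (?h a1 a2) b))"
      by (intro lin_lift linear_map_id Fob_space c) auto
    show "?L (ten a1 a2) (Far F \<Delta> b) = lift H H (\<lambda>a1 a2. D (?h a1 a2) b) (ten a1 a2)"
      if "a1 \<in> carrier A" "a2 \<in> carrier A" for a1 a2
      using that right[OF that \<Delta>_closed[OF b], folded D_def] by (simp only: lift_pure[OF H_Ob H_Ob c])
  qed
  have "Far F \<Delta> (a \<bullet> b) = Far F (m \<star> m) (Far F (braid_middle C H H H H) (Ften F HH HH (Far F \<Delta> a) (Far F \<Delta> b)))"
    using arg_cong[OF \<Delta>_m, of "\<lambda>f. Far F f (ten a b)"] a b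
    by (simp add: Far_Comp[OF m_Hom \<Delta>_Hom] Far_TAr[OF \<Delta>_Hom \<Delta>_Hom]
        Far_Comp2[OF TAr_Hom[OF \<Delta>_Hom \<Delta>_Hom] braid_middle_Hom TAr_Hom[OF m_Hom m_Hom]] flip: mul_def)
  then show ?thesis using left[OF \<Delta>_closed[OF a]] by (simp add: D_def[of _ a] D_def[of _ "a \<bullet> b"])
qed

text \<open>The braiding is onto, so x (x) y is the braiding of its preimage. This cancels a
  braiding: an identity between the legs of a braided tensor becomes one in free variables.\<close>

lemma bilinear_eq_if_B_eq:
  assumes f: "bilinear_map K A A k f" and g: "bilinear_map K A A k g"
    and eq: "\<And>a b. a \<in> carrier A \<Longrightarrow> b \<in> carrier A \<Longrightarrow> B f a b = B g a b"
    and x: "x \<in> carrier A" and y: "y \<in> carrier A"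
  shows "f x y = g x y"
proof -
  note [simp] = H_Ob HH_Ob
  have lift: "lift H H f (Far F (\<beta> H H) t) = lift H H g (Far F (\<beta> H H) t)" if "t \<in> carrier (Fob F HH)" for t
    by (rule ten_ext[OF H_Ob H_Ob _ _ _ that])
      (use eq in \<open>auto simp: B_def intro!: lin_lift f g lin_Far[OF Braid_Hom] linear_map_id Fob_space\<close>)
  let ?t = "Far F (inv_arrow C HH HH (\<beta> H H)) (ten x y)"
  have "lift H H f (ten x y) = lift H H g (ten x y)"
    using lift[of ?t] x y Far_closed[OF inv_arrow_Hom[OF Braid_iso[OF H_Ob H_Ob]]]
      Far_inv_arrow2[OF Braid_iso[OF H_Ob H_Ob]] by simp
  then show ?thesis using x y by (simp add: lift_pure[OF _ _ f] lift_pure[OF _ _ g])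
qed

end

section \<open>Integrals\<close>

context fibred_hopf_algebra
begin

definition integral where
  "integral x \<longleftrightarrow> x \<in> carrier A \<and> (\<forall>h \<in> carrier A. h \<bullet> x = e h \<odot>\<^bsub>A\<^esub> x)"

text \<open>Fubini for two independent Sweedler sums: both sides are linear in the coproduct of
  \<open>a\<close>, which may therefore be replaced by a pure tensor.\<close>

lemma D_swap:
  assumes f1: "\<And>x y. x \<in> carrier A \<Longrightarrow> y \<in> carrier A \<Longrightarrow> bilinear_map K A A k (f x y)"
    and f2: "\<And>p q. p \<in> carrier A \<Longrightarrow> q \<in> carrier A \<Longrightarrow> bilinear_map K A A k (\<lambda>x y. f x y p q)"
    and a: "a \<in> carrier A" and b: "b \<in> carrier A"
  shows "D (\<lambda>x y. D (f x y) b) a = D (\<lambda>p q. D (\<lambda>x y. f x y p q) a) b"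
proof -
  note [simp] = H_Ob HH_Ob
  note f2l = bilinear_map_left[OF f2] and f2r = bilinear_map_right[OF f2]
    and f1l = bilinear_map_left[OF f1] and f1r = bilinear_map_right[OF f1]
  have "lift H H (\<lambda>x y. D (f x y) b) t = D (\<lambda>p q. lift H H (\<lambda>x y. f x y p q) t) b"
    if t: "t \<in> carrier (Fob F HH)" for t
  proof (rule ten_ext[OF H_Ob H_Ob _ _ _ t])
    have c: "bilinear_map K A A k (\<lambda>x y. D (f x y) b)"
      by (intro lins f1 f2l f2r b)
    show "linear_map K (Fob F HH) k (lift H H (\<lambda>x y. D (f x y) b))"
      by (intro lin_lift linear_map_id Fob_space c) auto
    have c': "bilinear_map K A A k (\<lambda>p q. lift H H (\<lambda>x y. f x y p q) t)" if "t \<in> carrier (Fob F HH)" for t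
      by (intro bilinear_mapI lin_lift_param vs_A f2 f1l f1r) (use that in auto)
    show "linear_map K (Fob F HH) k (\<lambda>t. D (\<lambda>p q. lift H H (\<lambda>x y. f x y p q) t) b)"
      by (intro lin_D_param Fob_space b c' lin_lift linear_map_id f2) auto
    show "lift H H (\<lambda>x y. D (f x y) b) (ten x y) = D (\<lambda>p q. lift H H (\<lambda>x y. f x y p q) (ten x y)) b"
      if xy: "x \<in> carrier A" "y \<in> carrier A" for x y
      unfolding lift_pure[OF H_Ob H_Ob c xy] by (rule D_cong) (simp add: xy lift_pure[OF _ _ f2])
  qed
  from this[OF \<Delta>_closed[OF a]] show ?thesis by (simp add: D_def[of _ a])
qed

text \<open>In effect, the first leg of beta(h (x) L) is again an integral. Braiding a past b L can
  be computed by \<open>B_mult\<close> or through b L = e(b) L. The results are two forms in the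
  legs of beta(a (x) b), and cancelling that braiding frees these legs to be the given
  \<open>g\<close> and \<open>h\<close>.\<close>

lemma B_integral:
  assumes f: "bilinear_map K A A k f" and L: "integral L" and g: "g \<in> carrier A" and h: "h \<in> carrier A"
  shows "B (\<lambda>x y. f (g \<bullet> x) y) h L = e g \<otimes>\<^bsub>K\<^esub> B f h L"
proof -
  note fl = bilinear_left_comp[OF f] and fr = bilinear_right_comp[OF f]
  have LA [simp]: "L \<in> carrier A" and Li: "\<And>x. x \<in> carrier A \<Longrightarrow> x \<bullet> L = e x \<odot>\<^bsub>A\<^esub> L"
    using L by (auto simp: integral_def)
  let ?P = "\<lambda>b a. B (\<lambda>c a'. f (b \<bullet> c) a') a L" and ?Q = "\<lambda>b a. e b \<otimes>\<^bsub>K\<^esub> B f a L"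
  have lB: "linear_map K A k (\<lambda>a. B f a L)" by (intro lins f) auto
  have P: "bilinear_map K A A k ?P" by (intro lins fl fr) auto
  have Q: "bilinear_map K A A k ?Q" by (intro lins f B_closed) auto
  have "B ?P a b = B ?Q a b" if ab: "a \<in> carrier A" "b \<in> carrier A" for a b
  proof -
    have "B ?P a b = B f a (b \<bullet> L)" using B_mult[OF f ab LA] by simp
    also have "\<dots> = B f a (e b \<odot>\<^bsub>A\<^esub> L)" using ab by (simp add: Li)
    also have "\<dots> = e b \<otimes>\<^bsub>K\<^esub> B f a L"
      using linear_map_smult[OF lin_B_right[OF f ab(1) lin_A] e_closed[OF ab(2)] LA] by simp
    \<comment> \<open>The scalar \<open>e b\<close> is put back under the braiding of
      \<open>a\<close> with \<open>b\<close>, so that both sides become forms of the same braided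
      tensor and can be compared.\<close>
    also have "\<dots> = B ?Q a b" using B_counit_left[OF lB ab] by simp
    finally show ?thesis .
  qed
  from bilinear_eq_if_B_eq[OF P Q this g h] show ?thesis .
qed

text \<open>In Sweedler notation: \<open>h \<Lambda>\<^sub>1 \<otimes> S \<Lambda>\<^sub>2 = \<Sum> \<Lambda>'\<^sub>1 \<otimes> S \<Lambda>'\<^sub>2 h'\<close>, where \<open>\<beta> (h \<otimes> \<Lambda>) = \<Sum> \<Lambda>' \<otimes> h'\<close>.
  Writing \<open>f\<close> through its transform \<open>g\<close> along the Galois map \<open>a \<otimes> b \<mapsto> a\<^sub>1 \<otimes> a\<^sub>2 b\<close> avoids
  the braided anti-multiplicativity of \<open>S\<close>.\<close>

lemma D_mult_integral:
  assumes f: "bilinear_map K A A k f" and L: "integral L" and h: "h \<in> carrier A"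
  shows "D (\<lambda>x y. f (h \<bullet> x) (s y)) L = B (\<lambda>x y. D (\<lambda>x1 x2. f x1 (s x2 \<bullet> y)) x) h L"
proof -
  note fl = bilinear_left_comp[OF f] and fr = bilinear_right_comp[OF f]
  have LA [simp]: "L \<in> carrier A" using L by (simp add: integral_def)
  define g where "g x y = D (\<lambda>x1 x2. f x1 (s x2 \<bullet> y)) x" for x y
  have g: "bilinear_map K A A k g"
    unfolding g_def by (intro lins fl fr) auto
  note gl = bilinear_left_comp[OF g] and gr = bilinear_right_comp[OF g]
  \<comment> \<open>The inverse of the Galois map is a (x) b |-> a_1 (x) S(a_2) b, and
    \<open>g\<close> is \<open>f\<close> composed with it; composing with the Galois map recovers
    \<open>f\<close> by coassociativity and the antipode axiom.\<close>
  have fg: "f a b = D (\<lambda>x y. g x (y \<bullet> b)) a" if [simp]: "a \<in> carrier A" "b \<in> carrier A" for a b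
  proof -
    have "D (\<lambda>x y. g x (y \<bullet> b)) a = D (\<lambda>x z. D (\<lambda>x y. f x (s y \<bullet> (z \<bullet> b))) x) a" by (simp add: g_def)
    also have "\<dots> = D (\<lambda>x y. D (\<lambda>y z. f x (s y \<bullet> (z \<bullet> b))) y) a"
      by (rule D_coassoc) (auto intro!: lins fl fr)
    also have "\<dots> = D (\<lambda>x y. e y \<otimes>\<^bsub>K\<^esub> f x b) a"
    proof (rule D_cong)
      fix x y assume [simp]: "x \<in> carrier A" "y \<in> carrier A"
      have "D (\<lambda>y z. f x (s y \<bullet> (z \<bullet> b))) y = D (\<lambda>y z. f x ((s y \<bullet> z) \<bullet> b)) y"
        by (rule D_cong) (simp add: mul_ass)
      also have "\<dots> = e y \<otimes>\<^bsub>K\<^esub> f x (u \<bullet> b)"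
        by (rule D_antipode_left[of "\<lambda>w. f x (w \<bullet> b)"]) (auto intro!: lins fr)
      finally show "D (\<lambda>y z. f x (s y \<bullet> (z \<bullet> b))) y = e y \<otimes>\<^bsub>K\<^esub> f x b" by simp
    qed
    also have "\<dots> = f a b" by (rule D_counit_right) (auto intro!: lins fl)
    finally show ?thesis by simp
  qed
  \<comment> \<open>With \<open>x\<close> for L_1 and \<open>y\<close> for the factor multiplied on
    at the right, \<open>G\<close> is \<open>g\<close> on the braided expansion of the coproduct of
    h L.\<close>
  define G where "G x y = D (\<lambda>h1 h2. B (\<lambda>p q. g (h1 \<bullet> p) (q \<bullet> y)) h2 x) h" for x y
  have G: "bilinear_map K A A k G"
    unfolding G_def by (intro lins gl gr) (use h in auto)
  note Gl = bilinear_left_comp[OF G] and Gr = bilinear_right_comp[OF G]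
  have "D (\<lambda>x y. f (h \<bullet> x) (s y)) L = D (\<lambda>x y. D (\<lambda>x1 x2. G x1 (x2 \<bullet> s y)) x) L"
  proof (rule D_cong)
    fix x y assume [simp]: "x \<in> carrier A" "y \<in> carrier A"
    have "f (h \<bullet> x) (s y) = D (\<lambda>p q. g p (q \<bullet> s y)) (h \<bullet> x)" using h by (simp add: fg)
    also have "\<dots> = D (\<lambda>h1 h2. D (\<lambda>x1 x2. B (\<lambda>p q. g (h1 \<bullet> p) (q \<bullet> x2 \<bullet> s y)) h2 x1) x) h"
      by (rule D_mult) (use h in \<open>auto intro!: lins gl gr\<close>)
    also have "\<dots> = D (\<lambda>x1 x2. D (\<lambda>h1 h2. B (\<lambda>p q. g (h1 \<bullet> p) (q \<bullet> x2 \<bullet> s y)) h2 x1) h) x"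
      by (rule D_swap) (use h in \<open>auto intro!: lins gl gr\<close>)
    also have "\<dots> = D (\<lambda>x1 x2. G x1 (x2 \<bullet> s y)) x"
      unfolding G_def by (intro D_cong B_cong) (simp add: mul_ass)
    finally show "f (h \<bullet> x) (s y) = D (\<lambda>x1 x2. G x1 (x2 \<bullet> s y)) x" .
  qed
  \<comment> \<open>Regrouping brings L_2 next to S(L_3), and this product collapses to a counit. It
    is the reason for passing to \<open>g\<close>: the antipode never has to be applied to a
    product.\<close>
  also have "\<dots> = D (\<lambda>x y. D (\<lambda>y z. G x (y \<bullet> s z)) y) L"
    by (rule D_coassoc) (auto intro!: lins Gl Gr)
  also have "\<dots> = D (\<lambda>x y. e y \<otimes>\<^bsub>K\<^esub> G x u) L"
    by (rule D_cong, rule D_antipode_right[of "G _"]) (auto intro!: Gr lins)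
  also have "\<dots> = G L u" by (rule D_counit_right) (auto intro!: lins Gl)
  \<comment> \<open>The factor h_1 multiplies the first leg of beta(h_2 (x) L), which is an
    integral, so it turns into the scalar e(h_1) and the counit axiom restores h.\<close>
  also have "\<dots> = D (\<lambda>h1 h2. e h1 \<otimes>\<^bsub>K\<^esub> B g h2 L) h"
    unfolding G_def
  proof (rule D_cong)
    fix h1 h2 assume hh: "h1 \<in> carrier A" "h2 \<in> carrier A"
    have "B (\<lambda>p q. g (h1 \<bullet> p) (q \<bullet> u)) h2 L = B (\<lambda>p q. g (h1 \<bullet> p) q) h2 L"
      by (rule B_cong) simp
    then show "B (\<lambda>p q. g (h1 \<bullet> p) (q \<bullet> u)) h2 L = e h1 \<otimes>\<^bsub>K\<^esub> B g h2 L"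
      using B_integral[OF g L hh] by simp
  qed
  also have "\<dots> = B g h L" by (rule D_counit_left) (auto intro!: lins g h)
  finally show ?thesis by (simp add: g_def[abs_def])
qed

text \<open>Apply the counit to S(a_1) a_2 = e(a) 1. The result is used to get S(L) L = L from e(L)
  = 1.\<close>

lemma e_s [simp]:
  assumes [simp]: "a \<in> carrier A" shows "e (s a) = e a"
proof -
  have "e (s a) = D (\<lambda>x y. e y \<otimes>\<^bsub>K\<^esub> e (s x)) a"
    by (rule D_counit_right[symmetric]) (auto intro!: lins)
  also have "\<dots> = D (\<lambda>x y. e (s x \<bullet> y)) a" by (rule D_cong) (simp add: m_comm)
  also have "\<dots> = e a \<otimes>\<^bsub>K\<^esub> e u" by (rule D_antipode_left) (auto intro!: lins)
  finally show ?thesis by simp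
qed

text \<open>\<open>D_mult_integral\<close> for the form e(x) \<phi>(y): on one side the counit turns
  h L_1 into e(h) e(L_1), on the other it removes L'_1, so that S(L') h' remains.\<close>

lemma B_antipode_integral:
  assumes \<phi>: "linear_map K A k \<phi>" and L: "integral L" and h: "h \<in> carrier A"
  shows "B (\<lambda>x y. \<phi> (s x \<bullet> y)) h L = e h \<otimes>\<^bsub>K\<^esub> \<phi> (s L)"
proof -
  note \<phi>' = linear_map_comp[OF _ \<phi>]
  have \<phi>c [simp]: "\<phi> x \<in> carrier K" if "x \<in> carrier A" for x
    using linear_map_closed[OF \<phi> that] by simp
  have LA [simp]: "L \<in> carrier A" using L by (simp add: integral_def)
  have f: "bilinear_map K A A k (\<lambda>x y. e x \<otimes>\<^bsub>K\<^esub> \<phi> y)" by (intro lins \<phi>) auto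
  have "B (\<lambda>x y. \<phi> (s x \<bullet> y)) h L = B (\<lambda>x y. D (\<lambda>x1 x2. e x1 \<otimes>\<^bsub>K\<^esub> \<phi> (s x2 \<bullet> y)) x) h L"
    by (intro B_cong D_counit_left[symmetric, of "\<lambda>x. \<phi> (s x \<bullet> _)"] \<phi>' lins)
  also have "\<dots> = D (\<lambda>x y. e (h \<bullet> x) \<otimes>\<^bsub>K\<^esub> \<phi> (s y)) L"
    by (rule D_mult_integral[OF f L h, symmetric])
  also have "\<dots> = D (\<lambda>x y. e h \<otimes>\<^bsub>K\<^esub> (e x \<otimes>\<^bsub>K\<^esub> \<phi> (s y))) L"
    by (rule D_cong) (use h in \<open>simp add: m_assoc\<close>)
  also have "\<dots> = e h \<otimes>\<^bsub>K\<^esub> D (\<lambda>x y. e x \<otimes>\<^bsub>K\<^esub> \<phi> (s y)) L"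
    by (rule D_scale) (use h in \<open>auto intro!: lins \<phi>'\<close>)
  also have "D (\<lambda>x y. e x \<otimes>\<^bsub>K\<^esub> \<phi> (s y)) L = \<phi> (s L)"
    by (rule D_counit_left) (auto intro!: \<phi>' lins)
  finally show ?thesis .
qed

section \<open>Slices of tensors and the subspace H (x) Int\<close>

lemma lin_smult_vector:
  assumes d: "linear_map K X k d" and y: "y \<in> carrier A"
  shows "linear_map K X A (\<lambda>x. d x \<odot>\<^bsub>A\<^esub> y)"
proof -
  interpret A: vectorspace K A by (rule vs_A)
  show ?thesis
    using linear_mapD[OF d] vs_A y by (intro linear_mapI) (auto simp: A.smult_l_distr A.smult_assoc1)
qed

text \<open>The slice map d (x) id from H (x) H to H. Slices along coordinate functionals recover a
  tensor and detect whether its second leg is an integral.\<close>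

definition contract where
  "contract d = tensor_lift K A A (Fob F HH) ten A (\<lambda>x y. d x \<odot>\<^bsub>A\<^esub> y)"

lemma contract_bilinear:
  assumes d: "linear_map K A k d" shows "bilinear_map K A A A (\<lambda>x y. d x \<odot>\<^bsub>A\<^esub> y)"
proof (rule bilinear_mapI)
  show "linear_map K A A (\<lambda>y. d x \<odot>\<^bsub>A\<^esub> y)" if "x \<in> carrier A" for x
    using linear_map_pointwise_smult[OF lin_A, of "d x"] linear_map_closed[OF d that] by simp
qed (rule lin_smult_vector[OF d])

lemma contract_linear:
  "linear_map K A k d \<Longrightarrow> linear_map K (Fob F HH) A (contract d)"
  unfolding contract_def
  by (rule tensor_lift_linear[OF Fob_TOb[OF H_Ob H_Ob] vs_A contract_bilinear])

lemma contract_ten: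
  "linear_map K A k d \<Longrightarrow> x \<in> carrier A \<Longrightarrow> y \<in> carrier A \<Longrightarrow> contract d (ten x y) = d x \<odot>\<^bsub>A\<^esub> y"
  unfolding contract_def
  by (rule tensor_lift_pure[OF Fob_TOb[OF H_Ob H_Ob] vs_A contract_bilinear])

lemma form_contract:
  assumes d: "linear_map K A k d" and \<phi>: "linear_map K A k \<phi>" and t: "t \<in> carrier (Fob F HH)"
  shows "\<phi> (contract d t) = lift H H (\<lambda>x y. d x \<otimes>\<^bsub>K\<^esub> \<phi> y) t"
proof -
  have "lift H H (\<lambda>x y. \<phi> (d x \<odot>\<^bsub>A\<^esub> y)) t = \<phi> (contract d t)"
    unfolding contract_def
    by (rule tensor_lift_linear_comp[OF Fob_TOb[OF H_Ob H_Ob] contract_bilinear[OF d] \<phi> t])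
  moreover have "lift H H (\<lambda>x y. \<phi> (d x \<odot>\<^bsub>A\<^esub> y)) = lift H H (\<lambda>x y. d x \<otimes>\<^bsub>K\<^esub> \<phi> y)"
    using linear_map_closed[OF d] linear_map_smult[OF \<phi>] by (intro tensor_lift_cong) simp
  ultimately show ?thesis by simp
qed

lemma basis_exists:
  obtains Bs d where "finite Bs" "Bs \<subseteq> carrier A" "\<forall>b\<in>Bs. linear_map K A k (d b)"
    "\<forall>x\<in>carrier A. finsum A (\<lambda>b. d b x \<odot>\<^bsub>A\<^esub> b) Bs = x"
  using dual_basis_exists[OF vs_A fin_dim] by blast

text \<open>On a pure tensor the scalars \<open>d b x\<close> can be moved from the right leg to the
  left one, where they reassemble \<open>x\<close>.\<close>

lemma tensor_eq_finsum_contract: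
  assumes Bs: "finite Bs" "Bs \<subseteq> carrier A" and d: "\<forall>b\<in>Bs. linear_map K A k (d b)"
    and sum: "\<forall>x\<in>carrier A. finsum A (\<lambda>b. d b x \<odot>\<^bsub>A\<^esub> b) Bs = x"
    and t: "t \<in> carrier (Fob F HH)"
  shows "finsum (Fob F HH) (\<lambda>b. ten b (contract (d b) t)) Bs = t"
proof (rule ten_ext[OF H_Ob H_Ob _ _ _ t])
  note [simp] = H_Ob HH_Ob
  have vT: "vectorspace K (Fob F HH)" by (rule Fob_space) simp
  interpret T: vectorspace K "Fob F HH" by (rule vT)
  show "linear_map K (Fob F HH) (Fob F HH) (\<lambda>t. finsum (Fob F HH) (\<lambda>b. ten b (contract (d b) t)) Bs)"
    by (intro linear_map_pointwise_finsum[OF vT vT Bs(1)] lin_ten_right contract_linear) (use Bs d in auto)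
  show "linear_map K (Fob F HH) (Fob F HH) (\<lambda>t. t)" by (rule linear_map_id[OF vT])
  fix x y assume x: "x \<in> carrier A" and y: "y \<in> carrier A"
  have dx: "d b x \<in> carrier K" if "b \<in> Bs" for b
    using linear_map_closed[of K A k "d b" x] d that x by auto
  have "finsum (Fob F HH) (\<lambda>b. ten b (contract (d b) (ten x y))) Bs
    = finsum (Fob F HH) (\<lambda>b. ten (d b x \<odot>\<^bsub>A\<^esub> b) y) Bs"
  proof (rule T.M.finsum_cong')
    show "(\<lambda>b. ten (d b x \<odot>\<^bsub>A\<^esub> b) y) \<in> Bs \<rightarrow> carrier (Fob F HH)" using Bs dx y by auto
    fix b assume b: "b \<in> Bs"
    have "ten b (d b x \<odot>\<^bsub>A\<^esub> y) = d b x \<odot>\<^bsub>Fob F HH\<^esub> ten b y"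
      using linear_map_smult[OF bilinear_map_right[OF Ften_bilinear[OF H_Ob H_Ob]]] b Bs dx y by blast
    also have "\<dots> = ten (d b x \<odot>\<^bsub>A\<^esub> b) y"
      using linear_map_smult[OF bilinear_map_left[OF Ften_bilinear[OF H_Ob H_Ob]]] b Bs dx y by fastforce
    finally show "ten b (contract (d b) (ten x y)) = ten (d b x \<odot>\<^bsub>A\<^esub> b) y"
      using d b x y by (simp add: contract_ten)
  qed simp
  also have "\<dots> = ten (finsum A (\<lambda>b. d b x \<odot>\<^bsub>A\<^esub> b) Bs) y"
    by (rule linear_map_finsum[OF lin_ten_left[OF H_Ob H_Ob y lin_A] Bs(1), symmetric]) (use Bs dx in auto)
  finally show "finsum (Fob F HH) (\<lambda>b. ten b (contract (d b) (ten x y))) Bs = ten x y"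
    using sum x by simp
qed

text \<open>The tensors of two basis vectors span: slicing expands the first leg, the coordinate
  functionals the second.\<close>

lemma fin_dim_HH: "vectorspace.fin_dim K (Fob F HH)"
proof -
  note [simp] = H_Ob HH_Ob
  interpret T: vectorspace K "Fob F HH" by (rule Fob_space) simp
  obtain Bs d where Bs: "finite Bs" "Bs \<subseteq> carrier A" and d: "\<forall>b\<in>Bs. linear_map K A k (d b)"
    and sum: "\<forall>x\<in>carrier A. finsum A (\<lambda>b. d b x \<odot>\<^bsub>A\<^esub> b) Bs = x"
    by (rule basis_exists)
  let ?X = "(\<lambda>(b, b'). ten b b') ` (Bs \<times> Bs)"
  have X: "?X \<subseteq> carrier (Fob F HH)" using Bs by (auto intro!: Ften_closed)
  have sp: "LinearCombinations.submodule K (T.span ?X) (Fob F HH)" by (rule T.span_is_submodule[OF X])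
  have "ten b y \<in> T.span ?X" if b: "b \<in> Bs" and y: "y \<in> carrier A" for b y
  proof -
    have dy: "d b' y \<in> carrier K" if "b' \<in> Bs" for b'
      using linear_map_closed[of K A k "d b'" y] d that y by auto
    have bA: "b \<in> carrier A" using b Bs by auto
    note l = lin_ten_right[OF H_Ob H_Ob bA lin_A]
    have "ten b y = ten b (finsum A (\<lambda>b'. d b' y \<odot>\<^bsub>A\<^esub> b') Bs)" using sum y by simp
    also have "\<dots> = finsum (Fob F HH) (\<lambda>b'. ten b (d b' y \<odot>\<^bsub>A\<^esub> b')) Bs"
      by (rule linear_map_finsum[OF l Bs(1)]) (use Bs dy in auto)
    also have "\<dots> \<in> T.span ?X"
    proof (rule submodule_finsum_closed[OF sp Bs(1)])
      fix b' assume b': "b' \<in> Bs"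
      have "ten b b' \<in> T.span ?X" using T.in_own_span[OF X] b b' by auto
      moreover have "ten b (d b' y \<odot>\<^bsub>A\<^esub> b') = d b' y \<odot>\<^bsub>Fob F HH\<^esub> ten b b'"
        using linear_map_smult[OF l dy[OF b']] b' Bs by auto
      ultimately show "ten b (d b' y \<odot>\<^bsub>A\<^esub> b') \<in> T.span ?X"
        using submodule.smult_closed[OF sp dy[OF b']] by simp
    qed
    finally show ?thesis .
  qed
  then have "t \<in> T.span ?X" if t: "t \<in> carrier (Fob F HH)" for t
    using submodule_finsum_closed[OF sp Bs(1), of "\<lambda>b. ten b (contract (d b) t)"]
      tensor_eq_finsum_contract[OF Bs d sum t] d t linear_map_closed[OF contract_linear]
    by auto
  then have "T.gen_set ?X" using T.span_is_subset2[OF X] by auto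
  then show ?thesis unfolding T.fin_dim_def using Bs(1) X by (intro exI[of _ ?X] conjI) auto
qed

text \<open>The subspace \<open>H \<otimes> \<integral>\<close> of \<open>H \<otimes> H\<close>.\<close>

definition W where
  "W = {t \<in> carrier (Fob F HH). \<forall>g \<in> carrier A. \<forall>f. bilinear_map K A A k f \<longrightarrow>
    lift H H (\<lambda>x y. f x (g \<bullet> y)) t = e g \<otimes>\<^bsub>K\<^esub> lift H H f t}"

lemma lift_linear: "bilinear_map K A A k f \<Longrightarrow> linear_map K (Fob F HH) k (lift H H f)"
  by (rule tensor_lift_linear[OF Fob_TOb[OF H_Ob H_Ob] vs_k])

lemma bilinear_mul_right:
  assumes f: "bilinear_map K A A k f" and g: "g \<in> carrier A"
  shows "bilinear_map K A A k (\<lambda>x y. f x (g \<bullet> y))"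
  by (intro lins bilinear_left_comp[OF f] bilinear_right_comp[OF f]) (use g in auto)

lemma W_subspace: "VectorSpace.subspace K W (Fob F HH)"
proof -
  note [simp] = H_Ob HH_Ob
  have vT: "vectorspace K (Fob F HH)" by (rule Fob_space) simp
  interpret T: vectorspace K "Fob F HH" by (rule vT)
  have "LinearCombinations.submodule K W (Fob F HH)"
  proof (rule submodule.intro)
    show "module K (Fob F HH)" by unfold_locales
    show "W \<subseteq> carrier (Fob F HH)" by (auto simp: W_def)
    show "\<zero>\<^bsub>Fob F HH\<^esub> \<in> W"
      using linear_map_zero[OF lift_linear] linear_map_zero[OF lift_linear[OF bilinear_mul_right]]
      by (auto simp: W_def)
    show "v \<oplus>\<^bsub>Fob F HH\<^esub> w \<in> W" if "v \<in> W" "w \<in> W" for v w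
      using that linear_map_add[OF lift_linear] linear_map_add[OF lift_linear[OF bilinear_mul_right]]
        linear_map_closed[OF lift_linear]
      by (auto simp: W_def r_distr)
    show "c \<odot>\<^bsub>Fob F HH\<^esub> v \<in> W" if "c \<in> carrier K" "v \<in> W" for c v
      using that linear_map_smult[OF lift_linear] linear_map_smult[OF lift_linear[OF bilinear_mul_right]]
        linear_map_closed[OF lift_linear]
      by (auto simp: W_def m_lcomm)
  qed
  then show ?thesis using vT by (simp add: VectorSpace.subspace_def)
qed

lemma ten_integral_in_W:
  assumes x: "x \<in> carrier A" and L: "integral L"
  shows "ten x L \<in> W"
proof -
  have LA [simp]: "L \<in> carrier A" and Li: "\<And>x. x \<in> carrier A \<Longrightarrow> x \<bullet> L = e x \<odot>\<^bsub>A\<^esub> L"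
    using L by (auto simp: integral_def)
  show ?thesis
    using x lift_pure[OF H_Ob H_Ob] bilinear_mul_right linear_map_smult[OF bilinear_map_right[of K A A k]]
    by (auto simp: W_def H_Ob Li)
qed

text \<open>\<open>W\<close> is cut out by equations, which makes membership easy to verify; here it
  is shown to be spanned by the tensors x (x) L. The defining equation for the forms d_b (x) \<phi>
  says that every slice of \<open>t\<close> is an integral, and \<open>t\<close> is the sum of the
  basis vectors tensored with its slices.\<close>

lemma W_ext:
  assumes t: "t \<in> W" and p: "linear_map K (Fob F HH) k p" and q: "linear_map K (Fob F HH) k q"
    and eq: "\<And>x L. x \<in> carrier A \<Longrightarrow> integral L \<Longrightarrow> p (ten x L) = q (ten x L)"
  shows "p t = q t"
proof -
  note [simp] = H_Ob HH_Ob
  obtain Bs d where Bs: "finite Bs" "Bs \<subseteq> carrier A" and d: "\<forall>b\<in>Bs. linear_map K A k (d b)"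
    and sum: "\<forall>x\<in>carrier A. finsum A (\<lambda>b. d b x \<odot>\<^bsub>A\<^esub> b) Bs = x"
    by (rule basis_exists)
  have tT: "t \<in> carrier (Fob F HH)" using t by (simp add: W_def)
  interpret k: vectorspace K k by (rule vs_k)
  have int: "integral (contract (d b) t)" if b: "b \<in> Bs" for b
    unfolding integral_def
  proof (intro conjI ballI)
    have db: "linear_map K A k (d b)" using d b by simp
    show c: "contract (d b) t \<in> carrier A" by (rule linear_map_closed[OF contract_linear[OF db] tT])
    fix h assume h: "h \<in> carrier A"
    show "h \<bullet> contract (d b) t = e h \<odot>\<^bsub>A\<^esub> contract (d b) t"
    proof (rule eq_if_linear_forms_eq[OF vs_A fin_dim])
      show "h \<bullet> contract (d b) t \<in> carrier A" "e h \<odot>\<^bsub>A\<^esub> contract (d b) t \<in> carrier A" using h c by auto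
      fix \<phi> assume \<phi>: "linear_map K A k \<phi>"
      have f: "bilinear_map K A A k (\<lambda>x y. d b x \<otimes>\<^bsub>K\<^esub> \<phi> y)"
        using linear_map_closed[OF \<phi>] linear_map_closed[OF db] by (intro lins \<phi> db) auto
      have "\<phi> (h \<bullet> contract (d b) t) = lift H H (\<lambda>x y. d b x \<otimes>\<^bsub>K\<^esub> \<phi> (h \<bullet> y)) t"
        by (rule form_contract[OF db _ tT]) (intro linear_map_comp[OF _ \<phi>] lins h)
      also have "\<dots> = e h \<otimes>\<^bsub>K\<^esub> lift H H (\<lambda>x y. d b x \<otimes>\<^bsub>K\<^esub> \<phi> y) t"
        using t h f by (auto simp: W_def)
      also have "\<dots> = \<phi> (e h \<odot>\<^bsub>A\<^esub> contract (d b) t)"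
        using form_contract[OF db \<phi> tT] linear_map_smult[OF \<phi> e_closed[OF h] c] by simp
      finally show "\<phi> (h \<bullet> contract (d b) t) = \<phi> (e h \<odot>\<^bsub>A\<^esub> contract (d b) t)" .
    qed
  qed
  then have cA: "contract (d b) t \<in> carrier A" if "b \<in> Bs" for b using that by (simp add: integral_def)
  have mem: "ten b (contract (d b) t) \<in> carrier (Fob F HH)" if "b \<in> Bs" for b
    using that cA Bs(2) by (intro Ften_closed) auto
  have "p t = finsum k (\<lambda>b. p (ten b (contract (d b) t))) Bs"
    using linear_map_finsum[OF p Bs(1), of "\<lambda>b. ten b (contract (d b) t)", OF mem]
    by (simp add: tensor_eq_finsum_contract[OF Bs d sum tT])
  also have "\<dots> = finsum k (\<lambda>b. q (ten b (contract (d b) t))) Bs"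
    using linear_map_closed[OF q mem] Bs(2) eq int by (intro k.M.finsum_cong') auto
  also have "\<dots> = q t"
    using linear_map_finsum[OF q Bs(1), of "\<lambda>b. ten b (contract (d b) t)", OF mem]
    by (simp add: tensor_eq_finsum_contract[OF Bs d sum tT])
  finally show ?thesis .
qed

text \<open>The flip of vector spaces, a linear map that is not assumed to come from an arrow.
  Composed with the braiding it brings Int (x) H back to H (x) Int and so produces an endomorphism
  of \<open>W\<close>, for which injective implies surjective.\<close>

definition flip where
  "flip = tensor_lift K A A (Fob F HH) ten (Fob F HH) (\<lambda>x y. ten y x)"

lemma flip_linear: "linear_map K (Fob F HH) (Fob F HH) flip"
  and flip_ten: "x \<in> carrier A \<Longrightarrow> y \<in> carrier A \<Longrightarrow> flip (ten x y) = ten y x"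
proof -
  have "bilinear_map K A A (Fob F HH) (\<lambda>x y. ten y x)"
    by (intro bilinear_mapI lin_ten_left lin_ten_right lin_A) (auto simp: H_Ob)
  note s = tensor_lift_spec[OF Fob_TOb[OF H_Ob H_Ob] Fob_space[OF HH_Ob] this]
  show "linear_map K (Fob F HH) (Fob F HH) flip" unfolding flip_def by (rule s)
  show "x \<in> carrier A \<Longrightarrow> y \<in> carrier A \<Longrightarrow> flip (ten x y) = ten y x" unfolding flip_def by (rule s)
qed

lemma flip_flip:
  assumes "t \<in> carrier (Fob F HH)" shows "flip (flip t) = t"
  by (rule ten_ext[OF H_Ob H_Ob linear_map_comp[OF flip_linear flip_linear]
        linear_map_id[OF Fob_space[OF HH_Ob]] _ assms]) (simp add: flip_ten)

lemma lift_flip: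
  assumes f: "bilinear_map K A A k f" and t: "t \<in> carrier (Fob F HH)"
  shows "lift H H f (flip t) = lift H H (\<lambda>x y. f y x) t"
proof (rule ten_ext[OF H_Ob H_Ob _ _ _ t])
  have f': "bilinear_map K A A k (\<lambda>x y. f y x)"
    using f by (simp add: bilinear_map_def)
  show "linear_map K (Fob F HH) k (\<lambda>t. lift H H f (flip t))"
    by (rule linear_map_comp[OF flip_linear lift_linear[OF f]])
  show "linear_map K (Fob F HH) k (lift H H (\<lambda>x y. f y x))" by (rule lift_linear[OF f'])
  show "lift H H f (flip (ten x y)) = lift H H (\<lambda>x y. f y x) (ten x y)"
    if "x \<in> carrier A" "y \<in> carrier A" for x y
    using that by (simp add: H_Ob flip_ten lift_pure[OF _ _ f] lift_pure[OF _ _ f'])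
qed

text \<open>\<open>\<beta>\<close> maps \<open>H \<otimes> \<integral>\<close> into \<open>\<integral> \<otimes> H\<close>; both have the same finite dimension, hence this is onto.\<close>

lemma braid_onto_integral:
  assumes L: "integral L" and h: "h \<in> carrier A"
  shows "\<exists>t\<in>W. Far F (\<beta> H H) t = ten L h"
proof -
  note [simp] = H_Ob HH_Ob
  let ?T = "Fob F HH" and ?\<beta> = "Far F (\<beta> H H)"
  let ?V = "?T\<lparr>carrier := W\<rparr>"
  have WT: "W \<subseteq> carrier ?T" by (auto simp: W_def)
  have \<beta>l: "linear_map K ?T ?T ?\<beta>" by (rule Far_linear[OF Braid_Hom]) auto
  \<comment> \<open>By \<open>W_ext\<close> only tensors x (x) L matter, and
    \<open>B_integral\<close> says that the first leg of their braiding is an integral; the flip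
    moves it to the second leg.\<close>
  have into: "flip (?\<beta> t) \<in> W" if t: "t \<in> W" for t
  proof -
    have tT: "t \<in> carrier ?T" using t WT by auto
    have "lift H H (\<lambda>x y. f x (g \<bullet> y)) (flip (?\<beta> t)) = e g \<otimes>\<^bsub>K\<^esub> lift H H f (flip (?\<beta> t))"
      if g: "g \<in> carrier A" and f: "bilinear_map K A A k f" for g f
    proof -
      have f': "bilinear_map K A A k (\<lambda>x y. f y x)" using f by (simp add: bilinear_map_def)
      have fg: "bilinear_map K A A k (\<lambda>y x. f x (g \<bullet> y))"
        using bilinear_mul_right[OF f g] by (simp add: bilinear_map_def)
      have "lift H H (\<lambda>y x. f x (g \<bullet> y)) (?\<beta> t) = e g \<otimes>\<^bsub>K\<^esub> lift H H (\<lambda>x y. f y x) (?\<beta> t)"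
      proof (rule W_ext[OF t])
        show "linear_map K ?T k (\<lambda>t. lift H H (\<lambda>y x. f x (g \<bullet> y)) (?\<beta> t))"
          by (rule linear_map_comp[OF \<beta>l lift_linear[OF fg]])
        show "linear_map K ?T k (\<lambda>t. e g \<otimes>\<^bsub>K\<^esub> lift H H (\<lambda>x y. f y x) (?\<beta> t))"
          by (rule lin_scalar_right[OF e_closed[OF g] linear_map_comp[OF \<beta>l lift_linear[OF f']]])
        show "lift H H (\<lambda>y x. f x (g \<bullet> y)) (?\<beta> (ten x L)) = e g \<otimes>\<^bsub>K\<^esub> lift H H (\<lambda>x y. f y x) (?\<beta> (ten x L))"
          if "x \<in> carrier A" "integral L" for x L
          using B_integral[OF f' that(2) g that(1)] by (simp add: B_def)
      qed
      then show ?thesis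
        using tT by (simp add: lift_flip[OF f] lift_flip[OF bilinear_mul_right[OF f g]])
    qed
    then show ?thesis
      using linear_map_closed[OF flip_linear \<beta>_closed[OF tT]] by (simp add: W_def)
  qed
  have vW: "vectorspace K ?V"
    by (rule vectorspace.subspace_is_vs[OF Fob_space[OF HH_Ob] W_subspace])
  have "linear_map K ?V ?V (\<lambda>t. flip (?\<beta> t))"
    by (rule linear_mapI[OF vW vW])
      (use into linear_mapD[OF linear_map_comp[OF \<beta>l flip_linear]] WT in \<open>auto simp: subset_eq\<close>)
  moreover have "inj_on (\<lambda>t. flip (?\<beta> t)) (carrier ?V)"
  proof (rule inj_onI)
    fix x y assume xy: "x \<in> carrier ?V" "y \<in> carrier ?V" "flip (?\<beta> x) = flip (?\<beta> y)"
    then have x: "x \<in> carrier ?T" and y: "y \<in> carrier ?T" using WT by auto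
    have "?\<beta> x = ?\<beta> y"
      using arg_cong[OF xy(3), of flip] flip_flip[OF \<beta>_closed[OF x]] flip_flip[OF \<beta>_closed[OF y]] by simp
    then show "x = y" by (rule Far_iso_inj[OF Braid_iso[OF H_Ob H_Ob] x y])
  qed
  moreover have "vectorspace.fin_dim K ?V"
    by (rule fin_dim_subspace[OF Fob_space[OF HH_Ob] fin_dim_HH W_subspace])
  ultimately have "(\<lambda>t. flip (?\<beta> t)) ` carrier ?V = carrier ?V"
    by (intro injective_endomorphism_surj)
  \<comment> \<open>Surjectivity is used at h (x) L: if flip(beta t) = h (x) L, then undoing the
    flip gives beta t = L (x) h.\<close>
  moreover have "ten h L \<in> carrier ?V" using ten_integral_in_W[OF h L] by simp
  ultimately have "ten h L \<in> (\<lambda>t. flip (?\<beta> t)) ` W" by simp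
  then obtain t where t: "ten h L = flip (?\<beta> t)" "t \<in> W" by (rule imageE)
  have "?\<beta> t = flip (ten h L)" using flip_flip[of "?\<beta> t"] t WT by auto
  also have "\<dots> = ten L h" using flip_ten h L by (simp add: integral_def)
  finally show ?thesis using t(2) by blast
qed

text \<open>The maps x (x) y |-> S(x) y and x (x) y |-> e(y) S(x) agree on beta(x (x) L') for every
  integral L', by \<open>B_antipode_integral\<close> and \<open>B_counit_right\<close>. By linearity
  they agree on the image of \<open>W\<close>, which contains L (x) h.\<close>

lemma antipode_integral_right:
  assumes L: "integral L" and h: "h \<in> carrier A"
  shows "s L \<bullet> h = e h \<odot>\<^bsub>A\<^esub> s L"
proof (rule eq_if_linear_forms_eq[OF vs_A fin_dim])
  have LA [simp]: "L \<in> carrier A" using L by (simp add: integral_def)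
  show "s L \<bullet> h \<in> carrier A" "e h \<odot>\<^bsub>A\<^esub> s L \<in> carrier A" using h by auto
  fix \<phi> assume \<phi>: "linear_map K A k \<phi>"
  note [simp] = H_Ob HH_Ob
  have \<phi>c [simp]: "\<phi> x \<in> carrier K" if "x \<in> carrier A" for x
    using linear_map_closed[OF \<phi> that] by simp
  have \<beta>l: "linear_map K (Fob F HH) (Fob F HH) (Far F (\<beta> H H))" by (rule Far_linear[OF Braid_Hom]) auto
  obtain t where t: "t \<in> W" "Far F (\<beta> H H) t = ten L h" using braid_onto_integral[OF L h] by blast
  have \<phi>s: "linear_map K A k (\<lambda>x. \<phi> (s x))" by (intro linear_map_comp[OF _ \<phi>] lins)
  have b1: "bilinear_map K A A k (\<lambda>x y. \<phi> (s x \<bullet> y))"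
    by (intro bilinear_mapI linear_map_comp[OF _ \<phi>] lins) auto
  have b2: "bilinear_map K A A k (\<lambda>x y. e y \<otimes>\<^bsub>K\<^esub> \<phi> (s x))"
    by (intro lins \<phi>s) auto
  have "lift H H (\<lambda>x y. \<phi> (s x \<bullet> y)) (Far F (\<beta> H H) t) = lift H H (\<lambda>x y. e y \<otimes>\<^bsub>K\<^esub> \<phi> (s x)) (Far F (\<beta> H H) t)"
  proof (rule W_ext[OF t(1) linear_map_comp[OF \<beta>l lift_linear[OF b1]] linear_map_comp[OF \<beta>l lift_linear[OF b2]]])
    fix x L assume x: "x \<in> carrier A" and L: "integral L"
    then have "L \<in> carrier A" by (simp add: integral_def)
    from B_antipode_integral[OF \<phi> L x] B_counit_right[OF \<phi>s x this]
    show "lift H H (\<lambda>x y. \<phi> (s x \<bullet> y)) (Far F (\<beta> H H) (ten x L))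
      = lift H H (\<lambda>x y. e y \<otimes>\<^bsub>K\<^esub> \<phi> (s x)) (Far F (\<beta> H H) (ten x L))"
      by (simp add: B_def)
  qed
  then show "\<phi> (s L \<bullet> h) = \<phi> (e h \<odot>\<^bsub>A\<^esub> s L)"
    using h by (simp add: t(2) lift_pure[OF _ _ b1] lift_pure[OF _ _ b2] linear_map_smult[OF \<phi>])
qed

section \<open>Normalised integrals and the separability idempotent\<close>

context
  fixes L assumes L: "integral L" and eL: "e L = \<one>\<^bsub>K\<^esub>"
begin

lemma L_closed [simp]: "L \<in> carrier A"
  using L by (simp add: integral_def)

lemma one_smult_A [simp]: "x \<in> carrier A \<Longrightarrow> \<one>\<^bsub>K\<^esub> \<odot>\<^bsub>A\<^esub> x = x"
  by (rule smult_one_Fob[OF H_Ob])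

lemma integral_two_sided: "h \<in> carrier A \<Longrightarrow> L \<bullet> h = e h \<odot>\<^bsub>A\<^esub> L"
proof -
  have "s L \<bullet> L = s L" using antipode_integral_right[OF L L_closed] eL by simp
  moreover have "s L \<bullet> L = L" using L eL by (simp add: integral_def)
  ultimately have "s L = L" by simp
  then show "h \<in> carrier A \<Longrightarrow> L \<bullet> h = e h \<odot>\<^bsub>A\<^esub> L" using antipode_integral_right[OF L] by simp
qed

text \<open>Multiply the first leg of beta(h (x) L) by L from the left. That leg is an integral and
  e(L) = 1, so nothing changes; but L is two-sided, so a leg x becomes e(x) L. The counit then
  slides through the braiding onto L and leaves L (x) h.\<close>

lemma B_normalized_integral:
  assumes f: "bilinear_map K A A k f" and h: "h \<in> carrier A"
  shows "B f h L = f L h"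
proof -
  have fL: "linear_map K A k (f L)" by (rule bilinear_map_right[OF f L_closed])
  have "B f h L = B (\<lambda>x y. f (L \<bullet> x) y) h L"
    using B_integral[OF f L L_closed h] eL B_closed[OF f h L_closed] by simp
  also have "\<dots> = B (\<lambda>x y. e x \<otimes>\<^bsub>K\<^esub> f L y) h L"
    by (rule B_cong) (use linear_map_smult[OF bilinear_map_left[OF f]] in \<open>simp add: integral_two_sided\<close>)
  also have "\<dots> = f L h"
    using B_counit_left[OF fL h L_closed] linear_map_closed[OF fL h] eL by simp
  finally show ?thesis .
qed

text \<open>With the braiding gone from \<open>D_mult_integral\<close>, the identity concerns
  ordinary tensors and can act on modules that carry no braiding.\<close>

lemma D_integral_balanced:
  assumes f: "bilinear_map K A A k f" and h: "h \<in> carrier A"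
  shows "D (\<lambda>x y. f (h \<bullet> x) (s y)) L = D (\<lambda>x y. f x (s y \<bullet> h)) L"
proof -
  note fl = bilinear_left_comp[OF f] and fr = bilinear_right_comp[OF f]
  have "bilinear_map K A A k (\<lambda>x y. D (\<lambda>x1 x2. f x1 (s x2 \<bullet> y)) x)"
    by (intro lins fl fr) auto
  from B_normalized_integral[OF this h] D_mult_integral[OF f L h] show ?thesis by simp
qed

text \<open>The sum of v_b (x) b is L_1 (x) S(L_2), expanded in its second leg. Coordinates are used
  because \<open>tensor_lift\<close> reaches only spaces on the type \<open>'v\<close>, whereas a
  finite family of elements of H can act on a module of any type.\<close>

lemma separability_elements:
  assumes Bs: "finite Bs" "Bs \<subseteq> carrier A" and d: "\<forall>b\<in>Bs. linear_map K A k (d b)"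
    and sum: "\<forall>x\<in>carrier A. finsum A (\<lambda>b. d b x \<odot>\<^bsub>A\<^esub> b) Bs = x"
  shows "\<exists>v. (\<forall>b\<in>Bs. v b \<in> carrier A) \<and>
    (\<forall>h\<in>carrier A. \<forall>c\<in>Bs. h \<bullet> v c = finsum A (\<lambda>b. d c (b \<bullet> h) \<odot>\<^bsub>A\<^esub> v b) Bs) \<and>
    finsum A (\<lambda>b. v b \<bullet> b) Bs = u"
proof -
  note [simp] = H_Ob HH_Ob
  interpret A: vectorspace K A by (rule vs_A)
  interpret k: vectorspace K k by (rule vs_k)
  have db [simp]: "d b x \<in> carrier K" if "b \<in> Bs" "x \<in> carrier A" for b x
    using linear_map_closed[of K A k "d b" x] d that by auto
  have BsA [simp]: "b \<in> carrier A" if "b \<in> Bs" for b using Bs that by auto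
  \<comment> \<open>The coefficient of the basis vector \<open>c\<close>: slice L_1 (x) S(L_2) by
    \<open>d c\<close> in the second leg.\<close>
  define v where "v c = tensor_lift K A A (Fob F HH) ten A (\<lambda>x y. d c (s y) \<odot>\<^bsub>A\<^esub> x) (Far F \<Delta> L)" for c
  have bl: "bilinear_map K A A A (\<lambda>x y. d c (s y) \<odot>\<^bsub>A\<^esub> x)" if c: "c \<in> Bs" for c
  proof (rule bilinear_mapI)
    show "linear_map K A A (\<lambda>y. d c (s y) \<odot>\<^bsub>A\<^esub> x)" if "x \<in> carrier A" for x
      using d c by (intro lin_smult_vector[OF _ that] linear_map_comp[OF _ bspec[OF d c]] lins)
    show "linear_map K A A (\<lambda>x. d c (s y) \<odot>\<^bsub>A\<^esub> x)" if "y \<in> carrier A" for y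
      using linear_map_pointwise_smult[OF lin_A, of "d c (s y)"] c that by simp
  qed
  have v [simp]: "v c \<in> carrier A" if "c \<in> Bs" for c
    unfolding v_def
    by (rule linear_map_closed[OF tensor_lift_linear[OF Fob_TOb[OF H_Ob H_Ob] vs_A bl[OF that]]]) simp
  have \<phi>v: "\<phi> (v c) = D (\<lambda>x y. d c (s y) \<otimes>\<^bsub>K\<^esub> \<phi> x) L" if c: "c \<in> Bs" and \<phi>: "linear_map K A k \<phi>" for c \<phi>
  proof -
    have "\<phi> (v c) = lift H H (\<lambda>x y. \<phi> (d c (s y) \<odot>\<^bsub>A\<^esub> x)) (Far F \<Delta> L)"
      unfolding v_def
      by (rule tensor_lift_linear_comp[OF Fob_TOb[OF H_Ob H_Ob] bl[OF c] \<phi>, symmetric]) simp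
    also have "\<dots> = D (\<lambda>x y. \<phi> (d c (s y) \<odot>\<^bsub>A\<^esub> x)) L" by (simp add: D_def)
    also have "\<dots> = D (\<lambda>x y. d c (s y) \<otimes>\<^bsub>K\<^esub> \<phi> x) L"
      by (rule D_cong) (use c linear_map_smult[OF \<phi>] in simp)
    finally show ?thesis .
  qed
  have D_sum: "finsum k (\<lambda>b. D (f b) L) Bs = D (\<lambda>x y. finsum k (\<lambda>b. f b x y) Bs) L"
    if f: "\<And>b. b \<in> Bs \<Longrightarrow> bilinear_map K A A k (f b)" for f
  proof -
    have b: "bilinear_map K A A k (\<lambda>x y. finsum k (\<lambda>b. f b x y) Bs)"
      by (intro bilinear_mapI linear_map_pointwise_finsum vs_A vs_k Bs bilinear_mapD[OF f])
    have "finsum k (\<lambda>b. lift H H (f b) t) Bs = lift H H (\<lambda>x y. finsum k (\<lambda>b. f b x y) Bs) t"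
      if t: "t \<in> carrier (Fob F HH)" for t
    proof (rule ten_ext[OF H_Ob H_Ob _ _ _ t])
      show "linear_map K (Fob F HH) k (\<lambda>t. finsum k (\<lambda>b. lift H H (f b) t) Bs)"
        by (intro linear_map_pointwise_finsum vs_k Bs lift_linear f Fob_space) auto
      show "linear_map K (Fob F HH) k (lift H H (\<lambda>x y. finsum k (\<lambda>b. f b x y) Bs))"
        by (rule lift_linear[OF b])
      show "finsum k (\<lambda>b. lift H H (f b) (ten x y)) Bs = lift H H (\<lambda>x y. finsum k (\<lambda>b. f b x y) Bs) (ten x y)"
        if "x \<in> carrier A" "y \<in> carrier A" for x y
        unfolding lift_pure[OF H_Ob H_Ob b that]
        by (rule k.M.finsum_cong') (use that bilinear_map_closed[OF f] lift_pure[OF H_Ob H_Ob f] in auto)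
    qed
    from this[OF \<Delta>_closed[OF L_closed]] show ?thesis by (simp add: D_def)
  qed
  show ?thesis
  proof (intro exI[of _ v] conjI ballI)
    fix h c assume h [simp]: "h \<in> carrier A" and c [simp]: "c \<in> Bs"
    show "h \<bullet> v c = finsum A (\<lambda>b. d c (b \<bullet> h) \<odot>\<^bsub>A\<^esub> v b) Bs"
    proof (rule eq_if_linear_forms_eq[OF vs_A fin_dim])
      show "h \<bullet> v c \<in> carrier A" by simp
      show "finsum A (\<lambda>b. d c (b \<bullet> h) \<odot>\<^bsub>A\<^esub> v b) Bs \<in> carrier A" by (rule A.M.finsum_closed) auto
      fix \<phi> assume \<phi>: "linear_map K A k \<phi>"
      note dl = linear_map_comp[OF _ bspec[OF d]] and \<phi>l = linear_map_comp[OF _ \<phi>]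
      have [simp]: "\<phi> x \<in> carrier K" if "x \<in> carrier A" for x using linear_map_closed[OF \<phi> that] by simp
      have "\<phi> (h \<bullet> v c) = D (\<lambda>x y. d c (s y) \<otimes>\<^bsub>K\<^esub> \<phi> (h \<bullet> x)) L"
        by (rule \<phi>v[of c "\<lambda>x. \<phi> (h \<bullet> x)"]) (auto intro!: \<phi>l lins)
      also have "\<dots> = D (\<lambda>x y. d c (s y \<bullet> h) \<otimes>\<^bsub>K\<^esub> \<phi> x) L"
      proof (rule D_integral_balanced[of "\<lambda>x y. d c y \<otimes>\<^bsub>K\<^esub> \<phi> x", OF _ h])
        show "bilinear_map K A A k (\<lambda>x y. d c y \<otimes>\<^bsub>K\<^esub> \<phi> x)"
          by (intro lins \<phi> bspec[OF d]) auto
      qed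
      \<comment> \<open>S(L_2) is expanded in the basis before it is multiplied by h. This splits
        d_c(S(L_2) h) into terms d_c(b h) d_b(S(L_2)), whose last factor is the one defining
        \<open>v b\<close>.\<close>
      also have "\<dots> = D (\<lambda>x y. finsum k (\<lambda>b. d c (b \<bullet> h) \<otimes>\<^bsub>K\<^esub> (d b (s y) \<otimes>\<^bsub>K\<^esub> \<phi> x)) Bs) L"
      proof (rule D_cong)
        fix x y assume [simp]: "x \<in> carrier A" "y \<in> carrier A"
        have "linear_map K A k (\<lambda>z. d c (z \<bullet> h) \<otimes>\<^bsub>K\<^esub> \<phi> x)"
          by (intro lins dl) auto
        from linear_map_finsum[OF this Bs(1), of "\<lambda>b. d b (s y) \<odot>\<^bsub>A\<^esub> b"]
        have "d c (s y \<bullet> h) \<otimes>\<^bsub>K\<^esub> \<phi> x = finsum k (\<lambda>b. d c ((d b (s y) \<odot>\<^bsub>A\<^esub> b) \<bullet> h) \<otimes>\<^bsub>K\<^esub> \<phi> x) Bs"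
          using sum by simp
        also have "\<dots> = finsum k (\<lambda>b. d c (b \<bullet> h) \<otimes>\<^bsub>K\<^esub> (d b (s y) \<otimes>\<^bsub>K\<^esub> \<phi> x)) Bs"
        proof (rule k.M.finsum_cong')
          fix b assume b [simp]: "b \<in> Bs"
          have "d c ((d b (s y) \<odot>\<^bsub>A\<^esub> b) \<bullet> h) = d b (s y) \<otimes>\<^bsub>K\<^esub> d c (b \<bullet> h)"
            using linear_map_smult[OF dl[OF lin_mul_left[OF h lin_A] c], of "d b (s y)" b] by simp
          then show "d c ((d b (s y) \<odot>\<^bsub>A\<^esub> b) \<bullet> h) \<otimes>\<^bsub>K\<^esub> \<phi> x = d c (b \<bullet> h) \<otimes>\<^bsub>K\<^esub> (d b (s y) \<otimes>\<^bsub>K\<^esub> \<phi> x)"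
            by (simp add: m_ac)
        qed auto
        finally show "d c (s y \<bullet> h) \<otimes>\<^bsub>K\<^esub> \<phi> x = finsum k (\<lambda>b. d c (b \<bullet> h) \<otimes>\<^bsub>K\<^esub> (d b (s y) \<otimes>\<^bsub>K\<^esub> \<phi> x)) Bs" .
      qed
      also have "\<dots> = finsum k (\<lambda>b. D (\<lambda>x y. d c (b \<bullet> h) \<otimes>\<^bsub>K\<^esub> (d b (s y) \<otimes>\<^bsub>K\<^esub> \<phi> x)) L) Bs"
        by (rule D_sum[symmetric], intro lins dl \<phi>) auto
      also have "\<dots> = finsum k (\<lambda>b. \<phi> (d c (b \<bullet> h) \<odot>\<^bsub>A\<^esub> v b)) Bs"
      proof (rule k.M.finsum_cong')
        fix b assume b [simp]: "b \<in> Bs"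
        have "D (\<lambda>x y. d c (b \<bullet> h) \<otimes>\<^bsub>K\<^esub> (d b (s y) \<otimes>\<^bsub>K\<^esub> \<phi> x)) L
          = d c (b \<bullet> h) \<otimes>\<^bsub>K\<^esub> D (\<lambda>x y. d b (s y) \<otimes>\<^bsub>K\<^esub> \<phi> x) L"
          by (rule D_scale) (auto intro!: lins dl \<phi>)
        then show "D (\<lambda>x y. d c (b \<bullet> h) \<otimes>\<^bsub>K\<^esub> (d b (s y) \<otimes>\<^bsub>K\<^esub> \<phi> x)) L = \<phi> (d c (b \<bullet> h) \<odot>\<^bsub>A\<^esub> v b)"
          using \<phi>v[OF b \<phi>] linear_map_smult[OF \<phi>] by simp
      qed auto
      also have "\<dots> = \<phi> (finsum A (\<lambda>b. d c (b \<bullet> h) \<odot>\<^bsub>A\<^esub> v b) Bs)"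
        by (rule linear_map_finsum[OF \<phi> Bs(1), symmetric]) auto
      finally show "\<phi> (h \<bullet> v c) = \<phi> (finsum A (\<lambda>b. d c (b \<bullet> h) \<odot>\<^bsub>A\<^esub> v b) Bs)" .
    qed
  next
    \<comment> \<open>This sum is L_1 S(L_2), which the antipode axiom evaluates to e(L) 1, and L is
      normalised.\<close>
    show "finsum A (\<lambda>b. v b \<bullet> b) Bs = u"
    proof (rule eq_if_linear_forms_eq[OF vs_A fin_dim])
      show "finsum A (\<lambda>b. v b \<bullet> b) Bs \<in> carrier A" by (rule A.M.finsum_closed) auto
      show "u \<in> carrier A" by simp
      fix \<phi> assume \<phi>: "linear_map K A k \<phi>"
      note dl = linear_map_comp[OF _ bspec[OF d]] and \<phi>l = linear_map_comp[OF _ \<phi>]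
      have [simp]: "\<phi> x \<in> carrier K" if "x \<in> carrier A" for x using linear_map_closed[OF \<phi> that] by simp
      have "\<phi> (finsum A (\<lambda>b. v b \<bullet> b) Bs) = finsum k (\<lambda>b. \<phi> (v b \<bullet> b)) Bs"
        by (rule linear_map_finsum[OF \<phi> Bs(1)]) auto
      also have "\<dots> = finsum k (\<lambda>b. D (\<lambda>x y. d b (s y) \<otimes>\<^bsub>K\<^esub> \<phi> (x \<bullet> b)) L) Bs"
        by (rule k.M.finsum_cong') (auto intro!: \<phi>v \<phi>l lins D_closed dl)
      also have "\<dots> = D (\<lambda>x y. finsum k (\<lambda>b. d b (s y) \<otimes>\<^bsub>K\<^esub> \<phi> (x \<bullet> b)) Bs) L"
        by (rule D_sum, intro lins dl \<phi>l) auto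
      also have "\<dots> = D (\<lambda>x y. \<phi> (x \<bullet> s y)) L"
      proof (rule D_cong)
        fix x y assume x [simp]: "x \<in> carrier A" and y [simp]: "y \<in> carrier A"
        have l: "linear_map K A k (\<lambda>z. \<phi> (x \<bullet> z))" by (intro \<phi>l lins) auto
        from linear_map_finsum[OF l Bs(1), of "\<lambda>b. d b (s y) \<odot>\<^bsub>A\<^esub> b"]
        have "\<phi> (x \<bullet> s y) = finsum k (\<lambda>b. \<phi> (x \<bullet> (d b (s y) \<odot>\<^bsub>A\<^esub> b))) Bs"
          using sum by simp
        also have "\<dots> = finsum k (\<lambda>b. d b (s y) \<otimes>\<^bsub>K\<^esub> \<phi> (x \<bullet> b)) Bs"
          by (rule k.M.finsum_cong') (use linear_map_smult[OF l] in auto)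
        finally show "finsum k (\<lambda>b. d b (s y) \<otimes>\<^bsub>K\<^esub> \<phi> (x \<bullet> b)) Bs = \<phi> (x \<bullet> s y)" by simp
      qed
      also have "\<dots> = \<phi> u" using D_antipode_right[OF \<phi> L_closed] eL by simp
      finally show "\<phi> (finsum A (\<lambda>b. v b \<bullet> b) Bs) = \<phi> u" .
    qed
  qed simp
qed

end

end

section \<open>Modules\<close>

text \<open>Modules may be infinite-dimensional, hence Zorn's lemma: take \<open>X\<close> maximal
  among the subspaces meeting \<open>N\<close> in zero. If x were not in N + X, adjoining x to
  \<open>X\<close> would keep the intersection zero, since an element a x + y of \<open>N\<close>
  with a nonzero can be solved for x.\<close>

lemma subspace_complement_exists:
  assumes V: "vectorspace K V" and N: "VectorSpace.subspace K N V"
  shows "\<exists>N'. VectorSpace.subspace K N' V \<and> N \<inter> N' = {\<zero>\<^bsub>V\<^esub>} \<and>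
    (\<forall>x\<in>carrier V. \<exists>y\<in>N. \<exists>z\<in>N'. x = y \<oplus>\<^bsub>V\<^esub> z)"
proof -
  interpret vectorspace K V by fact
  have submod: "VectorSpace.subspace K X V \<longleftrightarrow> LinearCombinations.submodule K X V" for X
    using V by (simp add: VectorSpace.subspace_def)
  have sN: "LinearCombinations.submodule K N V" using N by (simp add: submod)
  note Nc = submodule.subset[OF sN]
  let ?S = "{X. LinearCombinations.submodule K X V \<and> N \<inter> X = {\<zero>\<^bsub>V\<^esub>}}"
  have "\<exists>X\<in>?S. \<forall>Y\<in>?S. X \<subseteq> Y \<longrightarrow> Y = X"
  proof (rule subset_Zorn_nonempty)
    have "LinearCombinations.submodule K {\<zero>\<^bsub>V\<^esub>} V"
      by (rule submodule.intro) (auto intro: module_axioms)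
    then have "{\<zero>\<^bsub>V\<^esub>} \<in> ?S" using submodule.zero_closed[OF sN] by auto
    then show "?S \<noteq> {}" by blast
  next
    fix c assume c: "c \<noteq> {}" "subset.chain ?S c"
    have cS: "X \<in> ?S" if "X \<in> c" for X using c(2) that by (auto simp: subset_chain_def)
    have lin: "X \<subseteq> Y \<or> Y \<subseteq> X" if "X \<in> c" "Y \<in> c" for X Y using c(2) that by (auto simp: subset_chain_def)
    have sub: "LinearCombinations.submodule K X V" if "X \<in> c" for X using cS[OF that] by simp
    have "LinearCombinations.submodule K (\<Union>c) V"
    proof (rule submodule.intro)
      show "module K V" by (rule module_axioms)
      show "\<Union>c \<subseteq> carrier V" using submodule.subset[OF sub] by blast
      show "\<zero>\<^bsub>V\<^esub> \<in> \<Union>c" using c(1) submodule.zero_closed[OF sub] by blast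
      show "v \<oplus>\<^bsub>V\<^esub> w \<in> \<Union>c" if vw: "v \<in> \<Union>c" "w \<in> \<Union>c" for v w
      proof -
        obtain X Y where XY: "X \<in> c" "v \<in> X" "Y \<in> c" "w \<in> Y" using vw by blast
        then obtain Z where "Z \<in> c" "v \<in> Z" "w \<in> Z" using lin[OF XY(1,3)] by blast
        then show ?thesis using submodule.m_closed[OF sub] by blast
      qed
      show "a \<odot>\<^bsub>V\<^esub> v \<in> \<Union>c" if "a \<in> carrier K" "v \<in> \<Union>c" for a v
        using that submodule.smult_closed[OF sub] by blast
    qed
    moreover have "N \<inter> \<Union>c = {\<zero>\<^bsub>V\<^esub>}" using c(1) cS by blast
    ultimately show "\<Union>c \<in> ?S" by simp
  qed
  then obtain X where X: "X \<in> ?S" "\<forall>Y\<in>?S. X \<subseteq> Y \<longrightarrow> Y = X" by (rule bexE)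
  then have sX: "LinearCombinations.submodule K X V" and NX: "N \<inter> X = {\<zero>\<^bsub>V\<^esub>}" by simp_all
  have max: "Y = X" if "LinearCombinations.submodule K Y V" "N \<inter> Y = {\<zero>\<^bsub>V\<^esub>}" "X \<subseteq> Y" for Y
    using X(2) that by simp
  note Xc = submodule.subset[OF sX]
  have N_minus: "\<ominus>\<^bsub>V\<^esub> v \<in> Y" if "LinearCombinations.submodule K Y V" "v \<in> Y" for v Y
  proof -
    have "v \<in> carrier V" using submodule.subset[OF that(1)] that(2) by blast
    then have "\<ominus>\<^bsub>V\<^esub> v = (\<ominus>\<^bsub>K\<^esub> \<one>\<^bsub>K\<^esub>) \<odot>\<^bsub>V\<^esub> v" by (simp add: smult_l_minus)
    then show ?thesis using submodule.smult_closed[OF that(1) _ that(2)] by simp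
  qed
  have "\<exists>y\<in>N. \<exists>z\<in>X. x = y \<oplus>\<^bsub>V\<^esub> z" if x: "x \<in> carrier V" for x
  proof (rule ccontr)
    assume no: "\<not> ?thesis"
    \<comment> \<open>The enlargement K x + X that contradicts maximality.\<close>
    let ?Y = "{a \<odot>\<^bsub>V\<^esub> x \<oplus>\<^bsub>V\<^esub> y | a y. a \<in> carrier K \<and> y \<in> X}"
    have sY: "LinearCombinations.submodule K ?Y V"
    proof (rule submodule.intro)
      show "module K V" by (rule module_axioms)
      show "?Y \<subseteq> carrier V" using x Xc by auto
      show "\<zero>\<^bsub>V\<^esub> \<in> ?Y"
        using x submodule.zero_closed[OF sX] by (intro CollectI exI[of _ "\<zero>\<^bsub>K\<^esub>"] exI[of _ "\<zero>\<^bsub>V\<^esub>"]) simp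
      show "v \<oplus>\<^bsub>V\<^esub> w \<in> ?Y" if vw: "v \<in> ?Y" "w \<in> ?Y" for v w
      proof -
        obtain a y b z where e: "v = a \<odot>\<^bsub>V\<^esub> x \<oplus>\<^bsub>V\<^esub> y" "w = b \<odot>\<^bsub>V\<^esub> x \<oplus>\<^bsub>V\<^esub> z"
          and m: "a \<in> carrier K" "b \<in> carrier K" "y \<in> X" "z \<in> X" using vw by blast
        have yz: "y \<in> carrier V" "z \<in> carrier V" using m Xc by auto
        have "v \<oplus>\<^bsub>V\<^esub> w = (a \<oplus>\<^bsub>K\<^esub> b) \<odot>\<^bsub>V\<^esub> x \<oplus>\<^bsub>V\<^esub> (y \<oplus>\<^bsub>V\<^esub> z)"
          using m yz x by (simp add: e smult_l_distr M.a_ac)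
        then show ?thesis using m submodule.m_closed[OF sX] by blast
      qed
      show "c \<odot>\<^bsub>V\<^esub> v \<in> ?Y" if c: "c \<in> carrier K" and v: "v \<in> ?Y" for c v
      proof -
        obtain a y where e: "v = a \<odot>\<^bsub>V\<^esub> x \<oplus>\<^bsub>V\<^esub> y" and m: "a \<in> carrier K" "y \<in> X" using v by blast
        have y: "y \<in> carrier V" using m Xc by auto
        have "c \<odot>\<^bsub>V\<^esub> v = (c \<otimes>\<^bsub>K\<^esub> a) \<odot>\<^bsub>V\<^esub> x \<oplus>\<^bsub>V\<^esub> c \<odot>\<^bsub>V\<^esub> y"
          using m y x c by (simp add: e smult_r_distr smult_assoc1)
        then show ?thesis using m c submodule.smult_closed[OF sX] by blast
      qed
    qed
    have "N \<inter> ?Y = {\<zero>\<^bsub>V\<^esub>}"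
    proof
      show "{\<zero>\<^bsub>V\<^esub>} \<subseteq> N \<inter> ?Y" using submodule.zero_closed[OF sN] submodule.zero_closed[OF sY] by simp
      show "N \<inter> ?Y \<subseteq> {\<zero>\<^bsub>V\<^esub>}"
      proof
        fix n assume "n \<in> N \<inter> ?Y"
        then obtain a y where n: "n \<in> N" and e: "n = a \<odot>\<^bsub>V\<^esub> x \<oplus>\<^bsub>V\<^esub> y" and a: "a \<in> carrier K" and y: "y \<in> X" by blast
        have nV: "n \<in> carrier V" and yV: "y \<in> carrier V" using n y Nc Xc by auto
        show "n \<in> {\<zero>\<^bsub>V\<^esub>}"
        proof (cases "a = \<zero>\<^bsub>K\<^esub>")
          case True
          then have "n = y" using e x yV by simp
          then show ?thesis using n y NX by blast
        next
          case False
          then have ia: "inv\<^bsub>K\<^esub> a \<in> carrier K" "inv\<^bsub>K\<^esub> a \<otimes>\<^bsub>K\<^esub> a = \<one>\<^bsub>K\<^esub>" using a field_Units by auto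
          have "inv\<^bsub>K\<^esub> a \<odot>\<^bsub>V\<^esub> n = x \<oplus>\<^bsub>V\<^esub> inv\<^bsub>K\<^esub> a \<odot>\<^bsub>V\<^esub> y"
            using ia a x yV by (simp add: e smult_r_distr flip: smult_assoc1)
          then have "x = inv\<^bsub>K\<^esub> a \<odot>\<^bsub>V\<^esub> n \<oplus>\<^bsub>V\<^esub> \<ominus>\<^bsub>V\<^esub> (inv\<^bsub>K\<^esub> a \<odot>\<^bsub>V\<^esub> y)"
            using ia x yV by (simp add: M.a_assoc M.r_neg)
          moreover have "inv\<^bsub>K\<^esub> a \<odot>\<^bsub>V\<^esub> n \<in> N" using submodule.smult_closed[OF sN ia(1) n] .
          moreover have "\<ominus>\<^bsub>V\<^esub> (inv\<^bsub>K\<^esub> a \<odot>\<^bsub>V\<^esub> y) \<in> X"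
            by (rule N_minus[OF sX submodule.smult_closed[OF sX ia(1) y]])
          ultimately show ?thesis using no by blast
        qed
      qed
    qed
    moreover have "X \<subseteq> ?Y"
    proof
      fix y assume y: "y \<in> X"
      then have "y = \<zero>\<^bsub>K\<^esub> \<odot>\<^bsub>V\<^esub> x \<oplus>\<^bsub>V\<^esub> y" using x Xc by auto
      then show "y \<in> ?Y" using y by blast
    qed
    ultimately have "?Y = X" by (intro max[OF sY])
    moreover have "x \<in> ?Y"
      using x submodule.zero_closed[OF sX] by (intro CollectI exI[of _ "\<one>\<^bsub>K\<^esub>"] exI[of _ "\<zero>\<^bsub>V\<^esub>"]) simp
    ultimately have "x \<in> X" by simp
    moreover have "x = \<zero>\<^bsub>V\<^esub> \<oplus>\<^bsub>V\<^esub> x" using x by simp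
    ultimately show False using no submodule.zero_closed[OF sN] by blast
  qed
  then show ?thesis using sX NX submod by blast
qed

lemma linear_projection_exists:
  assumes V: "vectorspace K V" and N: "VectorSpace.subspace K N V"
  shows "\<exists>p. linear_map K V V p \<and> (\<forall>x\<in>carrier V. p x \<in> N) \<and> (\<forall>x\<in>N. p x = x)"
proof -
  interpret vectorspace K V by fact
  obtain X where X: "VectorSpace.subspace K X V" and NX: "N \<inter> X = {\<zero>\<^bsub>V\<^esub>}"
    and ex: "\<forall>x\<in>carrier V. \<exists>y\<in>N. \<exists>z\<in>X. x = y \<oplus>\<^bsub>V\<^esub> z"
    using subspace_complement_exists[OF V N] by blast
  have sN: "LinearCombinations.submodule K N V" and sX: "LinearCombinations.submodule K X V"
    using N X by (auto simp: VectorSpace.subspace_def)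
  note Nc = subsetD[OF submodule.subset[OF sN]] and Xc = subsetD[OF submodule.subset[OF sX]]
  have uniq: "y = y'" if m: "y \<in> N" "y' \<in> N" "z \<in> X" "z' \<in> X" and eq: "y \<oplus>\<^bsub>V\<^esub> z = y' \<oplus>\<^bsub>V\<^esub> z'" for y y' z z'
  proof -
    have c: "y \<in> carrier V" "y' \<in> carrier V" "z \<in> carrier V" "z' \<in> carrier V" using m Nc Xc by auto
    have neg: "(\<ominus>\<^bsub>K\<^esub> \<one>\<^bsub>K\<^esub>) \<odot>\<^bsub>V\<^esub> v = \<ominus>\<^bsub>V\<^esub> v" if "v \<in> carrier V" for v using that by (simp add: smult_l_minus)
    have "y \<oplus>\<^bsub>V\<^esub> \<ominus>\<^bsub>V\<^esub> y' = (y \<oplus>\<^bsub>V\<^esub> z) \<oplus>\<^bsub>V\<^esub> (\<ominus>\<^bsub>V\<^esub> z \<oplus>\<^bsub>V\<^esub> \<ominus>\<^bsub>V\<^esub> y')"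
      using c by (simp add: M.a_assoc M.r_neg2)
    also have "\<dots> = (y' \<oplus>\<^bsub>V\<^esub> z') \<oplus>\<^bsub>V\<^esub> (\<ominus>\<^bsub>V\<^esub> z \<oplus>\<^bsub>V\<^esub> \<ominus>\<^bsub>V\<^esub> y')" by (simp only: eq)
    also have "\<dots> = (y' \<oplus>\<^bsub>V\<^esub> \<ominus>\<^bsub>V\<^esub> y') \<oplus>\<^bsub>V\<^esub> (z' \<oplus>\<^bsub>V\<^esub> \<ominus>\<^bsub>V\<^esub> z)" using c by (simp add: M.a_ac)
    also have "\<dots> = z' \<oplus>\<^bsub>V\<^esub> \<ominus>\<^bsub>V\<^esub> z" using c by (simp add: M.r_neg)
    finally have *: "y \<oplus>\<^bsub>V\<^esub> \<ominus>\<^bsub>V\<^esub> y' = z' \<oplus>\<^bsub>V\<^esub> \<ominus>\<^bsub>V\<^esub> z" .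
    have "y \<oplus>\<^bsub>V\<^esub> \<ominus>\<^bsub>V\<^esub> y' \<in> N"
      using submodule.m_closed[OF sN m(1) submodule.smult_closed[OF sN _ m(2), of "\<ominus>\<^bsub>K\<^esub> \<one>\<^bsub>K\<^esub>"]] c by (simp add: neg)
    moreover have "z' \<oplus>\<^bsub>V\<^esub> \<ominus>\<^bsub>V\<^esub> z \<in> X"
      using submodule.m_closed[OF sX m(4) submodule.smult_closed[OF sX _ m(3), of "\<ominus>\<^bsub>K\<^esub> \<one>\<^bsub>K\<^esub>"]] c by (simp add: neg)
    ultimately have "y \<oplus>\<^bsub>V\<^esub> \<ominus>\<^bsub>V\<^esub> y' = \<zero>\<^bsub>V\<^esub>" using * NX by auto
    then show ?thesis using c M.minus_equality[of y "\<ominus>\<^bsub>V\<^esub> y'"] by simp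
  qed
  \<comment> \<open>The N-component along the complement \<open>X\<close>. By \<open>uniq\<close>
    there is only one candidate, so the choice is additive and homogeneous.\<close>
  define p where "p x = (SOME y. y \<in> N \<and> (\<exists>z\<in>X. x = y \<oplus>\<^bsub>V\<^esub> z))" for x
  have p: "p x \<in> N" "\<exists>z\<in>X. x = p x \<oplus>\<^bsub>V\<^esub> z" if "x \<in> carrier V" for x
  proof -
    have "\<exists>y. y \<in> N \<and> (\<exists>z\<in>X. x = y \<oplus>\<^bsub>V\<^esub> z)" using ex that by blast
    from someI_ex[OF this] show "p x \<in> N" "\<exists>z\<in>X. x = p x \<oplus>\<^bsub>V\<^esub> z" unfolding p_def by auto
  qed
  have p_eq: "p x = y" if "y \<in> N" "z \<in> X" "x = y \<oplus>\<^bsub>V\<^esub> z" for x y z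
  proof -
    have x: "x \<in> carrier V" using that Nc Xc by auto
    obtain z' where "z' \<in> X" "x = p x \<oplus>\<^bsub>V\<^esub> z'" using p(2)[OF x] by blast
    then show ?thesis using uniq[OF p(1)[OF x] that(1) _ that(2)] that(3) by simp
  qed
  have "linear_map K V V p"
  proof (rule linear_mapI[OF V V])
    show "p x \<in> carrier V" if "x \<in> carrier V" for x using p(1)[OF that] Nc by auto
  next
    fix x x' assume x: "x \<in> carrier V" "x' \<in> carrier V"
    obtain z z' where z: "z \<in> X" "x = p x \<oplus>\<^bsub>V\<^esub> z" "z' \<in> X" "x' = p x' \<oplus>\<^bsub>V\<^esub> z'"
      using p(2)[OF x(1)] p(2)[OF x(2)] by blast
    have c: "p x \<in> carrier V" "p x' \<in> carrier V" "z \<in> carrier V" "z' \<in> carrier V"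
      using p(1) x z Nc Xc by auto
    have "x \<oplus>\<^bsub>V\<^esub> x' = (p x \<oplus>\<^bsub>V\<^esub> z) \<oplus>\<^bsub>V\<^esub> (p x' \<oplus>\<^bsub>V\<^esub> z')" using z by simp
    also have "\<dots> = (p x \<oplus>\<^bsub>V\<^esub> p x') \<oplus>\<^bsub>V\<^esub> (z \<oplus>\<^bsub>V\<^esub> z')" using c by (simp add: M.a_ac)
    finally show "p (x \<oplus>\<^bsub>V\<^esub> x') = p x \<oplus>\<^bsub>V\<^esub> p x'"
      by (intro p_eq[of _ "z \<oplus>\<^bsub>V\<^esub> z'"] submodule.m_closed[OF sN] submodule.m_closed[OF sX] p(1) x z)
  next
    fix a x assume a: "a \<in> carrier K" and x: "x \<in> carrier V"
    obtain z where z: "z \<in> X" "x = p x \<oplus>\<^bsub>V\<^esub> z" using p(2)[OF x] by blast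
    have c: "p x \<in> carrier V" "z \<in> carrier V" using p(1) x z Nc Xc by auto
    have "a \<odot>\<^bsub>V\<^esub> x = a \<odot>\<^bsub>V\<^esub> (p x \<oplus>\<^bsub>V\<^esub> z)" using z by simp
    also have "\<dots> = a \<odot>\<^bsub>V\<^esub> p x \<oplus>\<^bsub>V\<^esub> a \<odot>\<^bsub>V\<^esub> z" using c a by (simp add: smult_r_distr)
    finally show "p (a \<odot>\<^bsub>V\<^esub> x) = a \<odot>\<^bsub>V\<^esub> p x"
      by (intro p_eq[of _ "a \<odot>\<^bsub>V\<^esub> z"] submodule.smult_closed[OF sN] submodule.smult_closed[OF sX] p(1) x z a)
  qed
  moreover have "p x = x" if "x \<in> N" for x
    using that submodule.zero_closed[OF sX] Nc[OF that] by (intro p_eq[of _ "\<zero>\<^bsub>V\<^esub>"]) auto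
  ultimately show ?thesis using p(1) by blast
qed

text \<open>\<open>\<Sum> v\<^sub>b \<otimes> b\<close> is a separability idempotent, given by its coordinates in the second leg.\<close>

lemma semisimple_if_separable:
  fixes R :: "('k, 'v) module" and K :: "'k ring"
  assumes R: "vectorspace K R" and mult: "bilinear_map K R R R (mult R)"
    and Bs: "finite Bs" "Bs \<subseteq> carrier R" and d: "\<forall>b\<in>Bs. linear_map K R (scalar_space K) (d b)"
    and sum: "\<forall>x\<in>carrier R. finsum R (\<lambda>b. d b x \<odot>\<^bsub>R\<^esub> b) Bs = x"
    and v: "\<forall>b\<in>Bs. v b \<in> carrier R"
    and bal: "\<forall>h\<in>carrier R. \<forall>c\<in>Bs. h \<otimes>\<^bsub>R\<^esub> v c = finsum R (\<lambda>b. d c (b \<otimes>\<^bsub>R\<^esub> h) \<odot>\<^bsub>R\<^esub> v b) Bs"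
    and norm: "finsum R (\<lambda>b. v b \<otimes>\<^bsub>R\<^esub> b) Bs = \<one>\<^bsub>R\<^esub>"
  shows "semisimple_algebra TYPE('m) K R"
  unfolding semisimple_algebra_def
proof (intro allI impI)
  fix M :: "('k, 'm) module" and act N
  assume M: "algebra_module K R M act" and N: "algebra_submodule K R M act N"
  have vM: "vectorspace K M" and act: "bilinear_map K R M M act"
    and act_mult: "\<And>g h x. g \<in> carrier R \<Longrightarrow> h \<in> carrier R \<Longrightarrow> x \<in> carrier M \<Longrightarrow> act (g \<otimes>\<^bsub>R\<^esub> h) x = act g (act h x)"
    and act_one: "\<And>x. x \<in> carrier M \<Longrightarrow> act \<one>\<^bsub>R\<^esub> x = x"
    using M by (auto simp: algebra_module_def)
  interpret M: vectorspace K M by (rule vM)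
  interpret R: vectorspace K R by (rule R)
  have sN: "VectorSpace.subspace K N M" and actN: "\<And>h x. h \<in> carrier R \<Longrightarrow> x \<in> N \<Longrightarrow> act h x \<in> N"
    using N by (auto simp: algebra_submodule_def)
  then have mN: "LinearCombinations.submodule K N M" by (simp add: VectorSpace.subspace_def)
  note Nc = subsetD[OF submodule.subset[OF mN]]
  obtain p where p: "linear_map K M M p" and pN: "\<And>x. x \<in> carrier M \<Longrightarrow> p x \<in> N" and pid: "\<And>x. x \<in> N \<Longrightarrow> p x = x"
    using linear_projection_exists[OF vM sN] by blast
  note pc [simp] = linear_map_closed[OF p] and actc [simp] = bilinear_map_closed[OF act]
    and multc [simp] = bilinear_map_closed[OF mult]
  have BsR [simp]: "b \<in> carrier R" if "b \<in> Bs" for b using Bs(2) that by auto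
  have vR [simp]: "v b \<in> carrier R" if "b \<in> Bs" for b using v that by auto
  have dK [simp]: "d b x \<in> carrier K" if "b \<in> Bs" "x \<in> carrier R" for b x
    using linear_map_closed[of K R "scalar_space K" "d b" x] d that by auto
  \<comment> \<open>The averaged projection. The separability idempotent acts on both sides of
    \<open>p\<close>, with its legs \<open>v b\<close> after and \<open>b\<close> before it.\<close>
  define q where "q x = finsum M (\<lambda>b. act (v b) (p (act b x))) Bs" for x
  have q: "linear_map K M M q"
    unfolding q_def
    by (intro linear_map_pointwise_finsum[OF vM vM Bs(1)]
        linear_map_comp[OF linear_map_comp[OF bilinear_map_right[OF act] p] bilinear_map_right[OF act]]) auto
  note qc [simp] = linear_map_closed[OF q]
  have qN: "q x \<in> N" if "x \<in> carrier M" for x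
    unfolding q_def by (rule submodule_finsum_closed[OF mN Bs(1)]) (use that in \<open>auto intro!: actN pN\<close>)
  \<comment> \<open>On \<open>N\<close> the projection does nothing to b x, so the average is
    multiplication by the sum of the v_b b, which is 1.\<close>
  have qid: "q x = x" if x: "x \<in> N" for x
  proof -
    have xM: "x \<in> carrier M" using Nc x .
    have "q x = finsum M (\<lambda>b. act (v b \<otimes>\<^bsub>R\<^esub> b) x) Bs"
      unfolding q_def by (rule M.M.finsum_cong') (use x xM in \<open>auto simp: act_mult pid actN\<close>)
    also have "\<dots> = act (finsum R (\<lambda>b. v b \<otimes>\<^bsub>R\<^esub> b) Bs) x"
      by (rule linear_map_finsum[OF bilinear_map_left[OF act xM] Bs(1), symmetric]) auto
    finally show ?thesis using xM by (simp add: norm act_one)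
  qed
  \<comment> \<open>Both sides carry the same coefficients d_c(b h): on the left they come from
    expanding b h in the basis, on the right from \<open>bal\<close>. An interchange of the two
    finite sums matches them.\<close>
  have q_act: "q (act h x) = act h (q x)" if h: "h \<in> carrier R" and x: "x \<in> carrier M" for h x
  proof -
    have "q (act h x) = finsum M (\<lambda>b. finsum M (\<lambda>c. d c (b \<otimes>\<^bsub>R\<^esub> h) \<odot>\<^bsub>M\<^esub> act (v b) (p (act c x))) Bs) Bs"
      unfolding q_def
    proof (rule M.M.finsum_cong')
      fix b assume b [simp]: "b \<in> Bs"
      have l: "linear_map K R M (\<lambda>y. act (v b) (p (act y x)))"
        by (intro linear_map_comp[OF linear_map_comp[OF bilinear_map_left[OF act x] p] bilinear_map_right[OF act]]) auto
      have "act (v b) (p (act b (act h x)))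
        = act (v b) (p (act (finsum R (\<lambda>c. d c (b \<otimes>\<^bsub>R\<^esub> h) \<odot>\<^bsub>R\<^esub> c) Bs) x))"
        using sum h x by (simp add: act_mult)
      also have "\<dots> = finsum M (\<lambda>c. act (v b) (p (act (d c (b \<otimes>\<^bsub>R\<^esub> h) \<odot>\<^bsub>R\<^esub> c) x))) Bs"
        by (rule linear_map_finsum[OF l Bs(1)]) (use h in auto)
      also have "\<dots> = finsum M (\<lambda>c. d c (b \<otimes>\<^bsub>R\<^esub> h) \<odot>\<^bsub>M\<^esub> act (v b) (p (act c x))) Bs"
        by (rule M.M.finsum_cong') (use h x linear_map_smult[OF l] in auto)
      finally show "act (v b) (p (act b (act h x)))
        = finsum M (\<lambda>c. d c (b \<otimes>\<^bsub>R\<^esub> h) \<odot>\<^bsub>M\<^esub> act (v b) (p (act c x))) Bs" .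
    qed (use h x in \<open>auto intro!: M.M.finsum_closed\<close>)
    also have "\<dots> = finsum M (\<lambda>c. finsum M (\<lambda>b. d c (b \<otimes>\<^bsub>R\<^esub> h) \<odot>\<^bsub>M\<^esub> act (v b) (p (act c x))) Bs) Bs"
      by (rule M.M.add.finprod_finprod_swap) (use Bs h x in auto)
    also have "\<dots> = finsum M (\<lambda>c. act h (act (v c) (p (act c x)))) Bs"
    proof (rule M.M.finsum_cong')
      fix c assume c [simp]: "c \<in> Bs"
      define w where "w = p (act c x)"
      have w [simp]: "w \<in> carrier M" using x by (simp add: w_def)
      note l = bilinear_map_left[OF act w]
      have "act h (act (v c) w) = act (finsum R (\<lambda>b. d c (b \<otimes>\<^bsub>R\<^esub> h) \<odot>\<^bsub>R\<^esub> v b) Bs) w"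
        using bal h by (simp flip: act_mult)
      also have "\<dots> = finsum M (\<lambda>b. act (d c (b \<otimes>\<^bsub>R\<^esub> h) \<odot>\<^bsub>R\<^esub> v b) w) Bs"
        by (rule linear_map_finsum[OF l Bs(1)]) (use h in auto)
      also have "\<dots> = finsum M (\<lambda>b. d c (b \<otimes>\<^bsub>R\<^esub> h) \<odot>\<^bsub>M\<^esub> act (v b) w) Bs"
        by (rule M.M.finsum_cong') (use h linear_map_smult[OF l] in auto)
      finally show "finsum M (\<lambda>b. d c (b \<otimes>\<^bsub>R\<^esub> h) \<odot>\<^bsub>M\<^esub> act (v b) (p (act c x))) Bs = act h (act (v c) (p (act c x)))"
        by (simp add: w_def)
    qed (use h x in auto)
    also have "\<dots> = act h (q x)"
      unfolding q_def by (rule linear_map_finsum[OF bilinear_map_right[OF act h] Bs(1), symmetric]) (use x in auto)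
    finally show ?thesis .
  qed
  \<comment> \<open>The kernel of an equivariant projection onto \<open>N\<close> is a complementary
    submodule.\<close>
  let ?N' = "{x \<in> carrier M. q x = \<zero>\<^bsub>M\<^esub>}"
  have "VectorSpace.subspace K ?N' M"
    using linear_map.kerT_is_subspace[OF q] by (simp add: mod_hom.ker_def[OF linear_map.axioms(3)[OF q]])
  then have "algebra_submodule K R M act ?N'"
    using linear_map_zero[OF bilinear_map_right[OF act]] by (auto simp: algebra_submodule_def q_act)
  moreover have "N \<inter> ?N' = {\<zero>\<^bsub>M\<^esub>}"
    using qid submodule.zero_closed[OF mN] linear_map_zero[OF q] Nc by auto
  moreover have "M.subspace_sum N ?N' = carrier M"
  proof
    show "M.subspace_sum N ?N' \<subseteq> carrier M" using Nc by (auto simp: M.submodule_sum_def)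
    show "carrier M \<subseteq> M.subspace_sum N ?N'"
    proof
      fix x assume x: "x \<in> carrier M"
      \<comment> \<open>\<open>q x\<close> lies in \<open>N\<close>, where \<open>q\<close> is the
        identity, so \<open>q\<close> is idempotent and kills x - q x.\<close>
      have "q (x \<ominus>\<^bsub>M\<^esub> q x) = \<zero>\<^bsub>M\<^esub>"
        using linear_map.T_minus[OF q x qc[OF x]] qid[OF qN[OF x]] x M.M.r_neg[OF qc[OF x]]
        by (simp add: a_minus_def)
      then have "x \<ominus>\<^bsub>M\<^esub> q x \<in> ?N'" using x by simp
      moreover have "x = q x \<oplus>\<^bsub>M\<^esub> (x \<ominus>\<^bsub>M\<^esub> q x)"
        using x by (simp add: M.M.minus_eq M.M.a_ac M.M.r_neg M.M.r_neg1 M.M.r_neg2)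
      ultimately show "x \<in> M.subspace_sum N ?N'" using qN[OF x] unfolding M.submodule_sum_def by force
    qed
  qed
  ultimately show "\<exists>N'. algebra_submodule K R M act N' \<and> N \<inter> N' = {\<zero>\<^bsub>M\<^esub>} \<and> M.subspace_sum N N' = carrier M"
    by blast
qed

text \<open>Split 1 = x + y along ker(e) and a complement. Then e(y) = 1, and h y - e(h) y lies both
  in the complement and in ker(e), hence vanishes. The complement thus delivers a normalised
  integral at once, not merely one of nonzero counit.\<close>

lemma integral_if_semisimple:
  fixes R :: "('k, 'v) module" and K :: "'k ring"
  assumes ss: "semisimple_algebra TYPE('v + 'm) K R"
    and R: "vectorspace K R" and mult: "bilinear_map K R R R (mult R)" and one: "\<one>\<^bsub>R\<^esub> \<in> carrier R"
    and assoc: "\<And>x y z. x \<in> carrier R \<Longrightarrow> y \<in> carrier R \<Longrightarrow> z \<in> carrier R \<Longrightarrow> (x \<otimes>\<^bsub>R\<^esub> y) \<otimes>\<^bsub>R\<^esub> z = x \<otimes>\<^bsub>R\<^esub> (y \<otimes>\<^bsub>R\<^esub> z)"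
    and l_one: "\<And>x. x \<in> carrier R \<Longrightarrow> \<one>\<^bsub>R\<^esub> \<otimes>\<^bsub>R\<^esub> x = x"
    and e: "linear_map K R (scalar_space K) e"
    and e_mult: "\<And>x y. x \<in> carrier R \<Longrightarrow> y \<in> carrier R \<Longrightarrow> e (x \<otimes>\<^bsub>R\<^esub> y) = e x \<otimes>\<^bsub>K\<^esub> e y"
    and e_one: "e \<one>\<^bsub>R\<^esub> = \<one>\<^bsub>K\<^esub>"
  shows "\<exists>x \<in> left_integrals R e. e x = \<one>\<^bsub>K\<^esub>"
proof -
  interpret R: vectorspace K R by (rule R)
  \<comment> \<open>Semisimplicity speaks only about modules on \<open>'v + 'm\<close>, so the
    regular module is copied there along the left injection.\<close>
  define i :: "'v \<Rightarrow> 'v + 'm" where "i = Inl"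
  have [simp]: "projl (i x) = x" and i_eq [simp]: "i x = i y \<longleftrightarrow> x = y" for x y by (auto simp: i_def)
  define M :: "('k, 'v + 'm) module" where "M = \<lparr>carrier = i ` carrier R, mult = undefined, one = undefined,
    zero = i \<zero>\<^bsub>R\<^esub>, add = (\<lambda>x y. i (projl x \<oplus>\<^bsub>R\<^esub> projl y)), smult = (\<lambda>a x. i (a \<odot>\<^bsub>R\<^esub> projl x))\<rparr>"
  have M_simps [simp]: "carrier M = i ` carrier R" "\<zero>\<^bsub>M\<^esub> = i \<zero>\<^bsub>R\<^esub>"
    "x \<oplus>\<^bsub>M\<^esub> y = i (projl x \<oplus>\<^bsub>R\<^esub> projl y)" "a \<odot>\<^bsub>M\<^esub> x = i (a \<odot>\<^bsub>R\<^esub> projl x)" for a x y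
    by (simp_all add: M_def)
  define act :: "'v \<Rightarrow> 'v + 'm \<Rightarrow> 'v + 'm" where "act h x = i (h \<otimes>\<^bsub>R\<^esub> projl x)" for h x
  note multc [simp] = bilinear_map_closed[OF mult] and ec [simp] = linear_map_closed[OF e, simplified]
  have "abelian_group M"
  proof (rule abelian_groupI)
    show "\<exists>y\<in>carrier M. y \<oplus>\<^bsub>M\<^esub> x = \<zero>\<^bsub>M\<^esub>" if "x \<in> carrier M" for x
      using that by (auto intro!: bexI[of _ "\<ominus>\<^bsub>R\<^esub> projl x"] simp: R.M.l_neg)
  qed (auto simp: R.M.a_ac)
  then have "module K M"
    by (intro moduleI) (auto simp: R.smult_l_distr R.smult_r_distr R.smult_assoc1 R.R.is_cring)
  then have vM: "vectorspace K M" using R by (simp add: vectorspace_def)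
  have "bilinear_map K R M M act"
  proof (rule bilinear_mapI)
    show "linear_map K M M (act h)" if "h \<in> carrier R" for h
      using that linear_mapD[OF bilinear_map_right[OF mult that]]
      by (intro linear_mapI vM) (auto simp: act_def)
    show "linear_map K R M (\<lambda>h. act h x)" if x: "x \<in> carrier M" for x
    proof -
      obtain y where y: "y \<in> carrier R" "x = i y" using x by auto
      then show ?thesis using linear_mapD[OF bilinear_map_left[OF mult y(1)]]
        by (intro linear_mapI vM R) (auto simp: act_def)
    qed
  qed
  then have mod: "algebra_module K R M act"
    using vM by (auto simp: algebra_module_def act_def assoc l_one)
  \<comment> \<open>The kernel of the counit, a left ideal because \<open>e\<close> is
    multiplicative.\<close>
  let ?N = "i ` {x \<in> carrier R. e x = \<zero>\<^bsub>K\<^esub>}"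
  have "LinearCombinations.submodule K ?N M"
    using linear_map_zero[OF e] linear_map_add[OF e] linear_map_smult[OF e]
    by (intro submodule.intro \<open>module K M\<close>) auto
  then have "algebra_submodule K R M act ?N"
    using vM by (auto simp: algebra_submodule_def VectorSpace.subspace_def act_def e_mult)
  then obtain N' where N': "algebra_submodule K R M act N'" and int: "?N \<inter> N' = {\<zero>\<^bsub>M\<^esub>}"
    and sum: "module.subspace_sum M ?N N' = carrier M"
    using ss mod unfolding semisimple_algebra_def by blast
  interpret M: vectorspace K M by (rule vM)
  have sN': "LinearCombinations.submodule K N' M" using N' by (simp add: algebra_submodule_def VectorSpace.subspace_def)
  have "i \<one>\<^bsub>R\<^esub> \<in> module.subspace_sum M ?N N'" using sum one by simp
  then obtain z where z: "i \<one>\<^bsub>R\<^esub> = (\<lambda>(x, y). x \<oplus>\<^bsub>M\<^esub> y) z" "z \<in> {(x, y). x \<in> ?N \<and> y \<in> N'}"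
    unfolding M.submodule_sum_def by (rule imageE)
  define n n' where "n = fst z" and "n' = snd z"
  have n: "n \<in> ?N" and n': "n' \<in> N'" and eq: "i \<one>\<^bsub>R\<^esub> = n \<oplus>\<^bsub>M\<^esub> n'"
    using z by (simp_all only: n_def n'_def case_prod_unfold mem_Collect_eq)
  obtain x where x: "x \<in> carrier R" "e x = \<zero>\<^bsub>K\<^esub>" "n = i x" using n by auto
  obtain y where y: "y \<in> carrier R" "n' = i y" using n' submodule.subset[OF sN'] by auto
  have "\<one>\<^bsub>R\<^esub> = x \<oplus>\<^bsub>R\<^esub> y" using eq x y by simp
  then have ey: "e y = \<one>\<^bsub>K\<^esub>" using e_one linear_map_add[OF e x(1) y(1)] x y by simp
  have "h \<otimes>\<^bsub>R\<^esub> y = e h \<odot>\<^bsub>R\<^esub> y" if h: "h \<in> carrier R" for h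
  proof -
    \<comment> \<open>The defect of y from being an integral. It stays in the complement as that is
      a submodule, and its counit is e(h) - e(h) = 0 because e(y) = 1.\<close>
    let ?z = "h \<otimes>\<^bsub>R\<^esub> y \<oplus>\<^bsub>R\<^esub> (\<ominus>\<^bsub>K\<^esub> e h) \<odot>\<^bsub>R\<^esub> y"
    have "act h n' \<in> N'" using N' h n' by (simp add: algebra_submodule_def)
    moreover have "(\<ominus>\<^bsub>K\<^esub> e h) \<odot>\<^bsub>M\<^esub> n' \<in> N'" 
      by (rule submodule.smult_closed[OF sN' _ n']) (use h in simp)
    ultimately have "act h n' \<oplus>\<^bsub>M\<^esub> (\<ominus>\<^bsub>K\<^esub> e h) \<odot>\<^bsub>M\<^esub> n' \<in> N'" by (rule submodule.m_closed[OF sN'])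
    then have "i ?z \<in> N'" using y by (simp add: act_def)
    moreover have "e ?z = \<zero>\<^bsub>K\<^esub>"
      using h y ey linear_map_add[OF e] linear_map_smult[OF e] by (simp add: e_mult R.R.r_neg)
    then have "i ?z \<in> ?N" using h y by auto
    ultimately have "i ?z = \<zero>\<^bsub>M\<^esub>" using int by blast
    then have "?z = \<zero>\<^bsub>R\<^esub>" by simp
    then have "h \<otimes>\<^bsub>R\<^esub> y \<oplus>\<^bsub>R\<^esub> \<ominus>\<^bsub>R\<^esub> (e h \<odot>\<^bsub>R\<^esub> y) = \<zero>\<^bsub>R\<^esub>"
      using h y by (simp add: R.smult_l_minus)
    then show ?thesis using h y R.M.minus_equality[of "h \<otimes>\<^bsub>R\<^esub> y" "\<ominus>\<^bsub>R\<^esub> (e h \<odot>\<^bsub>R\<^esub> y)"] by simp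
  qed
  then have "y \<in> left_integrals R e" using y by (simp add: left_integrals_def)
  then show ?thesis using ey by blast
qed

section \<open>The two implications for the underlying algebra\<close>

context fibred_hopf_algebra
begin

abbreviation R where "R \<equiv> underlying_algebra K F H m \<eta>"

lemma R_simps:
  "carrier R = carrier A" "add R = add A" "zero R = zero A" "smult R = smult A" "mult R = mul" "one R = u"
  by (simp_all add: underlying_algebra_def mul_def[abs_def] u_def)

lemma finsum_R: "finsum R f I = finsum A f I"
  unfolding finsum_def finprod_def by (simp add: R_simps)

lemma vs_R: "vectorspace K R"
proof -
  interpret A: vectorspace K A by (rule vs_A)
  have "abelian_group R"
    by (rule abelian_groupI) (auto simp: R_simps A.M.a_ac intro: A.M.l_neg)
  then have "module K R"
    by (intro moduleI) (auto simp: R_simps A.smult_l_distr A.smult_r_distr A.smult_assoc1 is_cring)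
  then show ?thesis using vs_A by (simp add: vectorspace_def)
qed

text \<open>\<open>R\<close> and \<open>A\<close> are different records that share carrier, addition
  and scalar action, so linear maps transfer between them although the records cannot be
  identified.\<close>

lemma linear_map_from_R: "linear_map K R V f \<longleftrightarrow> linear_map K A V f"
  using vs_A vs_R
  by (auto simp: linear_map_def mod_hom_def mod_hom_axioms_def module_hom_def vectorspace_def R_simps)

lemma linear_map_to_R: "linear_map K V R f \<longleftrightarrow> linear_map K V A f"
  using vs_A vs_R
  by (auto simp: linear_map_def mod_hom_def mod_hom_axioms_def module_hom_def vectorspace_def R_simps)

lemma bilinear_mult_R: "bilinear_map K R R R (mult R)"
  using bilinear_mapI[of A K A A mul, OF lin_mul_right[OF _ lin_A] lin_mul_left[OF _ lin_A]]
  by (simp add: bilinear_map_def linear_map_from_R linear_map_to_R R_simps)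

lemma left_integrals_R: "left_integrals R e = {x. integral x}"
  unfolding left_integrals_def integral_def R_simps ..

lemma semisimple_imp_integral:
  assumes "semisimple_algebra TYPE('v + 'm) K R"
  shows "\<exists>x. integral x \<and> e x = \<one>\<^bsub>K\<^esub>"
proof -
  have "\<exists>x \<in> left_integrals R e. e x = \<one>\<^bsub>K\<^esub>"
    by (rule integral_if_semisimple[OF assms vs_R bilinear_mult_R])
      (use lin_e[OF lin_A] in \<open>simp_all add: R_simps linear_map_from_R mul_ass\<close>)
  then show ?thesis by (simp add: left_integrals_R)
qed

text \<open>The module type is left arbitrary: averaging over the separability idempotent works on
  every module.\<close>

lemma integral_imp_semisimple:
  assumes L: "integral L" "e L \<noteq> \<zero>\<^bsub>K\<^esub>"
  shows "semisimple_algebra TYPE('m) K R"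
proof -
  have LA: "L \<in> carrier A" and Li: "\<forall>x\<in>carrier A. x \<bullet> L = e x \<odot>\<^bsub>A\<^esub> L"
    using L(1) unfolding integral_def by (rule conjunct1, rule conjunct2)
  interpret A: vectorspace K A by (rule vs_A)
  \<comment> \<open>Dividing by e(L) normalises the integral, as the separability idempotent
    requires.\<close>
  define c where "c = inv\<^bsub>K\<^esub> (e L)"
  have c: "c \<in> carrier K" "c \<otimes>\<^bsub>K\<^esub> e L = \<one>\<^bsub>K\<^esub>" using L(2) LA field_Units by (auto simp: c_def)
  have int: "integral (c \<odot>\<^bsub>A\<^esub> L)"
    unfolding integral_def
  proof (intro conjI ballI)
    show "c \<odot>\<^bsub>A\<^esub> L \<in> carrier A" using c LA by simp
    fix h assume h: "h \<in> carrier A"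
    have "h \<bullet> (c \<odot>\<^bsub>A\<^esub> L) = c \<odot>\<^bsub>A\<^esub> (e h \<odot>\<^bsub>A\<^esub> L)"
      using linear_map_smult[OF lin_mul_right[OF h lin_A] c(1) LA] bspec[OF Li h] by simp
    also have "\<dots> = e h \<odot>\<^bsub>A\<^esub> (c \<odot>\<^bsub>A\<^esub> L)"
      using c(1) LA h m_comm[OF c(1) e_closed[OF h]] by (simp flip: A.smult_assoc1)
    finally show "h \<bullet> (c \<odot>\<^bsub>A\<^esub> L) = e h \<odot>\<^bsub>A\<^esub> (c \<odot>\<^bsub>A\<^esub> L)" .
  qed
  have one: "e (c \<odot>\<^bsub>A\<^esub> L) = \<one>\<^bsub>K\<^esub>" using linear_map_smult[OF lin_e[OF lin_A] c(1) LA] c by simp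
  obtain Bs d where Bs: "finite Bs" "Bs \<subseteq> carrier A" and d: "\<forall>b\<in>Bs. linear_map K A k (d b)"
    and sum: "\<forall>x\<in>carrier A. finsum A (\<lambda>b. d b x \<odot>\<^bsub>A\<^esub> b) Bs = x"
    by (rule basis_exists)
  obtain v where v: "\<forall>b\<in>Bs. v b \<in> carrier A"
    "\<forall>h\<in>carrier A. \<forall>c\<in>Bs. h \<bullet> v c = finsum A (\<lambda>b. d c (b \<bullet> h) \<odot>\<^bsub>A\<^esub> v b) Bs"
    "finsum A (\<lambda>b. v b \<bullet> b) Bs = u"
    using separability_elements[OF int one Bs d sum] by blast
  show ?thesis
    by (rule semisimple_if_separable[OF vs_R bilinear_mult_R, of Bs d v])
      (use Bs d sum v in \<open>simp_all add: R_simps linear_map_from_R finsum_R\<close>)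
qed

end

text \<open>The type \<open>'v + 'm\<close> always has room for a copy of the algebra itself, which
  the forward implication tests, and through the arbitrary \<open>'m\<close> for modules as large as
  desired.\<close>

theorem theorem4p1:
  fixes K :: "'v ring"
    and C :: "('o, 'a) braided_cat"
    and F :: "('o, 'a, 'v) vect_functor"
    and H :: 'o and m \<eta> \<Delta> \<epsilon> S :: 'a
  assumes "field K"
    and "braided_tensor_category C"
    and "forgetful_functor K C F"
    and "braided_hopf_algebra C H m \<eta> \<Delta> \<epsilon> S"
    and "vectorspace.fin_dim K (Fob F H)"
  shows "semisimple_algebra TYPE('v + 'm) K (underlying_algebra K F H m \<eta>)
    \<longleftrightarrow> Far F \<epsilon> ` left_integrals (underlying_algebra K F H m \<eta>) (Far F \<epsilon>) \<noteq> {\<zero>\<^bsub>K\<^esub>}"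
proof -
  interpret fibred_hopf_algebra K C F H m \<eta> \<Delta> \<epsilon> S
    using assms
    by (intro fibred_hopf_algebra.intro braided_forgetful_functor.intro fibred_hopf_algebra_axioms.intro)
  interpret A: vectorspace K A by (rule vs_A)
  have e0: "e \<zero>\<^bsub>A\<^esub> = \<zero>\<^bsub>K\<^esub>" using linear_map_zero[OF lin_e[OF lin_A]] by simp
  \<comment> \<open>Zero is an integral with counit zero, so the image is never empty, and being
    different from the zero set means containing a nonzero value.\<close>
  have "integral \<zero>\<^bsub>A\<^esub>"
    unfolding integral_def using linear_map_zero[OF lin_mul_right[OF _ lin_A]] by simp
  then have "e ` left_integrals R e \<noteq> {\<zero>\<^bsub>K\<^esub>} \<longleftrightarrow> (\<exists>x. integral x \<and> e x \<noteq> \<zero>\<^bsub>K\<^esub>)"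
    using e0 by (auto simp: left_integrals_R image_iff)
  then show ?thesis
    using semisimple_imp_integral[where 'm = 'm] integral_imp_semisimple[where 'm = "'v + 'm"] one_not_zero
    unfolding e_def by metis
qed

end
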